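(* Let $X_1,\dots,X_m$ be i.i.d. from a distribution $F^c$ on $[0,\infty)$ with density $f^c$, and let $p(\cdot\mid \mathbf X_m)$ be the posterior of the Dirichlet process mixture (DPM) prior with Gamma kernel and Gamma base measure described in the context. Suppose $f^c$ is continuous and bounded and satisfies: (a) $f^c(x)>0$ for all $x\in(0,\infty)$ and $f^c(x)\le C_f<\infty$ for all $x\in[0,\infty)$; (b) $\left|\int_0^\infty f^c(x)\log f^c(x)\,dx\right|<\infty$; (c) $\int_0^\infty f^c(x)\log\frac{f^c(x)}{\phi_\delta(x)}\,dx<\infty$ for some $\delta>0$, where $\phi_\delta(x)=\inf_{t\in[x,x+\delta)}f^c(t)$ if $0<x<1$ and $\phi_\delta(x)=\inf_{t\in(x-\delta,x]}f^c(t)$ if $x\ge 1$; (d) there exists $\zeta>0$ with $\int_0^\infty \max(x^{-\zeta-2},x^{\zeta+2})f^c(x)\,dx<\infty$. Then the posterior $p(F\mid\mathbf X_m)$ is weakly consistent at $F^c$.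
   Context: DPM prior: a random density is $f(x)=\int h(x\mid\psi)\,dG(\psi)$ where $G\sim DP(\alpha,G_0)$ is a Dirichlet process with dispersion parameter $\alpha>0$ (fixed, or given a $\mathrm{Gamma}(a,b)$ prior) and base distribution $G_0$; equivalently $X_i\mid\psi_i\sim h(\cdot\mid\psi_i)$, $\psi_i\mid G\sim G$, $G\sim DP(\alpha,G_0)$. Gamma kernel: $\psi=(V,u)$ with shape $V>0$ and mean $u>0$, $h(x\mid V,u)=\frac{(V/u)^V}{\Gamma(V)}x^{V-1}e^{-Vx/u}$, $x>0$. Base measure $G_0$: $V\sim\mathrm{Exponential}(\theta)$ and $u\sim\text{Inv-Gamma}(r,s)$ independently, with hyperparameters $\theta,r,s>0$. Weak consistency: the posterior $p(\cdot\mid\mathbf X_m)$ is weakly consistent at $F^c$ if, with $P_{F^c}$-probability one (over the infinite i.i.d. sequence), $p(U\mid\mathbf X_m)\to1$ as $m\to\infty$ for every weak neighborhood $U$ of $F^c$, where a weak neighborhood is any set of densities containing a set of the form $\{f:|\int\phi_i f-\int\phi_i f^c|<\epsilon,\ i=1,\dots,k\}$ with $\phi_i$ bounded continuous, $\epsilon>0$, $k\in\mathbb N$. *)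

theory Defs
  imports "HOL-Probability.Probability"
begin

text \<open>Gamma kernel with shape V and mean u; support (0,inf).\<close>
definition gamma_kernel :: "real \<Rightarrow> real \<Rightarrow> real \<Rightarrow> real" where
  "gamma_kernel V u x =
     (if 0 < x then (V / u) powr V / Gamma V * x powr (V - 1) * exp (- V * x / u) else 0)"

definition inv_gamma_density :: "real \<Rightarrow> real \<Rightarrow> real \<Rightarrow> real" where
  "inv_gamma_density r s u =
     (if 0 < u then s powr r / Gamma r * u powr (- r - 1) * exp (- s / u) else 0)"

definition gamma_density :: "real \<Rightarrow> real \<Rightarrow> real \<Rightarrow> real" where
  "gamma_density a b x =
     (if 0 < x then b powr a / Gamma a * x powr (a - 1) * exp (- b * x) else 0)"

definition beta1_density :: "real \<Rightarrow> real \<Rightarrow> real" where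
  "beta1_density \<alpha> x = (if 0 < x \<and> x < 1 then \<alpha> * (1 - x) powr (\<alpha> - 1) else 0)"

definition base_measure :: "real \<Rightarrow> real \<Rightarrow> real \<Rightarrow> (real \<times> real) measure" where
  "base_measure \<theta> r s =
     density lborel (\<lambda>V. ennreal (exponential_density \<theta> V))
       \<Otimes>\<^sub>M density lborel (\<lambda>u. ennreal (inv_gamma_density r s u))"

text \<open>Parameter: (beta, psi) with beta k ~ Beta(1,alpha) iid and psi k ~ G0 iid.
  G = sum_k w_k delta_{psi_k}, w_k = beta_k prod_{j<k} (1 - beta_j).\<close>
type_synonym dpm_param = "(nat \<Rightarrow> real) \<times> (nat \<Rightarrow> real \<times> real)"

definition stick_weight :: "(nat \<Rightarrow> real) \<Rightarrow> nat \<Rightarrow> real" where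
  "stick_weight \<beta> k = \<beta> k * (\<Prod>j<k. 1 - \<beta> j)"

definition stick_breaking :: "real \<Rightarrow> (real \<times> real) measure \<Rightarrow> dpm_param measure" where
  "stick_breaking \<alpha> G0 =
     (\<Pi>\<^sub>M k\<in>UNIV. density lborel (\<lambda>x. ennreal (beta1_density \<alpha> x)))
       \<Otimes>\<^sub>M (\<Pi>\<^sub>M k\<in>UNIV. G0)"

text \<open>Random mixture density f(x) = int h(x|psi) dG(psi) = sum_k w_k h(x|psi_k).\<close>
definition dpm_density :: "dpm_param \<Rightarrow> real \<Rightarrow> real" where
  "dpm_density p x =
     enn2real (\<Sum>k. ennreal (stick_weight (fst p) k *
        gamma_kernel (fst (snd p k)) (snd (snd p k)) x))"

definition admissible_alpha_prior :: "real measure \<Rightarrow> bool" where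
  "admissible_alpha_prior A \<longleftrightarrow>
     (\<exists>\<alpha>>0. A = return borel \<alpha>) \<or>
     (\<exists>a b. 0 < a \<and> 0 < b \<and> A = density lborel (\<lambda>x. ennreal (gamma_density a b x)))"

definition dpm_prior :: "real measure \<Rightarrow> real \<Rightarrow> real \<Rightarrow> real \<Rightarrow> dpm_param measure" where
  "dpm_prior A \<theta> r s = A \<bind> (\<lambda>\<alpha>. stick_breaking \<alpha> (base_measure \<theta> r s))"

definition posterior :: "dpm_param measure \<Rightarrow> (nat \<Rightarrow> real) \<Rightarrow> nat \<Rightarrow> (real \<Rightarrow> real) set \<Rightarrow> ennreal" where
  "posterior P X m U =
     (\<integral>\<^sup>+ p. indicator {p. dpm_density p \<in> U} p * (\<Prod>i<m. ennreal (dpm_density p (X i))) \<partial>P)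
     / (\<integral>\<^sup>+ p. (\<Prod>i<m. ennreal (dpm_density p (X i))) \<partial>P)"

definition ext0 :: "(real \<Rightarrow> real) \<Rightarrow> real \<Rightarrow> real" where
  "ext0 f x = indicator {0..} x * f x"

definition weak_nbhd :: "(real \<Rightarrow> real) \<Rightarrow> (real \<Rightarrow> real) set \<Rightarrow> bool" where
  "weak_nbhd fc U \<longleftrightarrow>
     (\<exists>(\<Phi> :: (real \<Rightarrow> real) list) (\<epsilon>::real). 0 < \<epsilon> \<and>
        (\<forall>\<phi>\<in>set \<Phi>. continuous_on UNIV \<phi> \<and> bounded (range \<phi>)) \<and>
        {f. \<forall>\<phi>\<in>set \<Phi>. \<bar>(\<integral>x. \<phi> x * f x \<partial>lborel) - (\<integral>x. \<phi> x * ext0 fc x \<partial>lborel)\<bar> < \<epsilon>} \<subseteq> U)"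

definition data_law :: "(real \<Rightarrow> real) \<Rightarrow> real measure" where
  "data_law fc = density lborel (\<lambda>x. ennreal (ext0 fc x))"

definition weakly_consistent :: "dpm_param measure \<Rightarrow> (real \<Rightarrow> real) \<Rightarrow> bool" where
  "weakly_consistent P fc \<longleftrightarrow>
     (AE X in (\<Pi>\<^sub>M i\<in>(UNIV::nat set). data_law fc).
        \<forall>U. weak_nbhd fc U \<longrightarrow> (\<lambda>m. posterior P X m U) \<longlonglongrightarrow> 1)"

definition phi_delta :: "(real \<Rightarrow> real) \<Rightarrow> real \<Rightarrow> real \<Rightarrow> real" where
  "phi_delta fc \<delta> x =
     (if x < 1 then Inf (fc ` {x..<x + \<delta>})
      else Inf (fc ` ({x - \<delta><..x} \<inter> {0..})))"

end

theory Submission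
  imports Defs "HOL-Real_Asymp.Real_Asymp" "HOL-Library.Discrete_Functions"
begin

text \<open>
  The posterior mass of a set of densities is compared with the likelihood of the true density.
  On the complement of a weak neighbourhood, exponentially tilted likelihood ratios have
  exponentially small mean. The denominator is at least a subexponential multiple of the true
  likelihood as soon as the prior charges, for every \<open>\<eta> > 0\<close>, a set of densities bounded below
  by \<open>f\<^sup>c exp (- Y)\<close> for a common \<open>Y \<ge> 0\<close> of mean less than \<open>\<eta>\<close>.

  Such sets are neighbourhoods of finite gamma mixtures. Mixing the kernel of shape \<open>n + 2\<close> over
  its mean with weight \<open>f\<^sup>c\<close> gives functions with pointwise lower limit at least \<open>f\<^sup>c\<close>; discretizing
  the mixture and moving finitely many parameters costs a factor \<open>exp (- \<eta> (x + 1 / x))\<close>, which is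
  harmless because \<open>x + 1 / x\<close> is square integrable under \<open>f\<^sup>c\<close>. A small multiple of the standard
  exponential density in the mixture dominates the log ratio by boundedness of \<open>f\<^sup>c\<close>.
\<close>

section \<open>Sums of independent variables\<close>

text \<open>The log ratio has to be dominated by one function \<open>Y\<close> on a whole set of
  parameters, so that a single application of a limit law bounds the likelihood of all of them at
  once. Only an eventual upper bound on sums of \<open>Y\<close> is needed; as
  \<open>Y \<ge> 0\<close> makes the sums monotone, a variance estimate along the squares yields it.

  Mixing over the mean reproduces the density for the following reason: with
  \<open>v = 1 / u\<close> and the Jacobian \<open>1 / v\<^sup>2\<close>, the kernel of shape
  \<open>n + 2\<close> at \<open>x\<close> becomes, up to a factor near 1, an Erlang density in
  \<open>v\<close> of rate \<open>(n + 2) * x\<close>, concentrated at \<open>1 / x\<close>. All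
  estimates on mixtures are lower bounds. Hence means may be truncated to a compact interval,
  factors above 1 dropped and components moved in one direction only.

  A further obstacle lies in total functions: the prior binds a kernel over all real dispersion
  parameters, and \<open>dpm_density\<close> turns an infinite sum into 0. Nonpositive parameters
  and points of divergence must therefore be shown to be harmless.\<close>

lemma nn_integral_PiM_prod:
  fixes g :: "nat \<Rightarrow> 'a \<Rightarrow> ennreal"
  assumes M: "prob_space M" and J: "finite J" and g: "\<And>i. i \<in> J \<Longrightarrow> g i \<in> borel_measurable M"
  shows "(\<integral>\<^sup>+X. (\<Prod>i\<in>J. g i (X i)) \<partial>(\<Pi>\<^sub>M i\<in>(UNIV::nat set). M)) = (\<Prod>i\<in>J. \<integral>\<^sup>+x. g i x \<partial>M)"
proof -
  interpret product_prob_space "\<lambda>_. M" "UNIV :: nat set"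
    using M by (intro product_prob_spaceI)
  have meas: "(\<lambda>X. \<Prod>i\<in>J. g i (X i)) \<in> borel_measurable (PiM J (\<lambda>_. M))"
    using g by (intro borel_measurable_prod_ennreal) (auto intro!: measurable_compose[OF measurable_component_singleton])
  have "(\<Prod>i\<in>J. \<integral>\<^sup>+x. g i x \<partial>M) = (\<integral>\<^sup>+X. (\<Prod>i\<in>J. g i (X i)) \<partial>(PiM J (\<lambda>_. M)))"
    using product_nn_integral_prod[of J g] J g by simp
  also have "\<dots> = (\<integral>\<^sup>+X. (\<Prod>i\<in>J. g i (X i)) \<partial>(distr (PiM UNIV (\<lambda>_. M)) (PiM J (\<lambda>_. M)) (\<lambda>x. restrict x J)))"
    using distr_PiM_restrict_finite[of J] J by simp
  also have "\<dots> = (\<integral>\<^sup>+X. (\<Prod>i\<in>J. g i (restrict X J i)) \<partial>(PiM UNIV (\<lambda>_. M)))"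
    using meas by (intro nn_integral_distr) (auto intro!: measurable_restrict_subset)
  also have "\<dots> = (\<integral>\<^sup>+X. (\<Prod>i\<in>J. g i (X i)) \<partial>(PiM UNIV (\<lambda>_. M)))"
    by (intro nn_integral_cong prod.cong) auto
  finally show ?thesis by simp
qed

text \<open>Mixed moments factor over distinct coordinates, so the variance is
  \<open>n * (v - \<mu>\<^sup>2)\<close> with \<open>v\<close> the second moment; the bound drops
  the mean. Since \<open>Y \<ge> 0\<close>, every mixed moment can be read off from a nonnegative
  product integral.\<close>

lemma variance_sum_PiM_le:
  fixes Y :: "'a \<Rightarrow> real"
  assumes M: "prob_space M" and [measurable]: "Y \<in> borel_measurable M" and nonneg: "\<And>x. 0 \<le> Y x"
    and sq: "integrable M (\<lambda>x. (Y x)\<^sup>2)"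
  shows "(\<integral>\<^sup>+X. ennreal (((\<Sum>i<n. Y (X i)) - n * (\<integral>x. Y x \<partial>M))\<^sup>2) \<partial>(\<Pi>\<^sub>M i\<in>(UNIV::nat set). M))
    \<le> ennreal (n * (\<integral>x. (Y x)\<^sup>2 \<partial>M))"
proof -
  interpret M: prob_space M by fact
  let ?P = "\<Pi>\<^sub>M i\<in>(UNIV::nat set). M"
  interpret P: prob_space ?P using M by (intro prob_space_PiM)
  define \<mu> where "\<mu> = (\<integral>x. Y x \<partial>M)"
  define v where "v = (\<integral>x. (Y x)\<^sup>2 \<partial>M)"
  have int: "integrable M Y"
    using M.square_integrable_imp_integrable[OF _ sq] by simp
  have mu0: "0 \<le> \<mu>" unfolding \<mu>_def using nonneg by (intro integral_nonneg_AE) auto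
  have v0: "0 \<le> v" unfolding v_def by (intro integral_nonneg_AE) auto
  have nnY: "(\<integral>\<^sup>+x. ennreal (Y x) \<partial>M) = ennreal \<mu>"
    unfolding \<mu>_def using nonneg int by (intro nn_integral_eq_integral) auto
  have nnY2: "(\<integral>\<^sup>+x. ennreal ((Y x)\<^sup>2) \<partial>M) = ennreal v"
    unfolding v_def using sq by (intro nn_integral_eq_integral) auto
  have [measurable]: "(\<lambda>X. X i) \<in> measurable ?P M" for i
    by (rule measurable_component_singleton) simp
  have one: "has_bochner_integral ?P (\<lambda>X. Y (X i)) \<mu>" for i
    using nn_integral_PiM_prod[OF M, of "{i}" "\<lambda>_ x. ennreal (Y x)"] nnY mu0 nonneg
    by (intro has_bochner_integral_nn_integral) auto
  have two: "has_bochner_integral ?P (\<lambda>X. Y (X i) * Y (X j)) (if i = j then v else \<mu>\<^sup>2)" for i j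
  proof (intro has_bochner_integral_nn_integral)
    show "(\<integral>\<^sup>+X. ennreal (Y (X i) * Y (X j)) \<partial>?P) = ennreal (if i = j then v else \<mu>\<^sup>2)"
    proof (cases "i = j")
      case True
      then show ?thesis
        using nn_integral_PiM_prod[OF M, of "{i}" "\<lambda>_ x. ennreal ((Y x)\<^sup>2)"] nnY2
        by (simp add: power2_eq_square)
    next
      case False
      then show ?thesis
        using nn_integral_PiM_prod[OF M, of "{i,j}" "\<lambda>_ x. ennreal (Y x)"] nnY nonneg mu0
        by (simp add: power2_eq_square ennreal_mult)
    qed
  qed (use nonneg v0 in auto)
  have sqeq: "((\<Sum>i<n. Y (X i)) - n * \<mu>)\<^sup>2 =
      (\<Sum>i<n. \<Sum>j<n. Y (X i) * Y (X j)) - 2 * n * \<mu> * (\<Sum>i<n. Y (X i)) + (n * \<mu>)\<^sup>2" for X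
    by (simp add: power2_diff sum_product[symmetric] power2_eq_square[of "sum _ _"])
  have "has_bochner_integral ?P (\<lambda>X. ((\<Sum>i<n. Y (X i)) - n * \<mu>)\<^sup>2)
      ((\<Sum>i<n. \<Sum>j<n. if i = j then v else \<mu>\<^sup>2) - 2 * n * \<mu> * (\<Sum>i<n. \<mu>) + (n * \<mu>)\<^sup>2)"
    unfolding sqeq
    by (intro has_bochner_integral_add has_bochner_integral_diff has_bochner_integral_sum two
          has_bochner_integral_mult_right one)
       (simp add: has_bochner_integral_iff P.prob_space)
  moreover have "(\<Sum>i<n. \<Sum>j<n. if i = j then v else \<mu>\<^sup>2) = n * v + (n * n - n) * \<mu>\<^sup>2"
  proof -
    have "(\<Sum>j<n. if i = j then v else \<mu>\<^sup>2) = (v - \<mu>\<^sup>2) + n * \<mu>\<^sup>2" if "i < n" for i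
    proof -
      have "(\<Sum>j<n. if i = j then v else \<mu>\<^sup>2) = (\<Sum>j<n. (if i = j then v - \<mu>\<^sup>2 else 0) + \<mu>\<^sup>2)"
        by (intro sum.cong) auto
      then show ?thesis using that by (simp add: sum.distrib)
    qed
    then have "(\<Sum>i<n. \<Sum>j<n. if i = j then v else \<mu>\<^sup>2) = real n * ((v - \<mu>\<^sup>2) + n * \<mu>\<^sup>2)"
      by simp
    also have "\<dots> = n * v + (n * n - n) * \<mu>\<^sup>2"
      by (simp add: algebra_simps)
    finally show ?thesis .
  qed
  ultimately have *: "has_bochner_integral ?P (\<lambda>X. ((\<Sum>i<n. Y (X i)) - n * \<mu>)\<^sup>2) (n * v - n * \<mu>\<^sup>2)"
    by (simp add: power2_eq_square algebra_simps)
  have "(\<integral>\<^sup>+X. ennreal (((\<Sum>i<n. Y (X i)) - n * \<mu>)\<^sup>2) \<partial>?P) = ennreal (n * v - n * \<mu>\<^sup>2)"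
    using * by (subst nn_integral_eq_integral) (auto simp: has_bochner_integral_iff)
  also have "\<dots> \<le> ennreal (n * v)"
    by (intro ennreal_leI) simp
  finally show ?thesis unfolding \<mu>_def v_def .
qed

text \<open>Borel-Cantelli in expectation form: the sum of the \<open>W n\<close> has finite
  integral, hence is finite almost everywhere, and the terms of a convergent series tend to
  0.\<close>

lemma AE_tendsto_0_of_suminf_nn_integral:
  fixes W :: "nat \<Rightarrow> 'a \<Rightarrow> ennreal"
  assumes [measurable]: "\<And>n. W n \<in> borel_measurable M"
    and fin: "(\<Sum>n. \<integral>\<^sup>+x. W n x \<partial>M) < \<infinity>"
  shows "AE x in M. (\<lambda>n. W n x) \<longlonglongrightarrow> 0"
proof -
  have "(\<integral>\<^sup>+x. (\<Sum>n. W n x) \<partial>M) < \<infinity>"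
    using fin by (subst nn_integral_suminf) auto
  then have "AE x in M. (\<Sum>n. W n x) \<noteq> \<infinity>"
    by (intro nn_integral_PInf_AE) auto
  then show ?thesis
  proof eventually_elim
    case (elim x)
    then have "\<And>n. W n x < top"
      using ennreal_suminf_lessD[of "\<lambda>n. W n x"] by (simp add: less_top)
    then have eq: "W n x = ennreal (enn2real (W n x))" for n
      by simp
    have "summable (\<lambda>n. enn2real (W n x))"
    proof (rule summable_suminf_not_top)
      show "(\<Sum>n. ennreal (enn2real (W n x))) \<noteq> top"
        using elim eq by simp
    qed auto
    then have "(\<lambda>n. enn2real (W n x)) \<longlonglongrightarrow> 0"
      by (rule summable_LIMSEQ_zero)
    then show ?case
      by (subst eq) (simp add: tendsto_ennreal_iff flip: ennreal_0)
  qed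
qed

text \<open>A one-sided strong law under a second moment. Along the squares the variances of the
  averages are summable; between two squares the sums are monotone, and consecutive squares have
  ratio tending to 1.\<close>

lemma AE_eventually_sum_le:
  fixes Y :: "'a \<Rightarrow> real" and c :: real
  assumes M: "prob_space M" and [measurable]: "Y \<in> borel_measurable M" and nonneg: "\<And>x. 0 \<le> Y x"
    and sq: "integrable M (\<lambda>x. (Y x)\<^sup>2)" and c: "(\<integral>x. Y x \<partial>M) < (c::real)"
  shows "AE X in (\<Pi>\<^sub>M i\<in>(UNIV::nat set). M). eventually (\<lambda>m. (\<Sum>i<m. Y (X i)) \<le> m * c) sequentially"
proof -
  let ?P = "\<Pi>\<^sub>M i\<in>(UNIV::nat set). M"
  define \<mu> where "\<mu> = (\<integral>x. Y x \<partial>M)"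
  define v where "v = (\<integral>x. (Y x)\<^sup>2 \<partial>M)"
  have v0: "0 \<le> v" unfolding v_def by (intro integral_nonneg_AE) auto
  have mu0: "0 \<le> \<mu>" unfolding \<mu>_def using nonneg by (intro integral_nonneg_AE) auto
  \<comment> \<open>The gap between \<open>c'\<close> and \<open>c\<close> absorbs the factor
    \<open>(k + 2)\<^sup>2 / (k + 1)\<^sup>2\<close> lost when passing to the next square.\<close>
  obtain c' where c': "\<mu> < c'" "c' < c"
    using c dense unfolding \<mu>_def by blast
  have [measurable]: "(\<lambda>X. X i) \<in> measurable ?P M" for i
    by (rule measurable_component_singleton) simp
  define S where "S n X = (\<Sum>i<n. Y (X i))" for n and X :: "nat \<Rightarrow> 'a"
  have [measurable]: "S n \<in> borel_measurable ?P" for n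
    unfolding S_def by measurable
  \<comment> \<open>Squared deviation of the average over the first \<open>(Suc k)\<^sup>2\<close>
    observations; its mean is at most \<open>v / (Suc k)\<^sup>2\<close>, which is summable.\<close>
  define W where "W k X = ennreal (((S ((Suc k)\<^sup>2) X - real ((Suc k)\<^sup>2) * \<mu>) / real ((Suc k)\<^sup>2))\<^sup>2)" for k and X :: "nat \<Rightarrow> 'a"
  have [measurable]: "W k \<in> borel_measurable ?P" for k
    unfolding W_def by measurable
  have W: "(\<integral>\<^sup>+X. W k X \<partial>?P) \<le> ennreal (v * inverse (real (Suc k) ^ 2))" for k
  proof -
    let ?n = "(Suc k)\<^sup>2"
    have "(\<integral>\<^sup>+X. W k X \<partial>?P) = (\<integral>\<^sup>+X. ennreal (1 / (real ?n)\<^sup>2) * ennreal ((S ?n X - ?n * \<mu>)\<^sup>2) \<partial>?P)"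
      unfolding W_def by (intro nn_integral_cong) (simp add: power_divide ennreal_mult[symmetric])
    also have "\<dots> = ennreal (1 / (real ?n)\<^sup>2) * (\<integral>\<^sup>+X. ennreal ((S ?n X - ?n * \<mu>)\<^sup>2) \<partial>?P)"
      by (intro nn_integral_cmult) auto
    also have "\<dots> \<le> ennreal (1 / (real ?n)\<^sup>2) * ennreal (?n * v)"
      unfolding S_def \<mu>_def v_def
      by (intro mult_left_mono variance_sum_PiM_le M nonneg sq) auto
    also have "\<dots> = ennreal (1 / (real ?n)\<^sup>2 * (?n * v))"
      using v0 by (subst ennreal_mult[symmetric]) auto
    also have "1 / (real ?n)\<^sup>2 * (?n * v) = v * inverse (real (Suc k) ^ 2)"
    proof -
      define a where "a = real (Suc k)"
      have "real ?n = a\<^sup>2" "a > 0" unfolding a_def by simp_all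
      then show ?thesis unfolding a_def[symmetric] by (simp add: power2_eq_square divide_simps)
    qed
    finally show ?thesis .
  qed
  have summ: "summable (\<lambda>k. v * inverse (real (Suc k) ^ 2))"
    using inverse_power_summable[of 2, where 'a=real] summable_Suc_iff[of "\<lambda>n. inverse (real n ^ 2)"]
    by (intro summable_mult) simp
  have "(\<Sum>k. \<integral>\<^sup>+X. W k X \<partial>?P) \<le> (\<Sum>k. ennreal (v * inverse (real (Suc k) ^ 2)))"
    by (intro suminf_le W) auto
  also have "\<dots> < \<infinity>"
    using v0 summ by (subst suminf_ennreal2) auto
  finally have "AE X in ?P. (\<lambda>k. W k X) \<longlonglongrightarrow> 0"
    by (intro AE_tendsto_0_of_suminf_nn_integral) auto
  then show ?thesis
  proof eventually_elim
    case (elim X)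
    have S_mono: "S m X \<le> S n X" if "m \<le> n" for m n
      unfolding S_def using that nonneg by (intro sum_mono2) auto
    define d where "d = c' - \<mu>"
    have "d > 0" using c' by (simp add: d_def)
    have "eventually (\<lambda>k. W k X < ennreal (d\<^sup>2)) sequentially"
      using elim \<open>d > 0\<close> by (intro order_tendstoD) auto
    moreover have "((\<lambda>k. (real k + 2)\<^sup>2 / (real k + 1)\<^sup>2 * c') \<longlongrightarrow> 1 * c') sequentially"
      by (intro tendsto_mult tendsto_const) real_asymp
    then have "eventually (\<lambda>k. (real k + 2)\<^sup>2 / (real k + 1)\<^sup>2 * c' < c) sequentially"
      using c' by (intro order_tendstoD) auto
    ultimately have "eventually (\<lambda>k. W k X < ennreal (d\<^sup>2) \<and> (real k + 2)\<^sup>2 / (real k + 1)\<^sup>2 * c' < c) sequentially"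
      by eventually_elim auto
    then obtain K where K: "\<And>k. k \<ge> K \<Longrightarrow> W k X < ennreal (d\<^sup>2)"
        "\<And>k. k \<ge> K \<Longrightarrow> (real k + 2)\<^sup>2 / (real k + 1)\<^sup>2 * c' < c"
      by (auto simp: eventually_sequentially)
    have S1: "S ((Suc k)\<^sup>2) X \<le> real ((Suc k)\<^sup>2) * c'" if "k \<ge> K" for k
    proof -
      have "((S ((Suc k)\<^sup>2) X - real ((Suc k)\<^sup>2) * \<mu>) / real ((Suc k)\<^sup>2))\<^sup>2 < d\<^sup>2"
        using K(1)[OF that] \<open>d > 0\<close> unfolding W_def by (simp add: ennreal_less_iff)
      then have "(S ((Suc k)\<^sup>2) X - real ((Suc k)\<^sup>2) * \<mu>) / real ((Suc k)\<^sup>2) < d"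
        using \<open>d > 0\<close> by (metis less_eq_real_def power2_less_imp_less)
      then have "S ((Suc k)\<^sup>2) X - real ((Suc k)\<^sup>2) * \<mu> < d * real ((Suc k)\<^sup>2)"
        by (subst (asm) pos_divide_less_eq) auto
      then show ?thesis unfolding d_def by (simp add: algebra_simps)
    qed
    show ?case unfolding eventually_sequentially
    proof (intro exI allI impI)
      fix m :: nat assume m: "m \<ge> (Suc (Suc K))\<^sup>2"
      \<comment> \<open>This choice gives
        \<open>(Suc k)\<^sup>2 \<le> m \<le> (Suc (Suc k))\<^sup>2\<close>, and the lower bound on
        \<open>m\<close> gives \<open>K \<le> k\<close>.\<close>
      define k where "k = floor_sqrt m - 1"
      have fs: "Suc (Suc K) \<le> floor_sqrt m"
        using m by (simp add: le_floor_sqrt_iff)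
      then have k: "Suc k = floor_sqrt m" "K \<le> k" unfolding k_def by auto
      have a: "(Suc k)\<^sup>2 \<le> m" unfolding k by simp
      have b: "m \<le> (Suc (Suc k))\<^sup>2" unfolding k
        using Suc_floor_sqrt_power2_gt[of m] by (simp add: less_imp_le)
      have "S m X \<le> S ((Suc (Suc k))\<^sup>2) X" by (rule S_mono[OF b])
      also have "\<dots> \<le> real ((Suc (Suc k))\<^sup>2) * c'"
        by (rule S1) (use k in auto)
      also have "\<dots> = (real k + 1)\<^sup>2 * ((real k + 2)\<^sup>2 / (real k + 1)\<^sup>2 * c')"
        by (simp add: add.commute divide_simps)
      also have "\<dots> \<le> (real k + 1)\<^sup>2 * c"
        using K(2)[OF k(2)] by (intro mult_left_mono) auto
      also have "\<dots> = real ((Suc k)\<^sup>2) * c" by (simp add: add.commute)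
      also have "\<dots> \<le> m * c"
        using a c' mu0 by (intro mult_right_mono) (auto simp del: of_nat_power)
      finally show "(\<Sum>i<m. Y (X i)) \<le> m * c" unfolding S_def .
    qed
  qed
qed

section \<open>Posterior ratios under Kullback-Leibler support\<close>

text \<open>For \<open>y = - z < 0\<close>, \<open>exp (- z) \<le> 1 / (1 + z)\<close> and
  \<open>(1 - z + z\<^sup>2) * (1 + z) = 1 + z ^ 3\<close> exceeds 1. The bound reduces the mean of
  an exponential tilt to the mean of its exponent.\<close>

lemma exp_le_quadratic:
  fixes y :: real
  assumes "\<bar>y\<bar> \<le> 1"
  shows "exp y \<le> 1 + y + y\<^sup>2"
proof (cases "0 \<le> y")
  case True
  then show ?thesis using exp_bound[of y] assms by simp
next
  case False
  define z where "z = - y"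
  have z: "z > 0" using False by (simp add: z_def)
  have "exp (- z) \<le> 1 / (1 + z)"
    using z exp_ge_add_one_self[of z] by (simp add: exp_minus divide_simps)
  also have "\<dots> \<le> 1 - z + z\<^sup>2"
  proof -
    have "(1 - z + z\<^sup>2) * (1 + z) = 1 + z ^ 3"
      by (simp add: algebra_simps power2_eq_square power3_eq_cube)
    then show ?thesis using z by (simp add: pos_divide_le_eq)
  qed
  finally show ?thesis by (simp add: z_def)
qed

lemma ennreal_inverse_antimono: "a \<le> b \<Longrightarrow> inverse b \<le> inverse (a :: ennreal)"
proof (cases "a = 0 \<or> b = top")
  case False
  assume "a \<le> b"
  with False obtain x y where "a = ennreal x" "b = ennreal y" "0 < x" "x \<le> y"
    by (cases a; cases b) (auto simp: top_unique)
  then show ?thesis by (simp add: inverse_ennreal le_imp_inverse_le ennreal_leI)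
qed auto

text \<open>The densities \<open>f p\<close> may have mass less than 1, which spares the proof that the stick-breaking
  weights sum to 1 almost surely.\<close>
locale bayes_model =
  fixes P :: "'p measure" and f :: "'p \<Rightarrow> real \<Rightarrow> real" and q :: "real \<Rightarrow> real"
  assumes prob_P: "prob_space P"
    and f_meas: "(\<lambda>(p, x). f p x) \<in> borel_measurable (P \<Otimes>\<^sub>M borel)"
    and f_nonneg: "\<And>p x. 0 \<le> f p x"
    and f_mass: "AE p in P. (\<integral>\<^sup>+x. ennreal (f p x) \<partial>lborel) \<le> 1"
    and q_meas [measurable]: "q \<in> borel_measurable borel"
    and q_nonneg: "\<And>x. 0 \<le> q x"
    and q_mass: "(\<integral>\<^sup>+x. ennreal (q x) \<partial>lborel) = 1"
begin

sublocale P: prob_space P by (rule prob_P)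

definition D :: "real measure" where "D = density lborel (\<lambda>x. ennreal (q x))"

definition \<Omega> :: "(nat \<Rightarrow> real) measure" where "\<Omega> = (\<Pi>\<^sub>M i\<in>UNIV. D)"

definition lik :: "(nat \<Rightarrow> real) \<Rightarrow> nat \<Rightarrow> 'p \<Rightarrow> ennreal" where
  "lik X m p = (\<Prod>i<m. ennreal (f p (X i)))"

lemma sets_D: "sets D = sets borel"
  unfolding D_def by simp

lemma borel_measurable_D: "borel_measurable D = borel_measurable borel"
  by (rule measurable_cong_sets) (simp_all add: sets_D)

sublocale D: prob_space D
proof
  show "emeasure D (space D) = 1"
    using q_mass unfolding D_def by (simp add: emeasure_density)
qed

sublocale \<Omega>: prob_space \<Omega>
  unfolding \<Omega>_def by (intro prob_space_PiM D.prob_space_axioms)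

sublocale pair: pair_sigma_finite P \<Omega> ..

lemma f_measurable2 [measurable (raw)]:
  assumes [measurable]: "g \<in> measurable M P" "h \<in> measurable M borel"
  shows "(\<lambda>z. f (g z) (h z)) \<in> borel_measurable M"
  using measurable_compose[OF _ f_meas, of "\<lambda>z. (g z, h z)" M] by simp

lemma component_measurable [measurable]: "(\<lambda>X. X i) \<in> measurable \<Omega> borel"
proof -
  have "(\<lambda>X. X i) \<in> measurable \<Omega> D"
    unfolding \<Omega>_def by (rule measurable_component_singleton) simp
  moreover have "measurable \<Omega> D = measurable \<Omega> borel"
    by (rule measurable_cong_sets) (simp_all add: sets_D)
  ultimately show ?thesis by simp
qed

lemma q_integrable: "integrable lborel q" "(\<integral>x. q x \<partial>lborel) = 1"
proof -
  have "has_bochner_integral lborel q 1"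
    using q_mass q_nonneg by (intro has_bochner_integral_nn_integral) auto
  then show "integrable lborel q" "(\<integral>x. q x \<partial>lborel) = 1"
    by (auto simp: has_bochner_integral_iff)
qed

lemma integral_D:
  assumes [measurable]: "g \<in> borel_measurable borel"
  shows "(\<integral>x. g x \<partial>D) = (\<integral>x. g x * q x \<partial>lborel)"
  unfolding D_def using q_nonneg by (subst integral_density) (auto simp: mult.commute)

lemma AE_q_pos: "AE X in \<Omega>. \<forall>i. 0 < q (X i)"
proof -
  have "AE x in D. 0 < q x"
    unfolding D_def by (subst AE_density) auto
  then have "AE X in \<Omega>. 0 < q (X i)" for i
    unfolding \<Omega>_def by (intro AE_PiM_component D.prob_space_axioms) auto
  then show ?thesis by (simp add: AE_all_countable)
qed

text \<open>After Fubini the coordinates are independent for each fixed \<open>p\<close>, and the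
  density \<open>q\<close> of the data cancels in every factor.\<close>

lemma nn_integral_weighted_likelihood_le:
  assumes A[measurable]: "A \<in> sets P" and psi[measurable]: "\<psi> \<in> borel_measurable borel" and psi0: "\<And>x. 0 \<le> \<psi> x"
    and rho: "0 \<le> \<rho>" "AE p in P. p \<in> A \<longrightarrow> (\<integral>\<^sup>+x. ennreal (f p x * \<psi> x) \<partial>lborel) \<le> ennreal \<rho>"
  shows "(\<integral>\<^sup>+X. (\<integral>\<^sup>+p. indicator A p * (\<Prod>i<m. ennreal (f p (X i) * \<psi> (X i) / q (X i))) \<partial>P) \<partial>\<Omega>) \<le> ennreal (\<rho> ^ m)"
proof -
  have "(\<integral>\<^sup>+X. (\<integral>\<^sup>+p. indicator A p * (\<Prod>i<m. ennreal (f p (X i) * \<psi> (X i) / q (X i))) \<partial>P) \<partial>\<Omega>)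
    = (\<integral>\<^sup>+p. (\<integral>\<^sup>+X. indicator A p * (\<Prod>i<m. ennreal (f p (X i) * \<psi> (X i) / q (X i))) \<partial>\<Omega>) \<partial>P)"
    by (rule pair.Fubini') measurable
  also have "\<dots> \<le> (\<integral>\<^sup>+p. ennreal (\<rho> ^ m) \<partial>P)"
  proof (rule nn_integral_mono_AE)
    show "AE p in P. (\<integral>\<^sup>+X. indicator A p * (\<Prod>i<m. ennreal (f p (X i) * \<psi> (X i) / q (X i))) \<partial>\<Omega>) \<le> ennreal (\<rho> ^ m)"
      using rho(2) AE_space
    proof eventually_elim
      case (elim p)
      have [measurable]: "f p \<in> borel_measurable borel" using elim(2) by measurable
      show ?case
      proof (cases "p \<in> A")
        case True
        have "(\<integral>\<^sup>+X. indicator A p * (\<Prod>i<m. ennreal (f p (X i) * \<psi> (X i) / q (X i))) \<partial>\<Omega>)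
            = (\<Prod>i<m. \<integral>\<^sup>+x. ennreal (f p x * \<psi> x / q x) \<partial>D)"
        proof -
          have "(\<lambda>x. ennreal (f p x * \<psi> x / q x)) \<in> borel_measurable D"
            unfolding borel_measurable_D by measurable
          then show ?thesis
            using True unfolding \<Omega>_def
            by (subst nn_integral_PiM_prod[symmetric]) (auto intro: D.prob_space_axioms)
        qed
        also have "\<dots> \<le> (\<Prod>i<m. ennreal \<rho>)"
        proof (intro prod_mono_ennreal)
          have "(\<integral>\<^sup>+x. ennreal (f p x * \<psi> x / q x) \<partial>D) = (\<integral>\<^sup>+x. ennreal (q x) * ennreal (f p x * \<psi> x / q x) \<partial>lborel)"
            unfolding D_def by (subst nn_integral_density) auto
          \<comment> \<open>Only an inequality: where \<open>q x = 0\<close> the quotient is 0 by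
            convention, while \<open>f p x\<close> may be positive.\<close>
          also have "\<dots> \<le> (\<integral>\<^sup>+x. ennreal (f p x * \<psi> x) \<partial>lborel)"
          proof (intro nn_integral_mono)
            fix x
            show "ennreal (q x) * ennreal (f p x * \<psi> x / q x) \<le> ennreal (f p x * \<psi> x)"
              using q_nonneg[of x] f_nonneg[of p x] psi0[of x]
              by (subst ennreal_mult[symmetric]) (auto intro!: ennreal_leI)
          qed
          also have "\<dots> \<le> ennreal \<rho>" using elim True by simp
          finally show "(\<integral>\<^sup>+x. ennreal (f p x * \<psi> x / q x) \<partial>D) \<le> ennreal \<rho>" .
        qed
        also have "\<dots> = ennreal (\<rho> ^ m)" using rho(1) by (simp add: ennreal_power)
        finally show ?thesis .
      qed simp
    qed
  qed
  also have "\<dots> = ennreal (\<rho> ^ m)" by (simp add: P.emeasure_space_1)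
  finally show ?thesis .
qed

text \<open>Divided by the true likelihood, the evidence has mean at most 1. Finiteness matters
  because in \<open>ennreal\<close> division by infinity gives 0, which would ruin the limit 1 of
  the posterior.\<close>

lemma AE_evidence_finite: "AE X in \<Omega>. \<forall>m. (\<integral>\<^sup>+p. lik X m p \<partial>P) < \<infinity>"
proof -
  let ?Z = "\<lambda>m X. \<integral>\<^sup>+p. (\<Prod>i<m. ennreal (f p (X i) / q (X i))) \<partial>P"
  have "(\<integral>\<^sup>+X. ?Z m X \<partial>\<Omega>) \<le> 1" for m
  proof -
    have "(\<integral>\<^sup>+X. ?Z m X \<partial>\<Omega>) = (\<integral>\<^sup>+X. (\<integral>\<^sup>+p. indicator (space P) p * (\<Prod>i<m. ennreal (f p (X i) * 1 / q (X i))) \<partial>P) \<partial>\<Omega>)"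
      by (intro nn_integral_cong) auto
    also have "\<dots> \<le> ennreal (1 ^ m)"
      by (rule nn_integral_weighted_likelihood_le) (use f_mass in auto)
    finally show ?thesis by simp
  qed
  then have "(\<integral>\<^sup>+X. ?Z m X \<partial>\<Omega>) < \<infinity>" for m
    by (rule order.strict_trans1) simp
  then have "AE X in \<Omega>. ?Z m X \<noteq> \<infinity>" for m
    by (intro nn_integral_PInf_AE) (measurable, simp add: less_top)
  then have "AE X in \<Omega>. \<forall>m. ?Z m X \<noteq> \<infinity>"
    by (simp add: AE_all_countable)
  with AE_q_pos AE_space show ?thesis
  proof eventually_elim
    case (elim X)
    show ?case
    proof
      fix m
      have "(\<integral>\<^sup>+p. lik X m p \<partial>P) = (\<integral>\<^sup>+p. ennreal (\<Prod>i<m. q (X i)) * (\<Prod>i<m. ennreal (f p (X i) / q (X i))) \<partial>P)"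
      proof (intro nn_integral_cong)
        fix p
        have "ennreal (\<Prod>i<m. q (X i)) * (\<Prod>i<m. ennreal (f p (X i) / q (X i)))
          = (\<Prod>i<m. ennreal (q (X i)) * ennreal (f p (X i) / q (X i)))"
          using q_nonneg by (simp add: prod_ennreal[symmetric] prod.distrib)
        also have "\<dots> = lik X m p"
          unfolding lik_def
        proof (intro prod.cong refl)
          fix i
          have "0 < q (X i)" using elim by simp
          then show "ennreal (q (X i)) * ennreal (f p (X i) / q (X i)) = ennreal (f p (X i))"
            using f_nonneg[of p "X i"] by (subst ennreal_mult[symmetric]) auto
        qed
        finally show "lik X m p = ennreal (\<Prod>i<m. q (X i)) * (\<Prod>i<m. ennreal (f p (X i) / q (X i)))" ..
      qed
      also have "\<dots> = ennreal (\<Prod>i<m. q (X i)) * ?Z m X"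
        by (intro nn_integral_cmult) measurable
      also have "\<dots> < \<infinity>"
        using elim by (auto simp: ennreal_mult_less_top less_top)
      finally show "(\<integral>\<^sup>+p. lik X m p \<partial>P) < \<infinity>" .
    qed
  qed
qed

text \<open>A form of Kullback-Leibler support in which one \<open>Y\<close> dominates the log ratio
  of \<open>q\<close> to \<open>f p\<close> for all \<open>p\<close> in \<open>B\<close>; square
  integrability serves the one-sided law. The exceptional set of \<open>p\<close> may depend on
  \<open>x\<close>, which suffices because only countably many data points occur.\<close>

definition kl_supported :: bool where
  "kl_supported \<longleftrightarrow> (\<forall>\<eta>>0::real. \<exists>Y B. Y \<in> borel_measurable borel \<and> (\<forall>x. 0 \<le> Y x) \<and>
     integrable D (\<lambda>x. (Y x)\<^sup>2) \<and> (\<integral>x. Y x \<partial>D) < \<eta> \<and> B \<in> sets P \<and> 0 < emeasure P B \<and>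
     (AE x in lborel. AE p in P. p \<in> B \<longrightarrow> q x * exp (- Y x) \<le> f p x))"

text \<open>On \<open>B\<close> the likelihood is at least the product of
  \<open>q (X i) * exp (- Y (X i))\<close>, which no longer depends on \<open>p\<close>. The law for
  \<open>Y\<close> supplies the exponent, and \<open>b\<close> is the prior mass of
  \<open>B\<close>.\<close>

lemma evidence_lower_bound:
  fixes \<eta> :: real
  assumes kl: kl_supported and eta: "0 < \<eta>"
  shows "AE X in \<Omega>. \<exists>b>0. \<forall>\<^sub>F m in sequentially.
     ennreal (b * exp (- \<eta> * m) * (\<Prod>i<m. q (X i))) \<le> (\<integral>\<^sup>+p. lik X m p \<partial>P)"
proof -
  obtain Y B where Y[measurable]: "Y \<in> borel_measurable borel" and Y0: "\<And>x. 0 \<le> Y x"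
    and Y2: "integrable D (\<lambda>x. (Y x)\<^sup>2)" and YI: "(\<integral>x. Y x \<partial>D) < \<eta>"
    and B[measurable]: "B \<in> sets P" and Bpos: "0 < emeasure P B"
    and le: "AE x in lborel. AE p in P. p \<in> B \<longrightarrow> q x * exp (- Y x) \<le> f p x"
    using kl eta unfolding kl_supported_def by blast
  have "AE x in D. AE p in P. p \<in> B \<longrightarrow> q x * exp (- Y x) \<le> f p x"
    unfolding D_def by (subst AE_density) (use le in auto)
  then have "AE X in \<Omega>. AE p in P. p \<in> B \<longrightarrow> q (X i) * exp (- Y (X i)) \<le> f p (X i)" for i
    unfolding \<Omega>_def
    by (intro AE_PiM_component[where P="\<lambda>x. AE p in P. p \<in> B \<longrightarrow> q x * exp (- Y x) \<le> f p x"] D.prob_space_axioms) auto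
  then have "AE X in \<Omega>. \<forall>i. AE p in P. p \<in> B \<longrightarrow> q (X i) * exp (- Y (X i)) \<le> f p (X i)"
    by (simp add: AE_all_countable)
  moreover have "AE X in \<Omega>. \<forall>\<^sub>F m in sequentially. (\<Sum>i<m. Y (X i)) \<le> m * \<eta>"
    unfolding \<Omega>_def by (intro AE_eventually_sum_le D.prob_space_axioms Y0 Y2 YI)
      (simp add: borel_measurable_D)
  ultimately show ?thesis
  proof eventually_elim
    case (elim X)
    define b where "b = measure P B"
    have b: "b > 0" "emeasure P B = ennreal b"
      using Bpos unfolding b_def by (auto simp: P.emeasure_eq_measure)
    have AEB: "AE p in P. \<forall>i. p \<in> B \<longrightarrow> q (X i) * exp (- Y (X i)) \<le> f p (X i)"
      using elim(1) unfolding AE_all_countable by simp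
    have "ennreal (b * exp (- \<eta> * m) * (\<Prod>i<m. q (X i))) \<le> (\<integral>\<^sup>+p. lik X m p \<partial>P)"
      if m: "(\<Sum>i<m. Y (X i)) \<le> m * \<eta>" for m
    proof -
      have "b * exp (- \<eta> * m) * (\<Prod>i<m. q (X i)) \<le> (\<Prod>i<m. q (X i) * exp (- Y (X i))) * b"
      proof -
        have "(\<Prod>i<m. q (X i) * exp (- Y (X i))) = exp (- (\<Sum>i<m. Y (X i))) * (\<Prod>i<m. q (X i))"
          by (simp add: prod.distrib exp_sum[symmetric] sum_negf mult.commute)
        moreover have "exp (- \<eta> * m) \<le> exp (- (\<Sum>i<m. Y (X i)))"
          using m by (simp add: mult.commute)
        moreover have "0 \<le> (\<Prod>i<m. q (X i))" by (intro prod_nonneg q_nonneg)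
        ultimately have "exp (- \<eta> * m) * (\<Prod>i<m. q (X i)) \<le> (\<Prod>i<m. q (X i) * exp (- Y (X i)))"
          by (simp only: mult_right_mono)
        then show ?thesis
          using mult_left_mono[of _ _ b] b by (simp add: mult.commute mult.left_commute)
      qed
      then have "ennreal (b * exp (- \<eta> * m) * (\<Prod>i<m. q (X i))) \<le> ennreal (\<Prod>i<m. q (X i) * exp (- Y (X i))) * emeasure P B"
        using b q_nonneg by (subst b(2), subst ennreal_mult[symmetric]) (auto intro!: ennreal_leI prod_nonneg)
      also have "\<dots> = (\<integral>\<^sup>+p. ennreal (\<Prod>i<m. q (X i) * exp (- Y (X i))) * indicator B p \<partial>P)"
        by (subst nn_integral_cmult_indicator) auto
      also have "\<dots> \<le> (\<integral>\<^sup>+p. lik X m p \<partial>P)"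
      proof (intro nn_integral_mono_AE)
        show "AE p in P. ennreal (\<Prod>i<m. q (X i) * exp (- Y (X i))) * indicator B p \<le> lik X m p"
          using AEB
        proof eventually_elim
          case (elim p)
          then show ?case
            unfolding lik_def using q_nonneg f_nonneg
            by (cases "p \<in> B") (auto simp: prod_ennreal intro!: ennreal_leI prod_mono)
        qed
      qed
      finally show ?thesis .
    qed
    then have "\<forall>\<^sub>F m in sequentially. ennreal (b * exp (- \<eta> * m) * (\<Prod>i<m. q (X i))) \<le> (\<integral>\<^sup>+p. lik X m p \<partial>P)"
      using elim(2) by (auto elim: eventually_mono)
    then show ?case using b(1) by auto
  qed
qed

text \<open>The weight \<open>\<psi>\<close> below is an exponential tilt, playing the role of a uniformly consistent test:
  it makes the tilted likelihood ratio exponentially small in mean on \<open>A\<close>, while the product of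
  the weights along the data is eventually at least 1.\<close>
lemma posterior_integral_upper_bound:
  assumes phi[measurable]: "\<phi> \<in> borel_measurable borel" and phi1: "\<And>x. \<bar>\<phi> x\<bar> \<le> 1"
    and eps: "0 < \<epsilon>" "\<epsilon> \<le> 1"
    and A: "A = {p \<in> space P. (\<integral>x. \<phi> x * q x \<partial>lborel) + \<epsilon> \<le> (\<integral>x. \<phi> x * f p x \<partial>lborel)}"
  shows "AE X in \<Omega>. \<forall>\<^sub>F m in sequentially.
    (\<integral>\<^sup>+p. indicator A p * lik X m p \<partial>P) \<le> ennreal ((\<Prod>i<m. q (X i)) * exp (- (\<epsilon>\<^sup>2 / 32) * m))"
proof -
  define I where "I = (\<integral>x. \<phi> x * q x \<partial>lborel)"
  \<comment> \<open>With \<open>c\<close> midway between \<open>I\<close> and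
    \<open>I + \<epsilon>\<close>, the exponent
    \<open>s * c - s * (I + \<epsilon>) + s\<^sup>2\<close> equals
    \<open>s\<^sup>2 - s * \<epsilon> / 2\<close>. It is minimal at
    \<open>s = \<epsilon> / 4\<close>, with the value \<open>- \<epsilon>\<^sup>2 / 16\<close> that
    defines \<open>\<rho>\<close>.\<close>
  define s where "s = \<epsilon> / 4"
  define c where "c = I + \<epsilon> / 2"
  define \<psi> where "\<psi> x = exp (- s * (\<phi> x - c))" for x
  define \<rho> where "\<rho> = exp (- (\<epsilon>\<^sup>2 / 16))"
  have s: "0 < s" "s \<le> 1" using eps by (auto simp: s_def)
  have [measurable]: "\<psi> \<in> borel_measurable borel" unfolding \<psi>_def by measurable
  have Ameas[measurable]: "A \<in> sets P" unfolding A by measurable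
  have psi0: "0 \<le> \<psi> x" for x by (simp add: \<psi>_def)
  have bound: "AE p in P. p \<in> A \<longrightarrow> (\<integral>\<^sup>+x. ennreal (f p x * \<psi> x) \<partial>lborel) \<le> ennreal \<rho>"
    using f_mass AE_space
  proof eventually_elim
    case (elim p)
    have [measurable]: "f p \<in> borel_measurable borel" using elim(2) by measurable
    show ?case
    proof
      assume "p \<in> A"
      then have pA: "I + \<epsilon> \<le> (\<integral>x. \<phi> x * f p x \<partial>lborel)" unfolding A I_def by simp
      have int: "integrable lborel (f p)"
        using elim f_nonneg by (intro integrableI_nonneg) (auto intro: order.strict_trans1)
      have mass: "(\<integral>x. f p x \<partial>lborel) \<le> 1"
        using elim f_nonneg int by (subst (asm) nn_integral_eq_integral) auto
      have intphi: "integrable lborel (\<lambda>x. \<phi> x * f p x)"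
        by (rule Bochner_Integration.integrable_bound[OF int])
           (use phi1 f_nonneg in \<open>auto simp: abs_mult intro!: mult_left_le_one_le AE_I2\<close>)
      let ?g = "\<lambda>x. exp (s * c) * (f p x - s * (\<phi> x * f p x) + s\<^sup>2 * f p x)"
      have le: "f p x * \<psi> x \<le> ?g x" for x
      proof -
        have "\<bar>- s * \<phi> x\<bar> \<le> 1" using s phi1[of x] by (simp add: abs_mult mult_le_one)
        then have "exp (- s * \<phi> x) \<le> 1 + (- s * \<phi> x) + (- s * \<phi> x)\<^sup>2"
          by (rule exp_le_quadratic)
        moreover have "(- s * \<phi> x)\<^sup>2 \<le> s\<^sup>2"
          using s phi1[of x] by (auto simp: power_mult_distrib abs_square_le_1 intro!: mult_left_le)
        ultimately have "exp (- s * \<phi> x) \<le> 1 - s * \<phi> x + s\<^sup>2" by simp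
        then have "f p x * (exp (s * c) * exp (- s * \<phi> x)) \<le> f p x * (exp (s * c) * (1 - s * \<phi> x + s\<^sup>2))"
          by (intro mult_left_mono f_nonneg) auto
        then show ?thesis unfolding \<psi>_def by (simp add: exp_add[symmetric] algebra_simps)
      qed
      have "(\<integral>\<^sup>+x. ennreal (f p x * \<psi> x) \<partial>lborel) \<le> (\<integral>\<^sup>+x. ennreal (?g x) \<partial>lborel)"
        by (intro nn_integral_mono ennreal_leI le)
      also have "\<dots> = ennreal (\<integral>x. ?g x \<partial>lborel)"
        using int intphi
        by (intro nn_integral_eq_integral)
           (auto intro!: AE_I2 order.trans[OF mult_nonneg_nonneg[OF f_nonneg psi0] le])
      also have "(\<integral>x. ?g x \<partial>lborel) = exp (s * c) * ((\<integral>x. f p x \<partial>lborel) - s * (\<integral>x. \<phi> x * f p x \<partial>lborel) + s\<^sup>2 * (\<integral>x. f p x \<partial>lborel))"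
        using int intphi by simp
      also have "\<dots> \<le> exp (s * c) * (1 + (- s * (I + \<epsilon>) + s\<^sup>2))"
      proof -
        have "s * (I + \<epsilon>) \<le> s * (\<integral>x. \<phi> x * f p x \<partial>lborel)"
          using pA s by (intro mult_left_mono) auto
        moreover have "s\<^sup>2 * (\<integral>x. f p x \<partial>lborel) \<le> s\<^sup>2" using mass by (simp add: mult_left_le)
        ultimately show ?thesis using mass by (intro mult_left_mono) auto
      qed
      also have "\<dots> \<le> exp (s * c) * exp (- s * (I + \<epsilon>) + s\<^sup>2)"
        by (intro mult_left_mono exp_ge_add_one_self) auto
      also have "\<dots> = \<rho>"
        unfolding \<rho>_def s_def c_def by (simp add: exp_add[symmetric] field_simps power2_eq_square)
      finally show "(\<integral>\<^sup>+x. ennreal (f p x * \<psi> x) \<partial>lborel) \<le> ennreal \<rho>"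
        by (simp add: ennreal_leI)
    qed
  qed
  define Z where "Z m X = (\<integral>\<^sup>+p. indicator A p * (\<Prod>i<m. ennreal (f p (X i) * \<psi> (X i) / q (X i))) \<partial>P)" for m and X :: "nat \<Rightarrow> real"
  have [measurable]: "Z m \<in> borel_measurable \<Omega>" for m unfolding Z_def by measurable
  \<comment> \<open>Half of the rate in \<open>\<rho>\<close> is spent on \<open>r ^ m\<close>; the
    other half keeps the means of \<open>r ^ m * Z m X\<close> summable.\<close>
  define r where "r = exp (\<epsilon>\<^sup>2 / 32)"
  have "(\<integral>\<^sup>+X. ennreal (r ^ m) * Z m X \<partial>\<Omega>) \<le> ennreal (exp (- (\<epsilon>\<^sup>2 / 32)) ^ m)" for m
  proof -
    have "(\<integral>\<^sup>+X. ennreal (r ^ m) * Z m X \<partial>\<Omega>) = ennreal (r ^ m) * (\<integral>\<^sup>+X. Z m X \<partial>\<Omega>)"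
      by (intro nn_integral_cmult) auto
    also have "\<dots> \<le> ennreal (r ^ m) * ennreal (\<rho> ^ m)"
      unfolding Z_def
      by (intro mult_left_mono nn_integral_weighted_likelihood_le Ameas bound psi0) (auto simp: \<rho>_def)
    also have "\<dots> = ennreal ((r * \<rho>) ^ m)"
      by (subst ennreal_mult[symmetric]) (auto simp: r_def \<rho>_def power_mult_distrib)
    also have "r * \<rho> = exp (- (\<epsilon>\<^sup>2 / 32))"
      by (simp add: r_def \<rho>_def exp_add[symmetric])
    finally show ?thesis .
  qed
  then have "(\<Sum>m. \<integral>\<^sup>+X. ennreal (r ^ m) * Z m X \<partial>\<Omega>) \<le> (\<Sum>m. ennreal (exp (- (\<epsilon>\<^sup>2 / 32)) ^ m))"
    by (intro suminf_le) auto
  also have "\<dots> < \<infinity>"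
    using eps by (subst suminf_ennreal2) (auto intro!: summable_geometric)
  finally have "AE X in \<Omega>. (\<lambda>m. ennreal (r ^ m) * Z m X) \<longlonglongrightarrow> 0"
    by (intro AE_tendsto_0_of_suminf_nn_integral) auto
  \<comment> \<open>The shift by 1 makes the summands nonnegative, as the one-sided law
    requires.\<close>
  moreover have "AE X in \<Omega>. \<forall>\<^sub>F m in sequentially. (\<Sum>i<m. 1 + \<phi> (X i)) \<le> m * (1 + c)"
    unfolding \<Omega>_def
  proof (intro AE_eventually_sum_le D.prob_space_axioms)
    have bnd: "0 \<le> 1 + \<phi> x" "1 + \<phi> x \<le> 2" for x using phi1[of x] by auto
    show "0 \<le> 1 + \<phi> x" for x by (rule bnd)
    show "(\<lambda>x. 1 + \<phi> x) \<in> borel_measurable D" unfolding borel_measurable_D by measurable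
    show "integrable D (\<lambda>x. (1 + \<phi> x)\<^sup>2)"
      using power_mono[OF bnd(2) bnd(1), of _ 2]
      by (intro D.integrable_const_bound[where B=4]) (auto simp: borel_measurable_D)
    have "integrable lborel (\<lambda>x. \<phi> x * q x)"
      by (rule Bochner_Integration.integrable_bound[OF q_integrable(1)])
         (use phi1 q_nonneg in \<open>auto simp: abs_mult intro!: mult_left_le_one_le AE_I2\<close>)
    then have "(\<integral>x. 1 + \<phi> x \<partial>D) = 1 + I"
      using q_integrable by (subst integral_D) (auto simp: I_def distrib_right)
    then show "(\<integral>x. 1 + \<phi> x \<partial>D) < 1 + c" using eps by (simp add: c_def)
  qed
  ultimately show ?thesis using AE_q_pos AE_space
  proof eventually_elim
    case (elim X)
    have "\<forall>\<^sub>F m in sequentially. ennreal (r ^ m) * Z m X < 1"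
      using elim(1) by (intro order_tendstoD) auto
    with elim(2) show ?case
    proof eventually_elim
      case (elim m)
      have phi: "(\<Sum>i<m. \<phi> (X i)) \<le> m * c"
        using elim(1) by (simp add: sum.distrib algebra_simps)
      \<comment> \<open>The true likelihood divided by the product of the tilts. As the average of
        \<open>\<phi>\<close> along the data is at most \<open>c\<close>, it does not exceed the
        true likelihood.\<close>
      define w where "w = (\<Prod>i<m. q (X i) * exp (s * (\<phi> (X i) - c)))"
      have w0: "0 \<le> w" unfolding w_def by (intro prod_nonneg) (simp add: q_nonneg)
      have "w = (\<Prod>i<m. q (X i)) * exp (\<Sum>i<m. s * (\<phi> (X i) - c))"
        unfolding w_def by (simp add: prod.distrib exp_sum)
      also have "(\<Sum>i<m. s * (\<phi> (X i) - c)) = s * ((\<Sum>i<m. \<phi> (X i)) - m * c)"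
        by (simp add: sum_distrib_left[symmetric] sum_subtractf)
      finally have w: "w \<le> (\<Prod>i<m. q (X i))"
        using phi s by (simp add: mult_left_le mult_nonneg_nonpos prod_nonneg q_nonneg)
      have "(\<integral>\<^sup>+p. indicator A p * lik X m p \<partial>P) = (\<integral>\<^sup>+p. ennreal w * (indicator A p * (\<Prod>i<m. ennreal (f p (X i) * \<psi> (X i) / q (X i)))) \<partial>P)"
      proof (intro nn_integral_cong)
        fix p
        have "ennreal w * (\<Prod>i<m. ennreal (f p (X i) * \<psi> (X i) / q (X i)))
          = (\<Prod>i<m. ennreal (q (X i) * exp (s * (\<phi> (X i) - c))) * ennreal (f p (X i) * \<psi> (X i) / q (X i)))"
        proof -
          have "ennreal w = (\<Prod>i<m. ennreal (q (X i) * exp (s * (\<phi> (X i) - c))))"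
            unfolding w_def by (rule prod_ennreal[symmetric]) (simp add: q_nonneg)
          then show ?thesis by (simp only: prod.distrib)
        qed
        also have "\<dots> = lik X m p"
          unfolding lik_def
        proof (intro prod.cong refl)
          fix i
          have qp: "0 < q (X i)" using \<open>\<forall>i. 0 < q (X i)\<close> by simp
          have "q (X i) * exp (s * (\<phi> (X i) - c)) * (f p (X i) * \<psi> (X i) / q (X i)) = f p (X i) * (exp (s * (\<phi> (X i) - c)) * \<psi> (X i))"
            using qp by simp
          also have "exp (s * (\<phi> (X i) - c)) * \<psi> (X i) = 1"
            unfolding \<psi>_def by (simp add: exp_add[symmetric])
          finally show "ennreal (q (X i) * exp (s * (\<phi> (X i) - c))) * ennreal (f p (X i) * \<psi> (X i) / q (X i)) = ennreal (f p (X i))"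
            using f_nonneg[of p "X i"] psi0 qp by (subst ennreal_mult[symmetric]) auto
        qed
        finally have "ennreal w * (\<Prod>i<m. ennreal (f p (X i) * \<psi> (X i) / q (X i))) = lik X m p" .
        then show "indicator A p * lik X m p = ennreal w * (indicator A p * (\<Prod>i<m. ennreal (f p (X i) * \<psi> (X i) / q (X i))))"
          unfolding mult.left_commute[of "ennreal w"] by simp
      qed
      also have "\<dots> = ennreal w * Z m X"
        unfolding Z_def using \<open>X \<in> space \<Omega>\<close> by (intro nn_integral_cmult) measurable
      also have "\<dots> \<le> ennreal (\<Prod>i<m. q (X i)) * ennreal (exp (- (\<epsilon>\<^sup>2 / 32) * m))"
      proof (intro mult_mono)
        have "Z m X = ennreal (exp (- (\<epsilon>\<^sup>2 / 32) * m)) * (ennreal (r ^ m) * Z m X)"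
        proof -
          have "exp (- (\<epsilon>\<^sup>2 / 32) * m) * r ^ m = 1"
            unfolding r_def by (simp add: exp_of_nat_mult[symmetric] exp_add[symmetric])
          then have "ennreal (exp (- (\<epsilon>\<^sup>2 / 32) * m)) * ennreal (r ^ m) = 1"
            by (subst ennreal_mult[symmetric]) (auto simp: r_def)
          then show ?thesis by (simp add: mult.assoc[symmetric])
        qed
        also have "\<dots> \<le> ennreal (exp (- (\<epsilon>\<^sup>2 / 32) * m)) * 1"
          using elim(2) by (intro mult_left_mono) auto
        finally show "Z m X \<le> ennreal (exp (- (\<epsilon>\<^sup>2 / 32) * m))" by simp
      qed (use w in \<open>auto intro: ennreal_leI\<close>)
      also have "\<dots> = ennreal ((\<Prod>i<m. q (X i)) * exp (- (\<epsilon>\<^sup>2 / 32) * m))"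
        using q_nonneg by (intro ennreal_mult[symmetric] prod_nonneg) auto
      finally show ?case .
    qed
  qed
qed

lemma AE_evidence_pos:
  assumes kl: kl_supported
  shows "AE X in \<Omega>. \<forall>\<^sub>F m in sequentially. 0 < (\<integral>\<^sup>+p. lik X m p \<partial>P)"
  using evidence_lower_bound[OF kl zero_less_one] AE_q_pos
proof eventually_elim
  case (elim X)
  then obtain b where b: "b > 0" and ev: "\<forall>\<^sub>F m in sequentially.
     ennreal (b * exp (- 1 * real m) * (\<Prod>i<m. q (X i))) \<le> (\<integral>\<^sup>+p. lik X m p \<partial>P)" by auto
  from ev show ?case
  proof eventually_elim
    case (elim m)
    have "0 < ennreal (b * exp (- 1 * real m) * (\<Prod>i<m. q (X i)))"
      using b \<open>\<forall>i. 0 < q (X i)\<close> by (auto intro!: mult_pos_pos prod_pos)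
    then show ?case using elim by (rule less_le_trans)
  qed
qed

theorem posterior_ratio_tendsto_0:
  assumes kl: kl_supported
    and phi[measurable]: "\<phi> \<in> borel_measurable borel" and phi1: "\<And>x. \<bar>\<phi> x\<bar> \<le> 1"
    and eps: "0 < \<epsilon>" "\<epsilon> \<le> 1"
    and A: "A = {p \<in> space P. (\<integral>x. \<phi> x * q x \<partial>lborel) + \<epsilon> \<le> (\<integral>x. \<phi> x * f p x \<partial>lborel)}"
  shows "AE X in \<Omega>. (\<lambda>m. (\<integral>\<^sup>+p. indicator A p * lik X m p \<partial>P) / (\<integral>\<^sup>+p. lik X m p \<partial>P)) \<longlonglongrightarrow> 0"
proof -
  \<comment> \<open>Half of the rate \<open>\<epsilon>\<^sup>2 / 32\<close> of the numerator, so
    that the quotient still decays like \<open>exp (- \<eta> * m)\<close>.\<close>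
  define \<eta> where "\<eta> = \<epsilon>\<^sup>2 / 64"
  have eta: "\<eta> > 0" using eps by (simp add: \<eta>_def)
  show ?thesis
    using posterior_integral_upper_bound[OF phi phi1 eps A] evidence_lower_bound[OF kl eta] AE_q_pos
  proof eventually_elim
    case (elim X)
    then obtain b where b: "b > 0" and ev: "\<forall>\<^sub>F m in sequentially.
       ennreal (b * exp (- \<eta> * real m) * (\<Prod>i<m. q (X i))) \<le> (\<integral>\<^sup>+p. lik X m p \<partial>P)" by auto
    have "(\<lambda>m. exp (- \<eta> * real m) / b) \<longlonglongrightarrow> 0"
      using eta b by real_asymp
    then have lim: "(\<lambda>m. ennreal (exp (- \<eta> * real m) / b)) \<longlonglongrightarrow> 0"
      using tendsto_ennrealI by fastforce
    show ?case
    proof (rule tendsto_sandwich[OF _ _ tendsto_const lim])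
      show "\<forall>\<^sub>F m in sequentially. (\<integral>\<^sup>+p. indicator A p * lik X m p \<partial>P) / (\<integral>\<^sup>+p. lik X m p \<partial>P) \<le> ennreal (exp (- \<eta> * real m) / b)"
        using ev elim(1)
      proof eventually_elim
        case (elim m)
        define Q where "Q = (\<Prod>i<m. q (X i))"
        have Q: "Q > 0" unfolding Q_def using \<open>\<forall>i. 0 < q (X i)\<close> by (auto intro: prod_pos)
        have "(\<integral>\<^sup>+p. indicator A p * lik X m p \<partial>P) / (\<integral>\<^sup>+p. lik X m p \<partial>P)
            \<le> ennreal (Q * exp (- (\<epsilon>\<^sup>2 / 32) * m)) / ennreal (b * exp (- \<eta> * real m) * Q)"
          using elim unfolding Q_def divide_ennreal_def by (intro mult_mono ennreal_inverse_antimono) auto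
        also have "\<dots> = ennreal (Q * exp (- (\<epsilon>\<^sup>2 / 32) * m) / (b * exp (- \<eta> * real m) * Q))"
          using Q b by (intro divide_ennreal) auto
        also have "exp (- (\<epsilon>\<^sup>2 / 32) * m) = exp (- \<eta> * real m) * exp (- \<eta> * real m)"
          unfolding \<eta>_def by (simp add: exp_add[symmetric])
        also have "Q * (exp (- \<eta> * real m) * exp (- \<eta> * real m)) / (b * exp (- \<eta> * real m) * Q) = exp (- \<eta> * real m) / b"
          using Q b by (simp add: field_simps)
        finally show ?case .
      qed
    qed simp
  qed
qed

end

section \<open>Weak neighbourhoods\<close>

text \<open>For \<open>0 < K\<close> the cells with index below \<open>2 * R * K\<close> tile the
  half-open interval from \<open>- R\<close> to \<open>R\<close> by disjoint pieces of length
  \<open>1 / K\<close>. Natural parameters keep the family countable.\<close>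

definition cell :: "nat \<Rightarrow> nat \<Rightarrow> nat \<Rightarrow> real set" where
  "cell R K j = {- real R + real j / real K ..< - real R + real (Suc j) / real K}"

lemma sum_cells:
  fixes h :: "nat \<Rightarrow> real"
  assumes K: "0 < K"
  shows "- real R \<le> x \<Longrightarrow> x < real R \<Longrightarrow>
      \<exists>j<2 * R * K. x \<in> cell R K j \<and> (\<Sum>i<2 * R * K. h i * indicator (cell R K i) x) = h j"
    and "\<not> (- real R \<le> x \<and> x < real R) \<Longrightarrow> (\<Sum>i<2 * R * K. h i * indicator (cell R K i) x) = 0"
proof -
  define j where "j = nat \<lfloor>(x + R) * K\<rfloor>"
  have iff: "x \<in> cell R K i \<longleftrightarrow> real i \<le> (x + R) * K \<and> (x + R) * K < real i + 1" for i
    using K unfolding cell_def by (auto simp: field_simps)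
  show "\<exists>j<2 * R * K. x \<in> cell R K j \<and> (\<Sum>i<2 * R * K. h i * indicator (cell R K i) x) = h j"
    if x: "- real R \<le> x" "x < real R"
  proof (intro exI conjI)
    have nn: "0 \<le> (x + R) * K" using x K by simp
    have cj: "x \<in> cell R K i \<longleftrightarrow> i = j" for i
      unfolding iff j_def using nn by linarith
    show "x \<in> cell R K j" by (simp add: cj)
    have "(x + R) * K < (2 * real R) * K" using x K by (intro mult_strict_right_mono) auto
    moreover have "real j \<le> (x + R) * K" using iff[of j] cj by auto
    ultimately have "real j < real (2 * R * K)" by simp
    then show "j < 2 * R * K" by linarith
    then show "(\<Sum>i<2 * R * K. h i * indicator (cell R K i) x) = h j"
      by (simp add: indicator_def cj if_distrib[of "\<lambda>z. _ * z"] sum.delta cong: if_cong)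
  qed
  show "(\<Sum>i<2 * R * K. h i * indicator (cell R K i) x) = 0"
    if x: "\<not> (- real R \<le> x \<and> x < real R)"
  proof (intro sum.neutral ballI)
    fix i assume i: "i \<in> {..<2 * R * K}"
    have "x \<notin> cell R K i"
    proof
      assume "x \<in> cell R K i"
      then have *: "real i \<le> (x + R) * K" "(x + R) * K < real i + 1" by (auto simp: iff)
      then have "0 \<le> (x + R) * K" using of_nat_0_le_iff[of i] by linarith
      then have "- real R \<le> x" using K by (simp add: zero_le_mult_iff)
      moreover have "real i + 1 \<le> 2 * real R * real K"
        using i by (metis Suc_leI lessThan_iff of_nat_Suc of_nat_le_iff of_nat_mult of_nat_numeral add.commute)
      then have "(x + R) * K < 2 * real R * real K" using * by linarith
      then have "x < real R" using K by simp
      ultimately show False using x by blast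
    qed
    then show "h i * indicator (cell R K i) x = 0" by simp
  qed
qed

lemma cell_measurable [measurable]: "cell R K j \<in> sets borel"
  unfolding cell_def by simp

text \<open>\<open>\<phi>\<close> is replaced by its value at the left end of each cell. The error
  is at most \<open>\<tau>\<close> on the cells and \<open>M\<close> elsewhere, and the mass
  elsewhere is at most \<open>1 - (\<Sum>j<2 * R * K. m j)\<close> since \<open>h\<close> has mass
  at most 1.\<close>

lemma step_function_integral_approx:
  fixes \<phi> h :: "real \<Rightarrow> real"
  assumes [measurable]: "\<phi> \<in> borel_measurable borel" and M: "\<And>x. \<bar>\<phi> x\<bar> \<le> M"
    and K: "0 < K" and tau: "0 \<le> \<tau>"
    and osc: "\<And>x y. x \<in> {- real R..real R} \<Longrightarrow> y \<in> {- real R..real R} \<Longrightarrow> \<bar>x - y\<bar> \<le> 1 / real K \<Longrightarrow> \<bar>\<phi> x - \<phi> y\<bar> \<le> \<tau>"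
    and h: "integrable lborel h" "\<And>x. 0 \<le> h x" "(\<integral>x. h x \<partial>lborel) \<le> 1"
  defines "m j \<equiv> \<integral>x. indicator (cell R K j) x * h x \<partial>lborel"
  shows "\<bar>(\<integral>x. \<phi> x * h x \<partial>lborel) - (\<Sum>j<2 * R * K. \<phi> (- real R + real j / real K) * m j)\<bar>
    \<le> \<tau> + M * (1 - (\<Sum>j<2 * R * K. m j))"
proof -
  let ?N = "2 * R * K"
  let ?t = "\<lambda>j::nat. - real R + real j / real K"
  have M0: "0 \<le> M" using M[of 0] by linarith
  have intc: "integrable lborel (\<lambda>x. indicator (cell R K j) x * h x)" for j
    using h(1) integrable_real_mult_indicator[OF _ h(1), of "cell R K j"] by (simp add: mult.commute)
  have intphi: "integrable lborel (\<lambda>x. \<phi> x * h x)"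
    by (rule Bochner_Integration.integrable_bound[of _ "\<lambda>x. M * h x"])
       (use h M M0 in \<open>auto simp: abs_mult intro!: mult_right_mono AE_I2\<close>)
  define \<sigma> where "\<sigma> x = (\<Sum>j<?N. \<phi> (?t j) * indicator (cell R K j) x)" for x :: real
  define \<kappa> where "\<kappa> x = (\<Sum>j<?N. (1::real) * indicator (cell R K j) x)" for x :: real
  have pt: "\<bar>\<phi> x - \<sigma> x\<bar> \<le> \<tau> + M * (1 - \<kappa> x)" for x
  proof (cases "- real R \<le> x \<and> x < real R")
    case True
    then obtain j where j: "j < ?N" "x \<in> cell R K j" "\<sigma> x = \<phi> (?t j)"
      using sum_cells(1)[OF K, where h="\<lambda>j. \<phi> (?t j)" and R=R and x=x] unfolding \<sigma>_def by auto
    have chi: "\<kappa> x = 1"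
      using sum_cells(1)[OF K, where h="\<lambda>j. 1" and R=R and x=x] True unfolding \<kappa>_def by auto
    have "?t j \<le> x" "x < ?t (Suc j)" using j(2) by (auto simp: cell_def)
    moreover have "?t (Suc j) = ?t j + 1 / real K" by (simp add: add_divide_distrib)
    moreover have "0 \<le> real j / real K" by simp
    ultimately have "\<bar>x - ?t j\<bar> \<le> 1 / real K" "?t j \<in> {- real R..real R}" using True by auto
    then have "\<bar>\<phi> x - \<phi> (?t j)\<bar> \<le> \<tau>" using True by (intro osc) auto
    then show ?thesis using j chi by simp
  next
    case False
    then have "\<sigma> x = 0" "\<kappa> x = 0"
      unfolding \<sigma>_def \<kappa>_def by (intro sum_cells(2) K; simp)+
    then show ?thesis using M[of x] tau by simp
  qed
  have sig: "(\<integral>x. \<sigma> x * h x \<partial>lborel) = (\<Sum>j<?N. \<phi> (?t j) * m j)" "integrable lborel (\<lambda>x. \<sigma> x * h x)"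
    unfolding \<sigma>_def m_def sum_distrib_right using intc by (simp_all add: mult.assoc)
  have chi: "(\<integral>x. \<kappa> x * h x \<partial>lborel) = (\<Sum>j<?N. m j)" "integrable lborel (\<lambda>x. \<kappa> x * h x)"
    unfolding \<kappa>_def m_def sum_distrib_right mult_1 using intc
    by (intro Bochner_Integration.integral_sum Bochner_Integration.integrable_sum; simp)+
  have "\<bar>(\<integral>x. \<phi> x * h x \<partial>lborel) - (\<Sum>j<?N. \<phi> (?t j) * m j)\<bar> = \<bar>\<integral>x. \<phi> x * h x - \<sigma> x * h x \<partial>lborel\<bar>"
    using sig intphi by simp
  also have "\<dots> \<le> (\<integral>x. \<bar>\<phi> x * h x - \<sigma> x * h x\<bar> \<partial>lborel)"
    by (rule integral_abs_bound)
  also have "\<dots> \<le> (\<integral>x. \<tau> * h x + M * (h x - \<kappa> x * h x) \<partial>lborel)"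
  proof (rule integral_mono)
    fix x
    have "\<bar>\<phi> x * h x - \<sigma> x * h x\<bar> = \<bar>\<phi> x - \<sigma> x\<bar> * h x"
      using h(2)[of x] by (simp add: abs_mult left_diff_distrib[symmetric])
    also have "\<dots> \<le> (\<tau> + M * (1 - \<kappa> x)) * h x"
      by (intro mult_right_mono pt h)
    finally show "\<bar>\<phi> x * h x - \<sigma> x * h x\<bar> \<le> \<tau> * h x + M * (h x - \<kappa> x * h x)"
      by (simp add: algebra_simps)
  qed (use sig chi intphi h in auto)
  also have "\<dots> = \<tau> * (\<integral>x. h x \<partial>lborel) + M * ((\<integral>x. h x \<partial>lborel) - (\<Sum>j<?N. m j))"
    using chi h by simp
  also have "\<dots> \<le> \<tau> + M * (1 - (\<Sum>j<?N. m j))"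
    using tau M0 h(3) by (intro add_mono mult_left_mono) (auto intro: mult_left_le)
  finally show ?thesis .
qed

text \<open>Tightness is inherited from \<open>q\<close>: its cells carry mass above
  \<open>1 - \<tau>\<close>, so an \<open>h\<close> of mass at most 1 with nearly the same cell
  masses has little mass outside. Thus finitely many cell masses control the integral of
  \<open>\<phi>\<close>, uniformly in \<open>h\<close>.\<close>

lemma weak_closeness_from_cells:
  fixes \<phi> q :: "real \<Rightarrow> real"
  assumes cont: "continuous_on UNIV \<phi>" and bdd: "bounded (range \<phi>)" and eps: "0 < \<epsilon>"
    and q: "integrable lborel q" "\<And>x. 0 \<le> q x" "(\<integral>x. q x \<partial>lborel) = 1"
  obtains R K n :: nat where
    "\<And>h. integrable lborel h \<Longrightarrow> (\<And>x. 0 \<le> h x) \<Longrightarrow> (\<integral>x. h x \<partial>lborel) \<le> 1 \<Longrightarrow>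
       (\<And>j. j < 2 * R * K \<Longrightarrow> \<bar>(\<integral>x. indicator (cell R K j) x * h x \<partial>lborel) - (\<integral>x. indicator (cell R K j) x * q x \<partial>lborel)\<bar> < 1 / real (Suc n)) \<Longrightarrow>
       \<bar>(\<integral>x. \<phi> x * h x \<partial>lborel) - (\<integral>x. \<phi> x * q x \<partial>lborel)\<bar> < \<epsilon>"
proof -
  obtain M0 where "\<And>x. \<bar>\<phi> x\<bar> \<le> M0" using bdd by (auto simp: bounded_iff)
  then obtain M where M: "\<And>x. \<bar>\<phi> x\<bar> \<le> M" "M > 0"
    by (metis abs_ge_zero gt_ex less_imp_le order.strict_trans1 order.trans)
  have [measurable]: "\<phi> \<in> borel_measurable borel" using cont by (rule borel_measurable_continuous_onI)
  \<comment> \<open>The two step-function errors contribute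
    \<open>2 * \<tau> + 2 * (M * \<tau>) = \<epsilon> / 4\<close>. The deviation of the cell masses
    enters twice, each time with at most \<open>\<epsilon> / 8\<close> by the choice of
    \<open>n\<close>, so the total is at most \<open>\<epsilon> / 2\<close>.\<close>
  define \<tau> where "\<tau> = \<epsilon> / (8 * (1 + M))"
  have tau: "\<tau> > 0" using eps M by (simp add: \<tau>_def)
  have "(\<lambda>R::nat. \<integral>x. indicator {- real R..<real R} x * q x \<partial>lborel) \<longlonglongrightarrow> (\<integral>x. q x \<partial>lborel)"
  proof (rule integral_dominated_convergence[where w=q])
    show "AE x in lborel. (\<lambda>R. indicator {- real R..<real R} x * q x) \<longlonglongrightarrow> q x"
    proof (intro AE_I2 tendsto_eventually)
      fix x :: real
      obtain N :: nat where "\<bar>x\<bar> < real N" using reals_Archimedean2 by blast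
      then show "\<forall>\<^sub>F R in sequentially. indicator {- real R..<real R} x * q x = q x"
        by (intro eventually_sequentiallyI[of N]) (auto simp: indicator_def)
    qed
  qed (use q in \<open>auto simp: indicator_def\<close>)
  then have "\<forall>\<^sub>F R in sequentially. (\<integral>x. indicator {- real R..<real R} x * q x \<partial>lborel) > 1 - \<tau>"
    using q tau by (intro order_tendstoD) auto
  then obtain R :: nat where R: "(\<integral>x. indicator {- real R..<real R} x * q x \<partial>lborel) > 1 - \<tau>"
    by (auto simp: eventually_sequentially)
  have "uniformly_continuous_on {- real R..real R} \<phi>"
    by (intro compact_uniformly_continuous continuous_on_subset[OF cont]) auto
  then obtain d where d: "d > 0" "\<And>x y. x \<in> {- real R..real R} \<Longrightarrow> y \<in> {- real R..real R} \<Longrightarrow> \<bar>y - x\<bar> < d \<Longrightarrow> \<bar>\<phi> y - \<phi> x\<bar> < \<tau>"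
    using tau unfolding uniformly_continuous_on_def dist_real_def by metis
  obtain K0 :: nat where K0: "1 / real (Suc K0) < d"
    using d(1) reals_Archimedean[of d] by (auto simp: inverse_eq_divide)
  define K where "K = Suc K0"
  let ?N = "2 * R * K"
  let ?t = "\<lambda>j::nat. - real R + real j / real K"
  have K: "0 < K" by (simp add: K_def)
  have osc: "\<bar>\<phi> x - \<phi> y\<bar> \<le> \<tau>" if "x \<in> {- real R..real R}" "y \<in> {- real R..real R}" "\<bar>x - y\<bar> \<le> 1 / real K" for x y
    using d(2)[of y x] that K0 unfolding K_def by fastforce
  obtain n :: nat where n: "8 * M * ?N / \<epsilon> < real (Suc n)"
    using reals_Archimedean2[of "8 * M * ?N / \<epsilon>"] by (metis less_trans of_nat_Suc less_add_one add.commute)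
  define \<delta> where "\<delta> = 1 / real (Suc n)"
  have delta: "M * (?N * \<delta>) \<le> \<epsilon> / 8"
    using n eps M unfolding \<delta>_def by (simp add: field_simps)
  show thesis
  proof (rule that[of R K n])
    fix h :: "real \<Rightarrow> real"
    assume h: "integrable lborel h" "\<And>x. 0 \<le> h x" "(\<integral>x. h x \<partial>lborel) \<le> 1"
    define m where "m j = (\<integral>x. indicator (cell R K j) x * h x \<partial>lborel)" for j
    define mq where "mq j = (\<integral>x. indicator (cell R K j) x * q x \<partial>lborel)" for j
    assume "\<And>j. j < ?N \<Longrightarrow> \<bar>(\<integral>x. indicator (cell R K j) x * h x \<partial>lborel) - (\<integral>x. indicator (cell R K j) x * q x \<partial>lborel)\<bar> < 1 / real (Suc n)"
    then have close: "\<bar>m j - mq j\<bar> \<le> \<delta>" if "j < ?N" for j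
      using that unfolding m_def mq_def \<delta>_def by (meson less_imp_le)
    have intq: "integrable lborel (\<lambda>x. indicator (cell R K j) x * q x)" for j
      using integrable_real_mult_indicator[OF _ q(1), of "cell R K j"] by (simp add: mult.commute)
    have "(\<integral>x. indicator {- real R..<real R} x * q x \<partial>lborel) = (\<integral>x. (\<Sum>j<?N. indicator (cell R K j) x * q x) \<partial>lborel)"
    proof (intro Bochner_Integration.integral_cong refl)
      fix x
      show "indicator {- real R..<real R} x * q x = (\<Sum>j<?N. indicator (cell R K j) x * q x)"
        using sum_cells[OF K, where h="\<lambda>_. 1" and R=R and x=x]
        by (cases "- real R \<le> x \<and> x < real R") (auto simp: sum_distrib_right[symmetric] indicator_def[of "{_..<_}"])
    qed
    also have "\<dots> = (\<Sum>j<?N. mq j)" unfolding mq_def using intq by (intro Bochner_Integration.integral_sum)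
    finally have mq: "(\<Sum>j<?N. mq j) > 1 - \<tau>" using R by simp
    have "(\<Sum>j<?N. mq j) - (\<Sum>j<?N. m j) \<le> (\<Sum>j<?N. \<delta>)"
      unfolding sum_subtractf[symmetric] using close by (intro sum_mono) (auto simp: abs_le_iff)
    then have m: "1 - (\<Sum>j<?N. m j) \<le> \<tau> + ?N * \<delta>" using mq by simp
    have 1: "\<bar>(\<integral>x. \<phi> x * h x \<partial>lborel) - (\<Sum>j<?N. \<phi> (?t j) * m j)\<bar> \<le> \<tau> + M * (\<tau> + ?N * \<delta>)"
    proof -
      have "M * (1 - (\<Sum>j<?N. m j)) \<le> M * (\<tau> + ?N * \<delta>)" using m M by (intro mult_left_mono) auto
      then show ?thesis
        using step_function_integral_approx[OF _ M(1) K less_imp_le[OF tau] osc h] unfolding m_def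
        by force
    qed
    have 2: "\<bar>(\<integral>x. \<phi> x * q x \<partial>lborel) - (\<Sum>j<?N. \<phi> (?t j) * mq j)\<bar> \<le> \<tau> + M * \<tau>"
    proof -
      have "M * (1 - (\<Sum>j<?N. mq j)) \<le> M * \<tau>" using mq M by (intro mult_left_mono) auto
      then show ?thesis
        using step_function_integral_approx[OF _ M(1) K less_imp_le[OF tau] osc q(1,2)] q(3) unfolding mq_def
        by force
    qed
    have "\<bar>(\<Sum>j<?N. \<phi> (?t j) * m j) - (\<Sum>j<?N. \<phi> (?t j) * mq j)\<bar> \<le> (\<Sum>j<?N. \<bar>\<phi> (?t j) * m j - \<phi> (?t j) * mq j\<bar>)"
      unfolding sum_subtractf[symmetric] by (rule sum_abs)
    also have "\<dots> \<le> (\<Sum>j<?N. M * \<delta>)"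
    proof (intro sum_mono)
      fix j assume "j \<in> {..<?N}"
      then show "\<bar>\<phi> (?t j) * m j - \<phi> (?t j) * mq j\<bar> \<le> M * \<delta>"
        unfolding right_diff_distrib[symmetric] abs_mult
        using M close[of j] by (intro mult_mono) auto
    qed
    finally have 3: "\<bar>(\<Sum>j<?N. \<phi> (?t j) * m j) - (\<Sum>j<?N. \<phi> (?t j) * mq j)\<bar> \<le> M * (?N * \<delta>)"
      by (simp add: mult.left_commute)
    have "2 * \<tau> + 2 * (M * \<tau>) = 2 * (1 + M) * \<tau>" by (simp add: algebra_simps)
    also have "\<dots> = \<epsilon> / 4" using M unfolding \<tau>_def by (simp add: divide_simps)
    finally have "2 * \<tau> + 2 * (M * \<tau>) = \<epsilon> / 4" .
    then show "\<bar>(\<integral>x. \<phi> x * h x \<partial>lborel) - (\<integral>x. \<phi> x * q x \<partial>lborel)\<bar> < \<epsilon>"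
      using 1 2 3 delta eps unfolding distrib_left by linarith
  qed
qed

context bayes_model
begin

text \<open>\<open>V\<close> need not be measurable, since a weak neighbourhood is an arbitrary superset of a basic one.\<close>
lemma ratio_tendsto_1:
  fixes \<A> :: "'p set set"
  assumes fin: "finite \<A>" and meas: "\<A> \<subseteq> sets P"
    and small: "\<And>A. A \<in> \<A> \<Longrightarrow> (\<lambda>m. (\<integral>\<^sup>+p. indicator A p * lik X m p \<partial>P) / (\<integral>\<^sup>+p. lik X m p \<partial>P)) \<longlonglongrightarrow> 0"
    and cover: "AE p in P. p \<in> V \<or> p \<in> \<Union>\<A>"
    and ev: "\<forall>\<^sub>F m in sequentially. 0 < (\<integral>\<^sup>+p. lik X m p \<partial>P)" "\<And>m. (\<integral>\<^sup>+p. lik X m p \<partial>P) < \<infinity>"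
  shows "(\<lambda>m. (\<integral>\<^sup>+p. indicator V p * lik X m p \<partial>P) / (\<integral>\<^sup>+p. lik X m p \<partial>P)) \<longlonglongrightarrow> 1"
proof -
  let ?E = "\<lambda>m. \<integral>\<^sup>+p. lik X m p \<partial>P"
  let ?r = "\<lambda>V m. (\<integral>\<^sup>+p. indicator V p * lik X m p \<partial>P) / ?E m"
  have [measurable]: "lik X m \<in> borel_measurable P" for m
    unfolding lik_def by measurable
  \<comment> \<open>A measurable stand-in for \<open>V\<close>: almost every point of
    \<open>G\<close> lies in \<open>V\<close>, and monotonicity of \<open>nn_integral\<close> does
    not ask for measurability.\<close>
  define G where "G = space P - \<Union>\<A>"
  have [measurable]: "G \<in> sets P"
    unfolding G_def using fin meas by (intro sets.compl_sets sets.finite_Union) auto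
  have [measurable]: "A \<in> sets P" if "A \<in> \<A>" for A using that meas by auto
  have le: "1 - ?r V m \<le> (\<Sum>A\<in>\<A>. ?r A m)" if E: "0 < ?E m" for m
  proof -
    have "?E m \<le> (\<integral>\<^sup>+p. indicator G p * lik X m p + (\<Sum>A\<in>\<A>. indicator A p * lik X m p) \<partial>P)"
    proof (intro nn_integral_mono)
      fix p assume p: "p \<in> space P"
      show "lik X m p \<le> indicator G p * lik X m p + (\<Sum>A\<in>\<A>. indicator A p * lik X m p)"
      proof (cases "p \<in> G")
        case False
        then obtain A where A: "A \<in> \<A>" "p \<in> A" using p unfolding G_def by auto
        then have "lik X m p \<le> (\<Sum>A\<in>\<A>. indicator A p * lik X m p)"
          using member_le_sum[OF A(1), of "\<lambda>A. indicator A p * lik X m p"] fin by simp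
        then show ?thesis by (simp add: add_increasing)
      qed simp
    qed
    also have "\<dots> = (\<integral>\<^sup>+p. indicator G p * lik X m p \<partial>P) + (\<Sum>A\<in>\<A>. \<integral>\<^sup>+p. indicator A p * lik X m p \<partial>P)"
      by (subst nn_integral_add) (auto simp: nn_integral_sum)
    also have "\<dots> \<le> (\<integral>\<^sup>+p. indicator V p * lik X m p \<partial>P) + (\<Sum>A\<in>\<A>. \<integral>\<^sup>+p. indicator A p * lik X m p \<partial>P)"
    proof (intro add_right_mono nn_integral_mono_AE)
      show "AE p in P. indicator G p * lik X m p \<le> indicator V p * lik X m p"
        using cover by eventually_elim (auto simp: G_def indicator_def)
    qed
    finally have "?E m / ?E m \<le> ((\<integral>\<^sup>+p. indicator V p * lik X m p \<partial>P) + (\<Sum>A\<in>\<A>. \<integral>\<^sup>+p. indicator A p * lik X m p \<partial>P)) / ?E m"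
      by (rule divide_right_mono_ennreal)
    also have "\<dots> = ?r V m + (\<Sum>A\<in>\<A>. ?r A m)"
      by (simp add: divide_ennreal_def distrib_right sum_distrib_right)
    finally have "?E m / ?E m \<le> ?r V m + (\<Sum>A\<in>\<A>. ?r A m)" .
    then have "1 \<le> ?r V m + (\<Sum>A\<in>\<A>. ?r A m)"
      using E ev(2)[of m] by (simp add: ennreal_divide_self)
    then show ?thesis by (simp add: ennreal_minus_le_iff)
  qed
  have up: "?r V m \<le> 1" for m
  proof -
    have "(\<integral>\<^sup>+p. indicator V p * lik X m p \<partial>P) \<le> ?E m"
      by (intro nn_integral_mono) (auto simp: indicator_def)
    then have "?r V m \<le> ?E m / ?E m" by (rule divide_right_mono_ennreal)
    also have "\<dots> \<le> 1" using ev(2)[of m] by (cases "?E m = 0") (auto simp: ennreal_divide_self)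
    finally show ?thesis .
  qed
  have "(\<lambda>m. \<Sum>A\<in>\<A>. ?r A m) \<longlonglongrightarrow> (\<Sum>A\<in>\<A>. 0)"
    by (intro tendsto_sum small)
  then have lim: "(\<lambda>m. \<Sum>A\<in>\<A>. ?r A m) \<longlonglongrightarrow> 0" by simp
  have "(\<lambda>m. 1 - ?r V m) \<longlonglongrightarrow> 0"
  proof (rule tendsto_sandwich[OF _ _ tendsto_const lim])
    show "\<forall>\<^sub>F m in sequentially. 1 - ?r V m \<le> (\<Sum>A\<in>\<A>. ?r A m)"
      using ev(1) by (rule eventually_mono) (rule le)
  qed simp
  then show ?thesis
    by (rule ennreal_tendsto_const_minus[rotated]) (simp add: up)
qed

text \<open>Countably many intervals suffice to control all weak neighbourhoods of a fixed density, so one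
  null set serves every \<open>U\<close>.\<close>
theorem weak_consistency:
  assumes kl: kl_supported and fc: "q = ext0 fc"
  shows "AE X in \<Omega>. \<forall>U. weak_nbhd fc U \<longrightarrow>
    (\<lambda>m. (\<integral>\<^sup>+p. indicator {p. f p \<in> U} p * lik X m p \<partial>P) / (\<integral>\<^sup>+p. lik X m p \<partial>P)) \<longlonglongrightarrow> 1"
proof -
  \<comment> \<open>The sign \<open>s\<close> splits a two-sided deviation of a cell mass into two
    one-sided events, the form that tilting handles. The other indices are naturals, so only
    countably many null sets arise.\<close>
  define Bad where "Bad R K j n s = {p \<in> space P.
      (\<integral>x. (s * indicator (cell R K j) x) * q x \<partial>lborel) + 1 / real (Suc n) \<le> (\<integral>x. (s * indicator (cell R K j) x) * f p x \<partial>lborel)}"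
    for R K j n and s :: real
  have Bad_meas: "Bad R K j n s \<in> sets P" for R K j n s
    unfolding Bad_def by measurable
  have small: "AE X in \<Omega>. (\<lambda>m. (\<integral>\<^sup>+p. indicator (Bad R K j n s) p * lik X m p \<partial>P) / (\<integral>\<^sup>+p. lik X m p \<partial>P)) \<longlonglongrightarrow> 0"
    if "s \<in> {-1, 1}" for R K j n s
    by (rule posterior_ratio_tendsto_0[OF kl _ _ _ _ Bad_def])
       (use that in \<open>auto simp: indicator_def\<close>)
  have "AE X in \<Omega>. \<forall>R K j n. \<forall>s\<in>{-1, 1}. (\<lambda>m. (\<integral>\<^sup>+p. indicator (Bad R K j n s) p * lik X m p \<partial>P) / (\<integral>\<^sup>+p. lik X m p \<partial>P)) \<longlonglongrightarrow> 0"
    unfolding AE_all_countable using small by (auto intro!: AE_finite_allI)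
  then show ?thesis
    using AE_evidence_finite AE_evidence_pos[OF kl]
  proof eventually_elim
    case (elim X)
    show ?case
    proof (intro allI impI)
      fix U assume "weak_nbhd fc U"
      then obtain \<Phi> :: "(real \<Rightarrow> real) list" and \<epsilon> where eps: "0 < \<epsilon>"
        and \<Phi>: "\<And>\<phi>. \<phi> \<in> set \<Phi> \<Longrightarrow> continuous_on UNIV \<phi> \<and> bounded (range \<phi>)"
        and U: "\<And>g. (\<And>\<phi>. \<phi> \<in> set \<Phi> \<Longrightarrow> \<bar>(\<integral>x. \<phi> x * g x \<partial>lborel) - (\<integral>x. \<phi> x * q x \<partial>lborel)\<bar> < \<epsilon>) \<Longrightarrow> g \<in> U"
      proof -
        from \<open>weak_nbhd fc U\<close> obtain \<Phi> \<epsilon> where *: "0 < \<epsilon>"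
          "\<forall>\<phi>\<in>set \<Phi>. continuous_on UNIV \<phi> \<and> bounded (range \<phi>)"
          "{f. \<forall>\<phi>\<in>set \<Phi>. \<bar>(\<integral>x. \<phi> x * f x \<partial>lborel) - (\<integral>x. \<phi> x * q x \<partial>lborel)\<bar> < \<epsilon>} \<subseteq> U"
          unfolding weak_nbhd_def fc by blast
        show thesis
          by (rule that[of \<epsilon> \<Phi>]) (use * in blast)+
      qed
      define close where "close \<phi> R K n \<longleftrightarrow> (\<forall>h. integrable lborel h \<longrightarrow> (\<forall>x. 0 \<le> h x) \<longrightarrow> (\<integral>x. h x \<partial>lborel) \<le> 1 \<longrightarrow>
         (\<forall>j<2 * R * K. \<bar>(\<integral>x. indicator (cell R K j) x * h x \<partial>lborel) - (\<integral>x. indicator (cell R K j) x * q x \<partial>lborel)\<bar> < 1 / real (Suc n)) \<longrightarrow>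
         \<bar>(\<integral>x. \<phi> x * h x \<partial>lborel) - (\<integral>x. \<phi> x * q x \<partial>lborel)\<bar> < \<epsilon>)" for \<phi> :: "real \<Rightarrow> real" and R K n :: nat
      have "\<exists>R K n. close \<phi> R K n" if phi: "\<phi> \<in> set \<Phi>" for \<phi>
        unfolding close_def
        by (rule weak_closeness_from_cells[OF conjunct1[OF \<Phi>[OF phi]] conjunct2[OF \<Phi>[OF phi]] eps q_integrable(1) q_nonneg q_integrable(2)]) blast
      then obtain R K n where close: "\<And>\<phi>. \<phi> \<in> set \<Phi> \<Longrightarrow> close \<phi> (R \<phi>) (K \<phi>) (n \<phi>)"
        by metis
      have RKn: "\<bar>(\<integral>x. \<phi> x * h x \<partial>lborel) - (\<integral>x. \<phi> x * q x \<partial>lborel)\<bar> < \<epsilon>"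
        if "\<phi> \<in> set \<Phi>" "integrable lborel h" "\<And>x. 0 \<le> h x" "(\<integral>x. h x \<partial>lborel) \<le> 1"
         "\<And>j. j < 2 * R \<phi> * K \<phi> \<Longrightarrow> \<bar>(\<integral>x. indicator (cell (R \<phi>) (K \<phi>) j) x * h x \<partial>lborel) - (\<integral>x. indicator (cell (R \<phi>) (K \<phi>) j) x * q x \<partial>lborel)\<bar> < 1 / real (Suc (n \<phi>))"
        for \<phi> h
        using close[OF that(1)] that(2-) unfolding close_def by simp
      define \<A> where "\<A> = (\<Union>\<phi>\<in>set \<Phi>. \<Union>j\<in>{..<2 * R \<phi> * K \<phi>}. \<Union>s\<in>{-1, 1}. {Bad (R \<phi>) (K \<phi>) j (n \<phi>) s})"
      show "(\<lambda>m. (\<integral>\<^sup>+p. indicator {p. f p \<in> U} p * lik X m p \<partial>P) / (\<integral>\<^sup>+p. lik X m p \<partial>P)) \<longlonglongrightarrow> 1"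
      proof (rule ratio_tendsto_1)
        show "finite \<A>" unfolding \<A>_def by auto
        show "\<A> \<subseteq> sets P" unfolding \<A>_def using Bad_meas by auto
        show "(\<lambda>m. (\<integral>\<^sup>+p. indicator A p * lik X m p \<partial>P) / (\<integral>\<^sup>+p. lik X m p \<partial>P)) \<longlonglongrightarrow> 0" if "A \<in> \<A>" for A
          using that elim(1) unfolding \<A>_def by fast
        show "\<forall>\<^sub>F m in sequentially. 0 < (\<integral>\<^sup>+p. lik X m p \<partial>P)" "\<And>m. (\<integral>\<^sup>+p. lik X m p \<partial>P) < \<infinity>"
          using elim by auto
        show "AE p in P. p \<in> {p. f p \<in> U} \<or> p \<in> \<Union>\<A>"
          using f_mass AE_space
        proof eventually_elim
          case (elim p)
          have [measurable]: "f p \<in> borel_measurable borel" using elim(2) by measurable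
          have int: "integrable lborel (f p)"
            using elim f_nonneg by (intro integrableI_nonneg) (auto intro: order.strict_trans1)
          have mass: "(\<integral>x. f p x \<partial>lborel) \<le> 1"
            using elim f_nonneg int by (subst (asm) nn_integral_eq_integral) auto
          have "f p \<in> U" if notin: "p \<notin> \<Union>\<A>"
          proof (rule U)
            fix \<phi> assume phi: "\<phi> \<in> set \<Phi>"
            show "\<bar>(\<integral>x. \<phi> x * f p x \<partial>lborel) - (\<integral>x. \<phi> x * q x \<partial>lborel)\<bar> < \<epsilon>"
            proof (rule RKn[OF phi int f_nonneg mass])
              fix j assume "j < 2 * R \<phi> * K \<phi>"
              then have "p \<notin> Bad (R \<phi>) (K \<phi>) j (n \<phi>) s" if "s \<in> {-1, 1}" for s
                using notin phi that unfolding \<A>_def by blast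
              from this[of 1] this[of "-1"]
              show "\<bar>(\<integral>x. indicator (cell (R \<phi>) (K \<phi>) j) x * f p x \<partial>lborel) - (\<integral>x. indicator (cell (R \<phi>) (K \<phi>) j) x * q x \<partial>lborel)\<bar> < 1 / real (Suc (n \<phi>))"
                using elim(2) unfolding Bad_def by (auto simp: abs_less_iff)
            qed
          qed
          then show ?case by auto
        qed
      qed
    qed
  qed
qed

end

section \<open>The gamma kernel\<close>

text \<open>A bridge from nonnegative Lebesgue integrals to gauge integrals, for which the nonlinear
  change of variables is applied below.\<close>

lemma nn_integral_eq_iff_absolutely_integrable:
  fixes h :: "real \<Rightarrow> real"
  assumes [measurable]: "h \<in> borel_measurable borel" "S \<in> sets borel" and h: "\<And>x. x \<in> S \<Longrightarrow> 0 \<le> h x" and b: "0 \<le> b"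
  shows "(\<integral>\<^sup>+x. ennreal (h x) * indicator S x \<partial>lborel) = ennreal b \<longleftrightarrow> h absolutely_integrable_on S \<and> integral S h = b"
proof -
  have eq: "(\<integral>\<^sup>+x. ennreal (h x) * indicator S x \<partial>lborel) = (\<integral>\<^sup>+x. ennreal (indicator S x *\<^sub>R h x) \<partial>lborel)"
    by (intro nn_integral_cong) (auto simp: indicator_def)
  have nn: "0 \<le> indicator S x *\<^sub>R h x" for x using h by (auto simp: indicator_def)
  have abs: "h absolutely_integrable_on S \<longleftrightarrow> set_integrable lborel S h"
    unfolding set_integrable_def by (intro integrable_completion) measurable
  show ?thesis
  proof
    assume "(\<integral>\<^sup>+x. ennreal (h x) * indicator S x \<partial>lborel) = ennreal b"
    then have "has_bochner_integral lborel (\<lambda>x. indicator S x *\<^sub>R h x) b"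
      using nn b unfolding eq by (intro has_bochner_integral_nn_integral) auto
    then have "set_integrable lborel S h" "(LINT x:S|lborel. h x) = b"
      unfolding set_integrable_def set_lebesgue_integral_def by (auto simp: has_bochner_integral_iff)
    then show "h absolutely_integrable_on S \<and> integral S h = b"
      using abs set_borel_integral_eq_integral(2)[of S h] by simp
  next
    assume *: "h absolutely_integrable_on S \<and> integral S h = b"
    then have i: "set_integrable lborel S h" using abs by auto
    then have "(LINT x:S|lborel. h x) = b" using * set_borel_integral_eq_integral(2)[of S h] by simp
    then show "(\<integral>\<^sup>+x. ennreal (h x) * indicator S x \<partial>lborel) = ennreal b"
      using i nn unfolding eq set_integrable_def set_lebesgue_integral_def
      by (subst nn_integral_eq_integral) auto
  qed
qed

text \<open>\<open>1 / v\<close> maps the positive half-line onto itself with Jacobian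
  \<open>1 / v\<^sup>2\<close>. Change of variables shows that both sides take the same finite
  values \<open>b\<close>; if neither is finite, both are \<open>top\<close>.\<close>

lemma nn_integral_inverse_substitution:
  fixes g :: "real \<Rightarrow> real"
  assumes [measurable]: "g \<in> borel_measurable borel" and g: "\<And>x. 0 < x \<Longrightarrow> 0 \<le> g x"
  shows "(\<integral>\<^sup>+u. ennreal (g u) * indicator {0<..} u \<partial>lborel) = (\<integral>\<^sup>+v. ennreal (g (1 / v) / v\<^sup>2) * indicator {0<..} v \<partial>lborel)"
    (is "?L = ?R")
proof -
  have image: "(\<lambda>v::real. 1 / v) ` {0<..} = {0<..}"
  proof (intro equalityI subsetI)
    fix x :: real assume "x \<in> {0<..}"
    then show "x \<in> (\<lambda>v. 1 / v) ` {0<..}" by (intro image_eqI[of _ _ "1 / x"]) auto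
  qed auto
  have iff: "?L = ennreal b \<longleftrightarrow> ?R = ennreal b" if "0 \<le> b" for b
  proof -
    have "?L = ennreal b \<longleftrightarrow> g absolutely_integrable_on {0<..} \<and> integral {0<..} g = b"
      using that g by (intro nn_integral_eq_iff_absolutely_integrable) auto
    also have "\<dots> \<longleftrightarrow> (\<lambda>v. \<bar>- (1 / v\<^sup>2)\<bar> * g (1 / v)) absolutely_integrable_on {0<..} \<and>
        integral {0<..} (\<lambda>v. \<bar>- (1 / v\<^sup>2)\<bar> * g (1 / v)) = b"
    proof -
      have "((\<lambda>v. 1 / v) has_field_derivative - (1 / v\<^sup>2)) (at v within {0<..})" if "v \<in> {0<..}" for v :: real
        using that by (auto intro!: derivative_eq_intros simp: power2_eq_square)
      from has_absolute_integral_change_of_variables_1'[OF _ this, of g b] image show ?thesis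
        by (simp add: inj_on_def)
    qed
    also have "(\<lambda>v. \<bar>- (1 / v\<^sup>2)\<bar> * g (1 / v)) = (\<lambda>v. g (1 / v) / v\<^sup>2)"
      by (intro ext) simp
    also have "(\<lambda>v. g (1 / v) / v\<^sup>2) absolutely_integrable_on {0<..} \<and> integral {0<..} (\<lambda>v. g (1 / v) / v\<^sup>2) = b \<longleftrightarrow> ?R = ennreal b"
      using that g by (intro nn_integral_eq_iff_absolutely_integrable[symmetric]) auto
    finally show ?thesis .
  qed
  show ?thesis
    by (cases ?L; cases ?R) (use iff in auto)
qed

text \<open>\<open>Gamma\<close> has poles, but its reciprocal \<open>rGamma\<close> is continuous
  on the whole line.\<close>

lemma Gamma_measurable [measurable]: "(Gamma :: real \<Rightarrow> real) \<in> borel_measurable borel"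
proof -
  have "(Gamma :: real \<Rightarrow> real) = (\<lambda>x. inverse (rGamma x))"
    by (simp add: rGamma_inverse_Gamma fun_eq_iff)
  moreover have [measurable]: "(rGamma :: real \<Rightarrow> real) \<in> borel_measurable borel"
    by (intro borel_measurable_continuous_onI continuous_on_rGamma)
  have "(\<lambda>x::real. inverse (rGamma x)) \<in> borel_measurable borel" by measurable
  ultimately show ?thesis by (simp only:)
qed

lemma gamma_kernel_measurable [measurable (raw)]:
  assumes [measurable]: "f \<in> borel_measurable M" "g \<in> borel_measurable M" "h \<in> borel_measurable M"
  shows "(\<lambda>z. gamma_kernel (f z) (g z) (h z)) \<in> borel_measurable M"
  unfolding gamma_kernel_def by measurable

lemma gamma_kernel_nonneg: "0 < V \<Longrightarrow> 0 \<le> gamma_kernel V u x"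
  by (auto simp: gamma_kernel_def intro!: mult_nonneg_nonneg divide_nonneg_pos Gamma_real_pos)

lemma nn_integral_Gamma:
  assumes V: "0 < (V::real)"
  shows "(\<integral>\<^sup>+y. ennreal (y powr (V - 1) * exp (- y)) * indicator {0<..} y \<partial>lborel) = ennreal (Gamma V)"
proof -
  have "(\<integral>\<^sup>+y. ennreal (indicator {0..} y * (y powr (V - 1) / exp y)) \<partial>lborel) = ennreal (Gamma V)"
    by (rule nn_integral_has_integral_lebesgue[OF _ Gamma_integral_real[OF V]]) auto
  moreover have "(\<integral>\<^sup>+y. ennreal (y powr (V - 1) * exp (- y)) * indicator {0<..} y \<partial>lborel)
      = (\<integral>\<^sup>+y. ennreal (indicator {0..} y * (y powr (V - 1) / exp y)) \<partial>lborel)"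
    by (intro nn_integral_cong_AE AE_I[of _ _ "{0}"]) (auto simp: indicator_def exp_minus field_simps)
  ultimately show ?thesis by simp
qed

lemma nn_integral_gamma_kernel:
  assumes V: "0 < V" and u: "0 < u"
  shows "(\<integral>\<^sup>+x. ennreal (gamma_kernel V u x) \<partial>lborel) = 1"
proof -
  have G: "Gamma V > 0" using V by (rule Gamma_real_pos)
  \<comment> \<open>Scaling by \<open>u / V\<close> turns the exponential factor into
    \<open>exp (- y)\<close> and leaves the Gamma integral.\<close>
  have "(\<integral>\<^sup>+x. ennreal (gamma_kernel V u x) \<partial>lborel) = ennreal \<bar>u / V\<bar> * (\<integral>\<^sup>+y. ennreal (gamma_kernel V u (0 + (u / V) * y)) \<partial>lborel)"
    using V u by (intro nn_integral_real_affine) auto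
  also have "\<dots> = (\<integral>\<^sup>+y. ennreal \<bar>u / V\<bar> * ennreal (gamma_kernel V u (0 + (u / V) * y)) \<partial>lborel)"
    by (intro nn_integral_cmult[symmetric]) auto
  also have "\<dots> = (\<integral>\<^sup>+y. ennreal (1 / Gamma V) * (ennreal (y powr (V - 1) * exp (- y)) * indicator {0<..} y) \<partial>lborel)"
  proof (intro nn_integral_cong)
    fix y :: real
    show "ennreal \<bar>u / V\<bar> * ennreal (gamma_kernel V u (0 + (u / V) * y)) = ennreal (1 / Gamma V) * (ennreal (y powr (V - 1) * exp (- y)) * indicator {0<..} y)"
    proof (cases "0 < y")
      case True
      have "(u / V) * gamma_kernel V u ((u / V) * y) = 1 / Gamma V * (y powr (V - 1) * exp (- y))"
      proof -
        have "(V / u) powr V * ((u / V) * y) powr (V - 1) * (u / V) = ((V / u) * (u / V)) powr V * y powr (V - 1)"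
        proof -
          have 1: "((u / V) * y) powr (V - 1) = (u / V) powr (V - 1) * y powr (V - 1)"
            by (rule powr_mult)
          have 2: "(u / V) powr V = (u / V) powr (V - 1) * (u / V)"
            using powr_mult_base[of "u / V" "V - 1"] V u by (simp add: mult.commute)
          have 3: "((V / u) * (u / V)) powr V = (V / u) powr V * (u / V) powr V"
            by (rule powr_mult)
          show ?thesis unfolding 1 3 2 by (simp only: mult_ac)
        qed
        moreover have "(u / V) * gamma_kernel V u ((u / V) * y) =
            ((V / u) powr V * ((u / V) * y) powr (V - 1) * (u / V)) * (exp (- y) / Gamma V)"
          using True V u by (simp add: gamma_kernel_def)
        moreover have "(V / u) * (u / V) = 1" using V u by simp
        ultimately show ?thesis by simp
      qed
      then show ?thesis using True V u G
        by (simp add: ennreal_mult[symmetric] gamma_kernel_nonneg)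
    next
      case False
      then have "u / V * y \<le> 0" using V u by (intro mult_nonneg_nonpos) auto
      then show ?thesis using False by (simp add: gamma_kernel_def)
    qed
  qed
  also have "\<dots> = ennreal (1 / Gamma V) * ennreal (Gamma V)"
    using V by (subst nn_integral_cmult) (auto simp: nn_integral_Gamma)
  also have "\<dots> = 1" using G by (simp add: ennreal_mult[symmetric])
  finally show ?thesis .
qed

lemma gamma_density_eq_kernel:
  assumes "0 < a" "0 < b"
  shows "gamma_density a b x = gamma_kernel a (a / b) x"
  using assms by (simp add: gamma_density_def gamma_kernel_def mult.commute)

lemma inv_gamma_density_measurable [measurable]: "inv_gamma_density r s \<in> borel_measurable borel"
  unfolding inv_gamma_density_def by measurable

lemma gamma_density_measurable [measurable]: "gamma_density r s \<in> borel_measurable borel"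
  unfolding gamma_density_def by measurable

text \<open>Under \<open>u = 1 / v\<close> the density becomes \<open>gamma_density r s\<close>,
  that is, a kernel of shape \<open>r\<close> and mean \<open>r / s\<close>.\<close>

lemma nn_integral_inv_gamma_density:
  assumes r: "0 < r" and s: "0 < s"
  shows "(\<integral>\<^sup>+u. ennreal (inv_gamma_density r s u) \<partial>lborel) = 1"
proof -
  have nn: "0 < u \<Longrightarrow> 0 \<le> inv_gamma_density r s u" for u
    using r by (auto simp: inv_gamma_density_def intro!: mult_nonneg_nonneg divide_nonneg_pos Gamma_real_pos)
  have "(\<integral>\<^sup>+u. ennreal (inv_gamma_density r s u) \<partial>lborel) = (\<integral>\<^sup>+u. ennreal (inv_gamma_density r s u) * indicator {0<..} u \<partial>lborel)"
    by (intro nn_integral_cong) (auto simp: inv_gamma_density_def indicator_def)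
  also have "\<dots> = (\<integral>\<^sup>+v. ennreal (inv_gamma_density r s (1 / v) / v\<^sup>2) * indicator {0<..} v \<partial>lborel)"
    by (intro nn_integral_inverse_substitution nn) auto
  also have "\<dots> = (\<integral>\<^sup>+v. ennreal (gamma_density r s v) \<partial>lborel)"
  proof (intro nn_integral_cong)
    fix v :: real
    show "ennreal (inv_gamma_density r s (1 / v) / v\<^sup>2) * indicator {0<..} v = ennreal (gamma_density r s v)"
    proof (cases "0 < v")
      case True
      have "(1 / v) powr (- r - 1) / v\<^sup>2 = v powr (r - 1)"
      proof -
        have "(1 / v) powr (- r - 1) = v powr (r + 1)"
          using True by (simp add: powr_divide powr_minus_divide[symmetric] add.commute)
        also have "\<dots> = v powr (r - 1 + 2)" by (simp add: add.commute)
        also have "\<dots> = v powr (r - 1) * v\<^sup>2" using True by (subst powr_add) simp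
        finally show ?thesis using True by simp
      qed
      then have "inv_gamma_density r s (1 / v) / v\<^sup>2 = gamma_density r s v"
        using True by (simp add: inv_gamma_density_def gamma_density_def field_simps)
      then show ?thesis using True by simp
    qed (auto simp: gamma_density_def)
  qed
  also have "\<dots> = 1"
    using r s by (simp add: gamma_density_eq_kernel nn_integral_gamma_kernel)
  finally show ?thesis .
qed

lemma gamma_kernel_exp_form:
  assumes "0 < V" "0 < u" "0 < x"
  shows "gamma_kernel V u x = exp (V * ln (V / u) - ln (Gamma V) + (V - 1) * ln x - V / u * x)"
proof -
  have "Gamma V > 0" using assms by (simp add: Gamma_real_pos)
  then show ?thesis
    using assms by (simp add: gamma_kernel_def powr_def exp_add exp_diff exp_minus divide_inverse mult_ac)
qed

text \<open>Dominates 1, \<open>x\<close> and \<open>ln x\<close>, hence every perturbation of the log kernel; its square is integrable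
  by condition (d).\<close>
definition env :: "real \<Rightarrow> real" where "env x = x + 1 / x"

lemma env_ge:
  assumes "0 < x" shows "1 \<le> env x" "x \<le> env x" "\<bar>ln x\<bar> \<le> env x" "1 / x \<le> env x"
proof -
  show x: "x \<le> env x" "1 / x \<le> env x" using assms by (auto simp: env_def)
  show "1 \<le> env x"
  proof (cases "1 \<le> x")
    case False
    then have "1 \<le> 1 / x" using assms by simp
    then show ?thesis using x by linarith
  qed (use x in linarith)
  have "ln x \<le> x" using ln_le_minus_one[OF assms] by linarith
  moreover have "ln (1 / x) \<le> 1 / x" using ln_le_minus_one[of "1 / x"] assms by simp
  ultimately show "\<bar>ln x\<bar> \<le> env x" using x assms by (auto simp: ln_div abs_le_iff)
qed

text \<open>The log kernel is a combination of 1, \<open>ln x\<close> and \<open>x\<close> whose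
  coefficients are continuous in the parameters. Near the base point each coefficient moves by less
  than \<open>\<eta> / 3\<close>, and \<open>env x\<close> dominates all three functions, so one
  neighbourhood serves every \<open>x\<close>.\<close>

lemma gamma_kernel_perturbation:
  assumes V: "0 < V0" and u: "0 < u0" and eta: "0 < \<eta>"
  shows "\<forall>\<^sub>F z in nhds (V0, u0). 0 < fst z \<and> 0 < snd z \<and>
    (\<forall>x>0. gamma_kernel V0 u0 x * exp (- \<eta> * env x) \<le> gamma_kernel (fst z) (snd z) x)"
proof -
  define L where "L z = fst z * ln (fst z / snd z) - ln (Gamma (fst z))" for z :: "real \<times> real"
  have G: "Gamma V0 > 0" using V by (rule Gamma_real_pos)
  have "isCont (\<lambda>z::real \<times> real. Gamma (fst z)) (V0, u0)"
  proof -
    have "isCont (Gamma :: real \<Rightarrow> real) V0"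
      using V by (intro DERIV_isCont[OF has_field_derivative_Gamma]) (auto dest: nonpos_Ints_nonpos)
    then have "isCont (Gamma \<circ> (fst :: real \<times> real \<Rightarrow> real)) (V0, u0)"
      by (intro continuous_at_compose) (auto intro: continuous_intros)
    then show ?thesis by (simp add: o_def)
  qed
  then have "isCont L (V0, u0)"
    unfolding L_def using V u less_imp_neq[OF G] by (intro continuous_intros) auto
  then have tnd1: "(L \<longlongrightarrow> L (V0, u0)) (nhds (V0, u0))"
    unfolding continuous_at tendsto_at_iff_tendsto_nhds .
  define R where "R z = fst z / snd z" for z :: "real \<times> real"
  have "isCont R (V0, u0)"
    unfolding R_def using u by (intro continuous_intros) auto
  then have tnd2: "(R \<longlongrightarrow> R (V0, u0)) (nhds (V0, u0))"
    unfolding continuous_at tendsto_at_iff_tendsto_nhds .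
  have "\<forall>\<^sub>F z in nhds (V0, u0). dist (L z) (L (V0, u0)) < \<eta> / 3"
     "\<forall>\<^sub>F z in nhds (V0, u0). dist (fst z / snd z) (V0 / u0) < \<eta> / 3"
    using tendstoD[OF tnd1, where e="\<eta> / 3"] tendstoD[OF tnd2, where e="\<eta> / 3"] eta
    by (simp_all only: R_def fst_conv snd_conv zero_less_divide_iff) auto
  moreover have "\<forall>\<^sub>F z in nhds (V0, u0). 0 < fst z" "\<forall>\<^sub>F z in nhds (V0, u0). 0 < snd z"
     "\<forall>\<^sub>F z in nhds (V0, u0). dist (fst z) V0 < \<eta> / 3"
  proof -
    have "isCont (\<lambda>z::real \<times> real. fst z) (V0, u0)" "isCont (\<lambda>z::real \<times> real. snd z) (V0, u0)"
      by (intro continuous_intros)+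
    then have f: "((\<lambda>z::real \<times> real. fst z) \<longlongrightarrow> V0) (nhds (V0, u0))"
      and s: "((\<lambda>z::real \<times> real. snd z) \<longlongrightarrow> u0) (nhds (V0, u0))"
      unfolding continuous_at by (metis fst_conv tendsto_at_iff_tendsto_nhds, metis snd_conv tendsto_at_iff_tendsto_nhds)
    show "\<forall>\<^sub>F z in nhds (V0, u0). 0 < fst z" by (rule order_tendstoD(1)[OF f V])
    show "\<forall>\<^sub>F z in nhds (V0, u0). 0 < snd z" by (rule order_tendstoD(1)[OF s u])
    show "\<forall>\<^sub>F z in nhds (V0, u0). dist (fst z) V0 < \<eta> / 3"
      by (rule tendstoD[OF f]) (use eta in simp)
  qed
  ultimately show ?thesis
  proof eventually_elim
    case (elim z)
    obtain V u where z: "z = (V, u)" by (cases z)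
    have Vu: "0 < V" "0 < u" using elim by (auto simp: z)
    have "gamma_kernel V0 u0 x * exp (- \<eta> * env x) \<le> gamma_kernel V u x" if x: "0 < x" for x
    proof -
      note e = env_ge[OF x]
      have "L (V0, u0) - L (V, u) \<le> \<eta> / 3 * 1"
        using elim unfolding z dist_real_def by linarith
      also have "\<dots> \<le> \<eta> / 3 * env x" using e eta by (intro mult_left_mono) auto
      finally have 1: "L (V0, u0) - L (V, u) \<le> \<eta> / 3 * env x" .
      have "(V0 - V) * ln x \<le> \<bar>V0 - V\<bar> * \<bar>ln x\<bar>" by (metis abs_ge_self abs_mult)
      also have "\<dots> \<le> \<eta> / 3 * env x"
      proof (rule mult_mono)
        show "\<bar>V0 - V\<bar> \<le> \<eta> / 3" using elim by (simp add: z dist_real_def abs_minus_commute)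
      qed (use e eta in auto)
      finally have 2: "(V0 - V) * ln x \<le> \<eta> / 3 * env x" .
      have "(V / u - V0 / u0) * x \<le> \<eta> / 3 * env x"
      proof (rule mult_mono)
        show "V / u - V0 / u0 \<le> \<eta> / 3"
          by (rule order_trans[OF abs_ge_self less_imp_le]) (use elim in \<open>simp only: z dist_real_def fst_conv snd_conv\<close>)
      qed (use e eta x in auto)
      then have "V0 * ln (V0 / u0) - ln (Gamma V0) + (V0 - 1) * ln x - V0 / u0 * x - \<eta> * env x
        \<le> V * ln (V / u) - ln (Gamma V) + (V - 1) * ln x - V / u * x"
        using 1 2 unfolding L_def fst_conv snd_conv left_diff_distrib mult_1 by linarith
      then show ?thesis
        using gamma_kernel_exp_form[OF Vu x] gamma_kernel_exp_form[OF assms(1,2) x]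
        by (simp add: exp_add[symmetric])
    qed
    then show ?case using Vu by (simp add: z)
  qed
qed

section \<open>Approximation by finite gamma mixtures\<close>

text \<open>As a function of the inverse mean \<open>v = 1 / u\<close> the kernel is, up to a factor close to 1, an Erlang
  density concentrated at \<open>1 / x\<close>.\<close>
lemma gamma_kernel_inverse_mean:
  assumes x: "0 < x" and v: "0 < v"
  shows "gamma_kernel (real n + 2) (1 / v) x / v\<^sup>2 = (real n + 2) / (real n + 1) * erlang_density n ((real n + 2) * x) v"
proof -
  have G: "Gamma (real n + 2) = fact (Suc n)"
    using Gamma_fact[of "Suc n", where 'a=real] by (simp add: add.commute)
  have 1: "((real n + 2) / (1 / v)) powr (real n + 2) = ((real n + 2) * v) ^ (n + 2)"
    using v powr_realpow[of "(real n + 2) * v" "n + 2"] by (simp add: add.commute)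
  have 2: "x powr (real n + 2 - 1) = x ^ (n + 1)"
    using x powr_realpow[of x "n + 1"] by (simp add: add.commute)
  have "gamma_kernel (real n + 2) (1 / v) x / v\<^sup>2
      = ((real n + 2) * v) ^ (n + 2) / fact (Suc n) * x ^ (n + 1) * exp (- ((real n + 2) * x * v)) / v\<^sup>2"
    using x v unfolding gamma_kernel_def G 1 2 by (simp add: algebra_simps)
  also have "\<dots> = (real n + 2) / (real n + 1) * erlang_density n ((real n + 2) * x) v"
    using x v by (simp add: erlang_density_def power_mult_distrib power2_eq_square divide_simps add.commute)
  finally show ?thesis .
qed

text \<open>Chebyshev's inequality about \<open>1 / x\<close> rather than about the mean
  \<open>(n + 1) / ((n + 2) * x)\<close>: at rate \<open>(n + 2) * x\<close> the second moment about
  \<open>1 / x\<close> is exactly \<open>1 / ((n + 2) * x\<^sup>2)\<close>.\<close>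

lemma erlang_concentration:
  assumes x: "0 < x" and rho: "0 < \<rho>"
  shows "ennreal (1 - 1 / ((real n + 2) * x\<^sup>2 * \<rho>\<^sup>2))
     \<le> (\<integral>\<^sup>+v. ennreal (erlang_density n ((real n + 2) * x) v * indicator {v. \<bar>v - 1 / x\<bar> < \<rho>} v) \<partial>lborel)"
proof -
  define l where "l = (real n + 2) * x"
  have l: "0 < l" using x by (simp add: l_def)
  let ?e = "erlang_density n l"
  have nn: "0 \<le> ?e v" for v using l by simp
  have mom: "has_bochner_integral lborel (\<lambda>v. ?e v * v ^ i) (fact (n + i) / (fact n * l ^ i))" for i
    using nn_integral_erlang_ith_moment[OF l, of n i] l
    by (intro has_bochner_integral_nn_integral) (auto simp: erlang_density_def intro!: AE_I2)
  have "has_bochner_integral lborel (\<lambda>v. ?e v * v ^ 2 - 2 / x * (?e v * v ^ 1) + (1 / x\<^sup>2) * (?e v * v ^ 0))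
     (fact (n + 2) / (fact n * l ^ 2) - 2 / x * (fact (n + 1) / (fact n * l ^ 1)) + (1 / x\<^sup>2) * (fact (n + 0) / (fact n * l ^ 0)))"
    by (intro has_bochner_integral_add has_bochner_integral_diff has_bochner_integral_mult_right mom)
  moreover have "(\<lambda>v. ?e v * v ^ 2 - 2 / x * (?e v * v ^ 1) + (1 / x\<^sup>2) * (?e v * v ^ 0)) = (\<lambda>v. ?e v * (v - 1 / x)\<^sup>2)"
    using x by (intro ext) (simp add: power2_eq_square field_simps)
  moreover have "fact (n + 2) / (fact n * l ^ 2) - 2 / x * (fact (n + 1) / (fact n * l ^ 1)) + (1 / x\<^sup>2) * (fact (n + 0) / (fact n * l ^ 0)) = 1 / ((real n + 2) * x\<^sup>2)"
  proof -
    have a: "(fact (n + 2) :: real) = (real n + 2) * (real n + 1) * fact n" "(fact (n + 1) :: real) = (real n + 1) * fact n"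
      by (simp_all add: numeral_2_eq_2 algebra_simps)
    have "fact (n + 2) / (fact n * l ^ 2) = (real n + 1) / ((real n + 2) * x\<^sup>2)"
      unfolding a l_def using x by (simp add: power2_eq_square divide_simps)
    moreover have "2 / x * (fact (n + 1) / (fact n * l ^ 1)) = 2 * (real n + 1) / ((real n + 2) * x\<^sup>2)"
      unfolding a l_def using x by (simp add: power2_eq_square divide_simps)
    moreover have "(1 / x\<^sup>2) * (fact (n + 0) / (fact n * l ^ 0)) = (real n + 2) / ((real n + 2) * x\<^sup>2)"
      using x by simp
    moreover define E where "E = (real n + 2) * x\<^sup>2"
    moreover have "(real n + 1) / E - 2 * (real n + 1) / E + (real n + 2) / E = 1 / E"
      by (simp add: add_divide_distrib[symmetric] diff_divide_distrib[symmetric])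
    ultimately show ?thesis by simp
  qed
  ultimately have var: "has_bochner_integral lborel (\<lambda>v. ?e v * (v - 1 / x)\<^sup>2) (1 / ((real n + 2) * x\<^sup>2))"
    by simp
  have mass: "has_bochner_integral lborel ?e 1" using mom[of 0] by simp
  have int: "integrable lborel (\<lambda>v. ?e v * indicator {v. \<bar>v - 1 / x\<bar> < \<rho>} v)"
    using mass by (intro integrable_real_mult_indicator) (auto simp: has_bochner_integral_iff)
  have "1 - 1 / ((real n + 2) * x\<^sup>2 * \<rho>\<^sup>2) = (\<integral>v. ?e v - (1 / \<rho>\<^sup>2) * (?e v * (v - 1 / x)\<^sup>2) \<partial>lborel)"
    using var mass by (simp add: has_bochner_integral_iff)
  also have "\<dots> \<le> (\<integral>v. ?e v * indicator {v. \<bar>v - 1 / x\<bar> < \<rho>} v \<partial>lborel)"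
  proof (rule integral_mono)
    show "integrable lborel (\<lambda>v. ?e v - (1 / \<rho>\<^sup>2) * (?e v * (v - 1 / x)\<^sup>2))"
      using var mass by (auto simp: has_bochner_integral_iff)
    fix v
    show "?e v - (1 / \<rho>\<^sup>2) * (?e v * (v - 1 / x)\<^sup>2) \<le> ?e v * indicator {v. \<bar>v - 1 / x\<bar> < \<rho>} v"
    proof (cases "\<bar>v - 1 / x\<bar> < \<rho>")
      case True
      then show ?thesis using nn[of v] by simp
    next
      case False
      then have "\<rho>\<^sup>2 \<le> (v - 1 / x)\<^sup>2" using rho by (metis abs_le_square_iff abs_of_pos not_less)
      then have "1 \<le> (1 / \<rho>\<^sup>2) * (v - 1 / x)\<^sup>2" using rho by simp
      then have "?e v * 1 \<le> ?e v * ((1 / \<rho>\<^sup>2) * (v - 1 / x)\<^sup>2)" by (intro mult_left_mono nn)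
      then show ?thesis using False by (simp add: mult_ac)
    qed
  qed (rule int)
  finally have "ennreal (1 - 1 / ((real n + 2) * x\<^sup>2 * \<rho>\<^sup>2)) \<le> ennreal (\<integral>v. ?e v * indicator {v. \<bar>v - 1 / x\<bar> < \<rho>} v \<partial>lborel)"
    by (rule ennreal_leI)
  also have "\<dots> = (\<integral>\<^sup>+v. ennreal (?e v * indicator {v. \<bar>v - 1 / x\<bar> < \<rho>} v) \<partial>lborel)"
    using int nn by (intro nn_integral_eq_integral[symmetric]) auto
  finally show ?thesis unfolding l_def .
qed

text \<open>In the variable \<open>v = 1 / u\<close> the kernel concentrates at
  \<open>1 / x\<close>, where \<open>f0 (1 / v)\<close> is close to \<open>f0 x\<close>.
  Discretization needs means in a compact interval away from 0; as the interval grows with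
  \<open>n\<close>, it eventually contains the relevant means for the given
  \<open>x\<close>.\<close>

lemma continuous_gamma_mixture_lower_bound:
  fixes f0 :: "real \<Rightarrow> real"
  assumes [measurable]: "f0 \<in> borel_measurable borel" and nn: "\<And>x. 0 \<le> f0 x"
    and x: "0 < x" and cont: "isCont f0 x" and pos: "0 < f0 x" and c: "0 < c" "c < 1"
  shows "\<forall>\<^sub>F n in sequentially. ennreal (c * f0 x) \<le>
    (\<integral>\<^sup>+u. ennreal (gamma_kernel (real n + 2) u x * f0 u) * indicator {1 / (real n + 1)..real n + 1} u \<partial>lborel)"
proof -
  \<comment> \<open>The loss is split evenly: one factor pays for the variation of
    \<open>f0\<close>, the other for the Erlang mass away from \<open>1 / x\<close>.\<close>
  define c' where "c' = sqrt c"
  have c': "0 < c'" "c' < 1" "c' * c' = c" using c by (auto simp: c'_def)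
  have "isCont (\<lambda>v. f0 (1 / v)) (1 / x)"
  proof -
    have "isCont (f0 \<circ> (\<lambda>v. 1 / v)) (1 / x)"
      using x cont by (intro continuous_at_compose) (auto intro!: continuous_intros)
    then show ?thesis by (simp add: o_def)
  qed
  then have "((\<lambda>v. f0 (1 / v)) \<longlongrightarrow> f0 x) (at (1 / x))"
    using x by (simp add: isCont_def)
  moreover have "c' * f0 x < f0 x" using c' pos by simp
  ultimately have "\<forall>\<^sub>F v in at (1 / x). c' * f0 x < f0 (1 / v)" by (rule order_tendstoD)
  moreover have "c' * f0 x < f0 (1 / (1 / x))" using c' pos by simp
  ultimately obtain \<rho>1 where \<rho>1: "\<rho>1 > 0" "\<And>v. dist v (1 / x) < \<rho>1 \<Longrightarrow> c' * f0 x < f0 (1 / v)"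
    unfolding eventually_at by (metis UNIV_I dist_self)
  \<comment> \<open>The bound \<open>1 / (2 * x)\<close> keeps \<open>1 / v\<close> between
    \<open>x / 2\<close> and \<open>2 * x\<close>, hence in the truncation interval for large
    \<open>n\<close>.\<close>
  define \<rho> where "\<rho> = min \<rho>1 (1 / (2 * x))"
  have rho: "\<rho> > 0" using \<rho>1 x by (simp add: \<rho>_def)
  have near: "0 < v" "x / 2 \<le> 1 / v" "1 / v \<le> 2 * x" "c' * f0 x \<le> f0 (1 / v)" if v: "\<bar>v - 1 / x\<bar> < \<rho>" for v
  proof -
    have "\<bar>v - 1 / x\<bar> < 1 / (2 * x)" "\<bar>v - 1 / x\<bar> < \<rho>1" using v by (auto simp: \<rho>_def)
    then have b: "1 / (2 * x) < v" "v < 3 / (2 * x)"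
    proof -
      have "1 / x = 1 / (2 * x) + 1 / (2 * x)" "3 / (2 * x) = 1 / (2 * x) + 1 / (2 * x) + 1 / (2 * x)"
        using x by (simp_all add: field_simps)
      then show "1 / (2 * x) < v" "v < 3 / (2 * x)"
        using \<open>\<bar>v - 1 / x\<bar> < 1 / (2 * x)\<close> unfolding abs_less_iff by linarith+
    qed
    then show vpos: "0 < v" using x by (meson less_trans mult_pos_pos zero_less_divide_1_iff zero_less_numeral)
    have "1 < v * (2 * x)" "v * (2 * x) < 3"
      using b x by (simp_all add: pos_divide_less_eq pos_less_divide_eq)
    then show "x / 2 \<le> 1 / v" "1 / v \<le> 2 * x"
      unfolding pos_le_divide_eq[OF vpos] pos_divide_le_eq[OF vpos] by (simp_all add: mult_ac)
    show "c' * f0 x \<le> f0 (1 / v)"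
      using \<rho>1(2)[of v] \<open>\<bar>v - 1 / x\<bar> < \<rho>1\<close> by (simp add: dist_real_def)
  qed
  have "((\<lambda>n. 1 - 1 / ((real n + 2) * x\<^sup>2 * \<rho>\<^sup>2)) \<longlongrightarrow> 1) sequentially"
    using x rho by real_asymp
  then have "\<forall>\<^sub>F n in sequentially. c' < 1 - 1 / ((real n + 2) * x\<^sup>2 * \<rho>\<^sup>2)"
    using c' by (intro order_tendstoD)
  moreover have "\<forall>\<^sub>F n in sequentially. 2 * x \<le> real n + 1" by real_asymp
  moreover have "\<forall>\<^sub>F n in sequentially. 1 / (real n + 1) \<le> x / 2" using x by real_asymp
  ultimately show ?thesis
  proof eventually_elim
    case (elim n)
    let ?k = "\<lambda>v. gamma_kernel (real n + 2) (1 / v) x * f0 (1 / v) * indicator {1 / (real n + 1)..real n + 1} (1 / v) / v\<^sup>2"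
    let ?E = "\<lambda>v. erlang_density n ((real n + 2) * x) v * indicator {v. \<bar>v - 1 / x\<bar> < \<rho>} v"
    have "ennreal (c * f0 x) = ennreal (c' * f0 x) * ennreal c'"
      using c' pos by (subst ennreal_mult[symmetric]) auto
    also have "\<dots> \<le> ennreal (c' * f0 x) * (\<integral>\<^sup>+v. ennreal (?E v) \<partial>lborel)"
      by (intro mult_left_mono order_trans[OF _ erlang_concentration[OF x rho]] ennreal_leI less_imp_le elim)
         (use c' pos in auto)
    also have "\<dots> = (\<integral>\<^sup>+v. ennreal (c' * f0 x) * ennreal (?E v) \<partial>lborel)"
      by (intro nn_integral_cmult[symmetric]) auto
    also have "\<dots> \<le> (\<integral>\<^sup>+v. ennreal (?k v) * indicator {0<..} v \<partial>lborel)"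
    proof (intro nn_integral_mono)
      fix v :: real
      show "ennreal (c' * f0 x) * ennreal (?E v) \<le> ennreal (?k v) * indicator {0<..} v"
      proof (cases "\<bar>v - 1 / x\<bar> < \<rho>")
        case True
        note nv = near[OF True]
        have ind: "1 / v \<in> {1 / (real n + 1)..real n + 1}" using nv elim by auto
        have e0: "0 \<le> erlang_density n ((real n + 2) * x) v" using x by simp
        have "c' * f0 x * erlang_density n ((real n + 2) * x) v \<le> f0 (1 / v) * ((real n + 2) / (real n + 1) * erlang_density n ((real n + 2) * x) v)"
        proof (intro mult_mono nv)
          have "1 * erlang_density n ((real n + 2) * x) v \<le> (real n + 2) / (real n + 1) * erlang_density n ((real n + 2) * x) v"
            using e0 by (intro mult_right_mono) auto
          then show "erlang_density n ((real n + 2) * x) v \<le> (real n + 2) / (real n + 1) * erlang_density n ((real n + 2) * x) v" by simp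
        qed (use nn e0 in auto)
        also have "\<dots> = f0 (1 / v) * (gamma_kernel (real n + 2) (1 / v) x / v\<^sup>2)"
          by (simp only: gamma_kernel_inverse_mean[OF x nv(1)])
        also have "\<dots> = ?k v"
          using ind by (simp add: mult.commute)
        finally show ?thesis
          using True nv(1) c' pos e0 by (simp add: ennreal_mult[symmetric] ennreal_leI)
      qed simp
    qed
    also have "\<dots> = (\<integral>\<^sup>+u. ennreal (gamma_kernel (real n + 2) u x * f0 u * indicator {1 / (real n + 1)..real n + 1} u) * indicator {0<..} u \<partial>lborel)"
      using nn by (intro nn_integral_inverse_substitution[symmetric]) (auto simp: gamma_kernel_nonneg)
    also have "\<dots> \<le> (\<integral>\<^sup>+u. ennreal (gamma_kernel (real n + 2) u x * f0 u) * indicator {1 / (real n + 1)..real n + 1} u \<partial>lborel)"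
      by (intro nn_integral_mono) (auto simp: indicator_def)
    finally show ?case .
  qed
qed

text \<open>Lowering the mean from \<open>u\<close> to \<open>u'\<close> does not decrease the
  factor \<open>(V / u) powr V\<close>. Only the exponential factor costs, and its exponent changes
  by at most \<open>V * d * x / a\<^sup>2\<close>.\<close>

lemma gamma_kernel_mean_shift:
  assumes "0 < V" "0 < a" "a \<le> u'" "u' \<le> u" "u \<le> u' + d" "V * d \<le> \<eta> * a\<^sup>2" "0 < x"
  shows "gamma_kernel V u x \<le> exp (\<eta> * env x) * gamma_kernel V u' x"
proof -
  have u: "0 < u'" "0 < u" using assms by auto
  have eta: "0 \<le> \<eta>"
  proof -
    have "0 \<le> d" using assms by linarith
    then have "0 \<le> \<eta> * a\<^sup>2" using assms by (meson less_imp_le mult_nonneg_nonneg order_trans)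
    then show ?thesis using assms by (simp add: zero_le_mult_iff)
  qed
  have ln: "V * ln (V / u) \<le> V * ln (V / u')"
    using assms u by (intro mult_left_mono) (auto simp: ln_div)
  have "V / u' * x - V / u * x = V * (u - u') * x / (u' * u)"
    using u by (simp add: field_simps)
  also have "\<dots> \<le> V * d * x / (a * a)"
    using assms u by (intro frac_le mult_right_mono mult_left_mono mult_mono) auto
  also have "\<dots> \<le> \<eta> * a\<^sup>2 * x / (a * a)"
    using assms by (intro divide_right_mono mult_right_mono) auto
  also have "\<dots> = \<eta> * x" using assms by (simp add: power2_eq_square)
  also have "\<dots> \<le> \<eta> * env x" using env_ge[OF assms(7)] eta by (intro mult_left_mono) auto
  finally show ?thesis
    using ln unfolding gamma_kernel_exp_form[OF assms(1) u(1) assms(7)] gamma_kernel_exp_form[OF assms(1) u(2) assms(7)]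
    by (simp add: exp_add[symmetric])
qed

text \<open>Each mean is moved down to the left end of its cell, and the cell's mass under
  \<open>f0\<close> becomes the weight. The cells are disjoint, so the weights sum to at most the
  mass of \<open>f0\<close>.\<close>

lemma gamma_mixture_discretization:
  fixes f0 :: "real \<Rightarrow> real"
  assumes [measurable]: "f0 \<in> borel_measurable borel" and nn: "\<And>x. 0 \<le> f0 x"
    and mass: "integrable lborel f0" "(\<integral>x. f0 x \<partial>lborel) \<le> 1"
    and V: "0 < V" and a: "0 < a" and eta: "0 < \<eta>"
  shows "\<exists>(K::nat) w u. (\<forall>k. 0 \<le> w k) \<and> (\<forall>k. 0 < u k) \<and> (\<Sum>k<K. w k) \<le> 1 \<and>
    (\<forall>x>0. (\<integral>\<^sup>+v. ennreal (gamma_kernel V v x * f0 v) * indicator {a..b} v \<partial>lborel)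
      \<le> ennreal (exp (\<eta> * env x) * (\<Sum>k<K. w k * gamma_kernel V (u k) x)))"
proof -
  \<comment> \<open>The largest step that \<open>gamma_kernel_mean_shift\<close> permits:
    \<open>V * d = \<eta> * a\<^sup>2\<close>.\<close>
  define d where "d = \<eta> * a\<^sup>2 / V"
  have d: "0 < d" using assms by (simp add: d_def)
  \<comment> \<open>The extra 1 provides the cell that contains the right end
    \<open>b\<close>.\<close>
  define K where "K = nat \<lceil>(b - a) / d\<rceil> + 1"
  define u where "u k = a + real k * d" for k :: nat
  define I where "I k = {u k..<u k + d}" for k
  define w where "w k = (\<integral>v. indicator (I k) v * f0 v \<partial>lborel)" for k
  have [measurable]: "I k \<in> sets borel" for k by (simp add: I_def)
  have upos: "0 < u k" "a \<le> u k" for k using a d by (auto simp: u_def add_pos_nonneg)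
  have w0: "0 \<le> w k" for k unfolding w_def using nn by (intro integral_nonneg_AE) auto
  have int: "integrable lborel (\<lambda>v. indicator (I k) v * f0 v)" for k
    using integrable_real_mult_indicator[OF _ mass(1), of "I k"] by (simp add: mult.commute)
  have I_iff: "v \<in> I k \<longleftrightarrow> a \<le> v \<and> k = nat \<lfloor>(v - a) / d\<rfloor>" for v k
  proof -
    have "v \<in> I k \<longleftrightarrow> real k \<le> (v - a) / d \<and> (v - a) / d < real k + 1"
      using d unfolding I_def u_def by (auto simp: field_simps)
    moreover have "real k \<le> (v - a) / d \<Longrightarrow> a \<le> v"
      using d of_nat_0_le_iff[of k, where 'a=real] by (meson diff_ge_0_iff_ge order_trans zero_le_divide_iff not_less)
    moreover have "a \<le> v \<Longrightarrow> 0 \<le> (v - a) / d" using d by simp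
    ultimately show ?thesis by (auto simp: le_nat_floor) linarith+
  qed
  have sum1: "(\<Sum>k<K. indicator (I k) v) \<le> (1::real)" for v
  proof -
    have "(\<Sum>k<K. indicator (I k) v) = (\<Sum>k<K. if k = nat \<lfloor>(v - a) / d\<rfloor> then (if a \<le> v then 1 else 0) else (0::real))"
      by (intro sum.cong) (auto simp: indicator_def I_iff)
    then show ?thesis by (simp add: sum.delta)
  qed
  have "(\<Sum>k<K. w k) = (\<integral>v. (\<Sum>k<K. indicator (I k) v * f0 v) \<partial>lborel)"
    unfolding w_def by (intro Bochner_Integration.integral_sum[symmetric] int)
  also have "\<dots> \<le> (\<integral>v. f0 v \<partial>lborel)"
  proof (rule integral_mono)
    fix v
    have "(\<Sum>k<K. indicator (I k) v) * f0 v \<le> 1 * f0 v" by (intro mult_right_mono sum1 nn)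
    then show "(\<Sum>k<K. indicator (I k) v * f0 v) \<le> f0 v" by (simp only: sum_distrib_right mult_1)
  qed (rule mass(1) | intro Bochner_Integration.integrable_sum int)+
  finally have sumw: "(\<Sum>k<K. w k) \<le> 1" using mass by simp
  have "(\<integral>\<^sup>+v. ennreal (gamma_kernel V v x * f0 v) * indicator {a..b} v \<partial>lborel)
      \<le> ennreal (exp (\<eta> * env x) * (\<Sum>k<K. w k * gamma_kernel V (u k) x))" if x: "0 < x" for x
  proof -
    let ?h = "\<lambda>v. exp (\<eta> * env x) * (\<Sum>k<K. (indicator (I k) v * f0 v) * gamma_kernel V (u k) x)"
    have h_int: "has_bochner_integral lborel ?h (exp (\<eta> * env x) * (\<Sum>k<K. w k * gamma_kernel V (u k) x))"
      unfolding w_def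
      by (intro has_bochner_integral_mult_right has_bochner_integral_sum has_bochner_integral_mult_left has_bochner_integral_integrable int)
    have h_nn: "0 \<le> ?h v" for v
      using nn V by (intro mult_nonneg_nonneg sum_nonneg) (auto simp: gamma_kernel_nonneg)
    have "(\<integral>\<^sup>+v. ennreal (gamma_kernel V v x * f0 v) * indicator {a..b} v \<partial>lborel) \<le> (\<integral>\<^sup>+v. ennreal (?h v) \<partial>lborel)"
    proof (intro nn_integral_mono)
      fix v
      show "ennreal (gamma_kernel V v x * f0 v) * indicator {a..b} v \<le> ennreal (?h v)"
      proof (cases "v \<in> {a..b}")
        case True
        define j where "j = nat \<lfloor>(v - a) / d\<rfloor>"
        have vj: "v \<in> I j" using True by (simp add: I_iff j_def)
        have "(v - a) / d \<le> (b - a) / d" using True d by (intro divide_right_mono) auto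
        then have jK: "j < K" unfolding j_def K_def using True d by (simp add: less_Suc_eq_le) linarith
        have "gamma_kernel V v x \<le> exp (\<eta> * env x) * gamma_kernel V (u j) x"
          using vj upos(2)[of j] V a x
          by (intro gamma_kernel_mean_shift[where a=a and d=d]) (auto simp: I_def d_def)
        then have "gamma_kernel V v x * f0 v \<le> exp (\<eta> * env x) * gamma_kernel V (u j) x * f0 v"
          by (rule mult_right_mono) (rule nn)
        also have "\<dots> = exp (\<eta> * env x) * ((indicator (I j) v * f0 v) * gamma_kernel V (u j) x)"
          using vj by simp
        also have "\<dots> \<le> ?h v"
        proof (intro mult_left_mono)
          show "(indicator (I j) v * f0 v) * gamma_kernel V (u j) x \<le> (\<Sum>k<K. (indicator (I k) v * f0 v) * gamma_kernel V (u k) x)"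
            using jK nn V by (intro member_le_sum) (auto simp: gamma_kernel_nonneg)
        qed auto
        finally show ?thesis using True by (simp add: ennreal_leI)
      qed simp
    qed
    also have "\<dots> = ennreal (exp (\<eta> * env x) * (\<Sum>k<K. w k * gamma_kernel V (u k) x))"
      using h_int h_nn by (subst nn_integral_eq_integral) (auto simp: has_bochner_integral_iff)
    finally show ?thesis .
  qed
  then show ?thesis using w0 upos sumw by (intro exI[of _ K] exI[of _ w] exI[of _ u]) auto
qed

lemma env_pos: "0 < x \<Longrightarrow> 0 < env x"
  using env_ge(1)[of x] by linarith

lemma env_measurable [measurable]: "env \<in> borel_measurable borel"
  unfolding env_def by measurable

lemma gamma_kernel_1_1: "0 < x \<Longrightarrow> gamma_kernel 1 1 x = exp (- x)"
  by (simp add: gamma_kernel_def)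

text \<open>The mixture contains a small multiple of the exponential density \<open>exp (- x)\<close>. This bounds the log
  ratio by a multiple of \<open>env\<close> uniformly along the approximating sequence.\<close>
lemma finite_gamma_mixture_kl:
  fixes f0 :: "real \<Rightarrow> real" and D :: "real measure"
  assumes f0[measurable]: "f0 \<in> borel_measurable borel" and nn: "\<And>x. 0 \<le> f0 x"
    and bdd: "\<And>x. f0 x \<le> C" and pos: "\<And>x. 0 < x \<Longrightarrow> 0 < f0 x"
    and cont: "\<And>x. 0 < x \<Longrightarrow> isCont f0 x"
    and mass: "integrable lborel f0" "(\<integral>x. f0 x \<partial>lborel) \<le> 1"
    and D: "prob_space D" "sets D = sets borel" and AED: "AE x in D. 0 < x"
    and env: "integrable D env" and eps: "0 < \<epsilon>"
  shows "\<exists>(K::nat) w V u Y c. (\<forall>k. 0 \<le> w k \<and> 0 < V k \<and> 0 < u k) \<and> (\<Sum>k<K. w k) < 1 \<and>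
    Y \<in> borel_measurable borel \<and> (\<forall>x. 0 \<le> Y x) \<and> (\<forall>x>0. Y x \<le> c * env x) \<and> (\<integral>x. Y x \<partial>D) < \<epsilon> \<and>
    (\<forall>x>0. f0 x * exp (- Y x) \<le> (\<Sum>k<K. w k * gamma_kernel (V k) (u k) x))"
proof -
  interpret D: prob_space D by fact
  have bmD: "borel_measurable D = borel_measurable borel"
    by (rule measurable_cong_sets) (simp_all add: D)
  \<comment> \<open>Weight \<open>e\<close> goes to the exponential density and
    \<open>1 - 2 * e\<close> to the discretized mixture, so the total stays below 1. Another
    \<open>e\<close> is reserved for the approximation error, and \<open>1 - 3 * e\<close> is
    exactly \<open>exp (- (\<epsilon> / 4))\<close>.\<close>
  define e where "e = (1 - exp (- (\<epsilon> / 4))) / 3"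
  have e: "0 < e" "e < 1 / 3" "1 - 3 * e = exp (- (\<epsilon> / 4))" 
  proof -
    show "0 < e" "e < 1 / 3" using eps by (simp_all add: e_def)
    have "3 * e = 1 - exp (- (\<epsilon> / 4))" by (simp add: e_def)
    then show "1 - 3 * e = exp (- (\<epsilon> / 4))" by linarith
  qed
  define mixes where "mixes n K w u \<longleftrightarrow> (\<forall>k. 0 \<le> w k) \<and> (\<forall>k. 0 < u k) \<and> (\<Sum>k<K. w k) \<le> 1 \<and>
    (\<forall>x>0. (\<integral>\<^sup>+v. ennreal (gamma_kernel (real n + 2) v x * f0 v) * indicator {1 / (real n + 1)..real n + 1} v \<partial>lborel)
      \<le> ennreal (exp (1 / (real n + 1) * env x) * (\<Sum>k<K. w k * gamma_kernel (real n + 2) (u k) x)))"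
    for n K :: nat and w u
  have "\<exists>K w u. mixes n K w u" for n
    unfolding mixes_def by (intro gamma_mixture_discretization f0 nn mass) auto
  then obtain K w u where mixes: "\<And>n. mixes n (K n) (w n) (u n)"
    by metis
  have w0: "0 \<le> w n k" and u0: "0 < u n k" and w1: "(\<Sum>k<K n. w n k) \<le> 1" for n k
    using mixes[of n] unfolding mixes_def by auto
  have disc: "(\<integral>\<^sup>+v. ennreal (gamma_kernel (real n + 2) v x * f0 v) * indicator {1 / (real n + 1)..real n + 1} v \<partial>lborel)
      \<le> ennreal (exp (1 / (real n + 1) * env x) * (\<Sum>k<K n. w n k * gamma_kernel (real n + 2) (u n k) x))"
    if "0 < x" for n x
    using mixes[of n] that unfolding mixes_def by blast
  define S where "S n x = (\<Sum>k<K n. w n k * gamma_kernel (real n + 2) (u n k) x)" for n x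
  define F where "F n x = e * gamma_kernel 1 1 x + (1 - 2 * e) * S n x" for n x
  have [measurable]: "S n \<in> borel_measurable borel" "F n \<in> borel_measurable borel" for n
    unfolding F_def S_def by measurable
  have S0: "0 \<le> S n x" for n x
    unfolding S_def using w0 by (intro sum_nonneg mult_nonneg_nonneg gamma_kernel_nonneg) auto
  have Fge: "e * exp (- x) \<le> F n x" "(1 - 2 * e) * S n x \<le> F n x" if "0 < x" for n x
    using that e S0[of n x] by (auto simp: F_def gamma_kernel_1_1)
  have Fpos: "0 < F n x" if "0 < x" for n x
    using Fge(1)[OF that, of n] e by (meson exp_gt_zero less_le_trans mult_pos_pos)
  define Y where "Y n x = (if 0 < x then max 0 (ln (f0 x / F n x)) else 0)" for n x
  have [measurable]: "Y n \<in> borel_measurable borel" for n unfolding Y_def by measurable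
  have Y0: "0 \<le> Y n x" for n x by (simp add: Y_def)
  \<comment> \<open>\<open>C' \<ge> 1\<close> and \<open>e < 1\<close> make
    \<open>ln C' - ln e\<close> nonnegative; the 1 added in \<open>c\<close> accounts for the term
    \<open>x\<close> that comes from \<open>exp (- x)\<close>.\<close>
  define C' where "C' = max C 1"
  define c where "c = ln C' - ln e + 1"
  have C': "1 \<le> C'" "f0 x \<le> C'" for x using bdd[of x] by (auto simp: C'_def)
  have c0: "1 \<le> c" unfolding c_def using C' e by simp
  have Yle: "Y n x \<le> c * env x" if x: "0 < x" for n x
  proof -
    have "f0 x / F n x \<le> C' / (e * exp (- x))"
      using C' e Fge(1)[OF x, of n] nn by (intro frac_le) auto
    then have "ln (f0 x / F n x) \<le> ln (C' / (e * exp (- x)))"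
      using pos[OF x] Fpos[OF x, of n] by (intro ln_mono) auto
    also have "\<dots> = (ln C' - ln e) + x"
      using C'(1) e by (simp add: ln_div ln_mult)
    also have "\<dots> \<le> (ln C' - ln e) * env x + env x"
      using env_ge[OF x] C'(1) e by (intro add_mono) (auto simp: mult_le_cancel_left1)
    also have "\<dots> = c * env x" by (simp add: c_def algebra_simps)
    finally show ?thesis using c0 env_pos[OF x] x by (simp add: Y_def)
  qed
  \<comment> \<open>\<open>Y n\<close> need not tend to 0, because the weight of the mixture falls
    short of 1 by a fixed amount. Its excess over \<open>\<epsilon> / 4\<close> does tend to 0, and
    is dominated by \<open>c * env\<close>.\<close>
  define Z where "Z n x = max 0 (Y n x - \<epsilon> / 4)" for n x
  have [measurable]: "Z n \<in> borel_measurable borel" for n unfolding Z_def by measurable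
  have Zlim: "(\<lambda>n. Z n x) \<longlonglongrightarrow> 0" if x: "0 < x" for x
  proof -
    \<comment> \<open>The factor \<open>a\<close> is lost twice, in the discretization and in the
      continuous mixture.\<close>
    define a where "a = sqrt ((1 - 3 * e) / (1 - 2 * e))"
    have a: "0 < a" "a < 1" "(1 - 2 * e) * (a * a) = 1 - 3 * e"
      using e by (auto simp: a_def)
    have "((\<lambda>n. exp (- (1 / (real n + 1) * env x))) \<longlongrightarrow> 1) sequentially"
      by real_asymp
    then have "\<forall>\<^sub>F n in sequentially. a < exp (- (1 / (real n + 1) * env x))"
      using a by (intro order_tendstoD)
    moreover have "\<forall>\<^sub>F n in sequentially. ennreal (a * f0 x) \<le>
       (\<integral>\<^sup>+v. ennreal (gamma_kernel (real n + 2) v x * f0 v) * indicator {1 / (real n + 1)..real n + 1} v \<partial>lborel)"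
      by (intro continuous_gamma_mixture_lower_bound f0 nn x cont pos a)
    ultimately have "\<forall>\<^sub>F n in sequentially. Z n x = 0"
    proof eventually_elim
      case (elim n)
      let ?E = "exp (1 / (real n + 1) * env x)"
      have "ennreal (a * f0 x) \<le> ennreal (?E * S n x)"
        using elim(2) disc[OF x, of n] unfolding S_def by (rule order_trans)
      then have 1: "a * f0 x \<le> ?E * S n x"
        using S0[of n x] by (subst (asm) ennreal_le_iff) auto
      have "a * (a * f0 x) \<le> exp (- (1 / (real n + 1) * env x)) * (?E * S n x)"
        by (rule mult_mono[OF less_imp_le[OF elim(1)] 1]) (use a nn in auto)
      also have "\<dots> = S n x" by (simp add: mult.assoc[symmetric] exp_add[symmetric])
      finally have "(1 - 2 * e) * (a * (a * f0 x)) \<le> (1 - 2 * e) * S n x"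
        using e by (intro mult_left_mono) auto
      then have "(1 - 3 * e) * f0 x \<le> F n x"
        using Fge(2)[OF x, of n] a(3) by (simp add: mult.assoc[symmetric])
      then have "f0 x / F n x \<le> exp (\<epsilon> / 4)"
        using Fpos[OF x, of n] unfolding e(3) by (simp add: exp_minus field_simps)
      moreover have "0 < f0 x / F n x" using pos[OF x] Fpos[OF x, of n] by simp
      ultimately have "ln (f0 x / F n x) \<le> ln (exp (\<epsilon> / 4))" by (intro ln_mono) auto
      then show ?case using eps x by (simp add: Z_def Y_def)
    qed
    then show ?thesis by (rule tendsto_eventually)
  qed
  have "(\<lambda>n. \<integral>x. Z n x \<partial>D) \<longlonglongrightarrow> (\<integral>x. 0 \<partial>D)"
  proof (rule integral_dominated_convergence[where w="\<lambda>x. c * env x"])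
    show "integrable D (\<lambda>x. c * env x)" using env by simp
    show "AE x in D. (\<lambda>n. Z n x) \<longlonglongrightarrow> 0" using AED by eventually_elim (rule Zlim)
    show "AE x in D. norm (Z n x) \<le> c * env x" for n
      using AED
    proof eventually_elim
      case (elim x)
      then show ?case using Yle[of x n] Y0[of n x] eps by (auto simp: Z_def)
    qed
  qed (simp_all add: bmD)
  then have "\<forall>\<^sub>F n in sequentially. (\<integral>x. Z n x \<partial>D) < \<epsilon> / 4"
    using eps by (intro order_tendstoD) auto
  then obtain n where n: "(\<integral>x. Z n x \<partial>D) < \<epsilon> / 4" by (auto simp: eventually_sequentially)
  have intY: "integrable D (Y n)"
    by (rule Bochner_Integration.integrable_bound[of _ "\<lambda>x. c * env x"])
       (use env AED in \<open>auto simp: bmD elim!: eventually_mono intro!: order_trans[OF Yle] simp: Y0 abs_of_nonneg\<close>)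
  have intZ: "integrable D (Z n)"
    by (rule Bochner_Integration.integrable_bound[OF intY]) (use eps Y0 in \<open>auto simp: bmD Z_def intro!: AE_I2\<close>)
  have "(\<integral>x. Y n x \<partial>D) \<le> (\<integral>x. Z n x + \<epsilon> / 4 \<partial>D)"
    using intY intZ by (intro integral_mono) (auto simp: Z_def)
  also have "\<dots> = (\<integral>x. Z n x \<partial>D) + \<epsilon> / 4" using intZ by (simp add: D.prob_space)
  also have "\<dots> < \<epsilon>" using n eps by linarith
  finally have YI: "(\<integral>x. Y n x \<partial>D) < \<epsilon>" .
  define w' where "w' k = (case k of 0 \<Rightarrow> e | Suc j \<Rightarrow> (1 - 2 * e) * w n j)" for k
  define V' where "V' k = (case k of 0 \<Rightarrow> 1 | Suc j \<Rightarrow> real n + 2)" for k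
  define u' where "u' k = (case k of 0 \<Rightarrow> 1 | Suc j \<Rightarrow> u n j)" for k
  have F: "F n x = (\<Sum>k<Suc (K n). w' k * gamma_kernel (V' k) (u' k) x)" for x
    unfolding sum.lessThan_Suc_shift F_def S_def by (simp add: w'_def V'_def u'_def sum_distrib_left mult.assoc)
  have sumw: "(\<Sum>k<Suc (K n). w' k) < 1"
  proof -
    have "(\<Sum>k<Suc (K n). w' k) = e + (1 - 2 * e) * (\<Sum>k<K n. w n k)"
      unfolding sum.lessThan_Suc_shift by (simp add: w'_def sum_distrib_left)
    also have "\<dots> \<le> e + (1 - 2 * e) * 1" using w1 e by (intro add_left_mono mult_left_mono) auto
    also have "\<dots> < 1" using e by simp
    finally show ?thesis .
  qed
  have low: "f0 x * exp (- Y n x) \<le> F n x" if x: "0 < x" for x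
  proof -
    have "exp (- Y n x) \<le> exp (- ln (f0 x / F n x))" using x by (simp add: Y_def)
    also have "\<dots> = F n x / f0 x" using pos[OF x] Fpos[OF x, of n] by (simp add: exp_minus)
    finally show ?thesis using pos[OF x] by (simp add: field_simps)
  qed
  have g1: "\<forall>k. 0 \<le> w' k \<and> 0 < V' k \<and> 0 < u' k"
    using w0 u0 e by (auto simp: w'_def V'_def u'_def split: nat.split)
  have g2: "\<forall>x>0. f0 x * exp (- Y n x) \<le> (\<Sum>k<Suc (K n). w' k * gamma_kernel (V' k) (u' k) x)"
    using low F by simp
  show ?thesis
    by (rule exI[of _ "Suc (K n)"], rule exI[of _ w'], rule exI[of _ V'], rule exI[of _ u'], rule exI[of _ "Y n"], rule exI[of _ c])
       (intro conjI g1 g2 sumw YI, simp_all add: Y0 Yle)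
qed

text \<open>Induction on \<open>K\<close>, with \<open>Q\<close> the length of stick still unbroken.
  The first break must take more than the proportion \<open>w 0 / Q\<close> and yet leave more than
  the remaining weights; strictness of the sum bound makes room for open intervals, which the prior
  charges.\<close>

lemma stick_weight_lower_bound:
  fixes w :: "nat \<Rightarrow> real"
  assumes "\<And>k. 0 \<le> w k" "(\<Sum>k<K. w k) < Q" "0 < Q" "Q \<le> 1"
  shows "\<exists>l r. (\<forall>k. 0 \<le> l k \<and> l k < r k \<and> r k < 1) \<and>
    (\<forall>\<beta>. (\<forall>k<K. l k < \<beta> k \<and> \<beta> k < r k) \<longrightarrow> (\<forall>k<K. w k \<le> Q * stick_weight \<beta> k))"
  using assms
proof (induction K arbitrary: w Q)
  case 0
  then show ?case by (intro exI[of _ "\<lambda>_. 0"] exI[of _ "\<lambda>_. 1/2"]) auto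
next
  case (Suc K)
  have sum: "w 0 + (\<Sum>k<K. w (Suc k)) < Q" using Suc.prems(2) unfolding sum.lessThan_Suc_shift by simp
  have tail: "0 \<le> (\<Sum>k<K. w (Suc k))" using Suc.prems by (intro sum_nonneg) auto
  define l0 where "l0 = w 0 / Q"
  have "l0 < 1 - (\<Sum>k<K. w (Suc k)) / Q" unfolding l0_def using sum Suc.prems by (simp add: field_simps)
  then obtain r0 where r0: "l0 < r0" "r0 < 1 - (\<Sum>k<K. w (Suc k)) / Q" using dense by blast
  have "0 \<le> (\<Sum>k<K. w (Suc k)) / Q" using tail Suc.prems by simp
  then have r01: "r0 < 1" using r0 by linarith
  have "(\<Sum>k<K. w (Suc k)) < Q * (1 - r0)" using r0 Suc.prems by (simp add: field_simps)
  moreover have l00: "0 \<le> l0" unfolding l0_def using Suc.prems by simp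
  moreover have "Q * (1 - r0) \<le> 1" using Suc.prems r0 l00 r01 by (intro mult_le_one) auto
  \<comment> \<open>The worst case \<open>\<beta> 0 = r0\<close> leaves length
    \<open>Q * (1 - r0)\<close>, and the induction hypothesis is used for that length.\<close>
  ultimately have "\<exists>l r. (\<forall>k. 0 \<le> l k \<and> l k < r k \<and> r k < 1) \<and>
      (\<forall>\<beta>. (\<forall>k<K. l k < \<beta> k \<and> \<beta> k < r k) \<longrightarrow> (\<forall>k<K. w (Suc k) \<le> Q * (1 - r0) * stick_weight \<beta> k))"
    using Suc.prems r01 by (intro Suc.IH) auto
  then obtain l r where lr: "\<And>k. 0 \<le> l k \<and> l k < r k \<and> r k < 1"
    and IH: "\<And>\<beta>. (\<forall>k<K. l k < \<beta> k \<and> \<beta> k < r k) \<Longrightarrow> (\<forall>k<K. w (Suc k) \<le> Q * (1 - r0) * stick_weight \<beta> k)"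
    by blast
  define l' where "l' k = (case k of 0 \<Rightarrow> l0 | Suc j \<Rightarrow> l j)" for k
  define r' where "r' k = (case k of 0 \<Rightarrow> r0 | Suc j \<Rightarrow> r j)" for k
  have "w k \<le> Q * stick_weight \<beta> k" if b: "\<forall>k<Suc K. l' k < \<beta> k \<and> \<beta> k < r' k" and k: "k < Suc K" for \<beta> k
  proof (cases k)
    case 0
    have "l0 \<le> \<beta> 0" using b by (auto simp: l'_def)
    then show ?thesis using 0 Suc.prems by (simp add: stick_weight_def l0_def field_simps)
  next
    case (Suc j)
    then have j: "j < K" using k by simp
    have bj: "l i < \<beta> (Suc i) \<and> \<beta> (Suc i) < r i" if "i < K" for i
      using b[rule_format, of "Suc i"] that by (auto simp: l'_def r'_def)
    have b0: "\<beta> 0 < r0" using b by (auto simp: r'_def)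
    have "0 \<le> stick_weight (\<lambda>i. \<beta> (Suc i)) j"
      unfolding stick_weight_def using bj lr j
      by (intro mult_nonneg_nonneg prod_nonneg) (auto intro: less_imp_le order.strict_trans1 order.strict_trans less_trans dual_order.strict_trans1)
    moreover have "stick_weight \<beta> (Suc j) = (1 - \<beta> 0) * stick_weight (\<lambda>i. \<beta> (Suc i)) j"
      unfolding stick_weight_def prod.lessThan_Suc_shift by simp
    moreover have "w (Suc j) \<le> Q * (1 - r0) * stick_weight (\<lambda>i. \<beta> (Suc i)) j"
      using IH[of "\<lambda>i. \<beta> (Suc i)"] bj j by blast
    moreover have "Q * (1 - r0) * stick_weight (\<lambda>i. \<beta> (Suc i)) j \<le> Q * (1 - \<beta> 0) * stick_weight (\<lambda>i. \<beta> (Suc i)) j"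
      using b0 Suc.prems calculation(1) by (intro mult_right_mono mult_left_mono) auto
    ultimately show ?thesis using Suc by (simp add: mult.assoc)
  qed
  moreover have "0 \<le> l' k \<and> l' k < r' k \<and> r' k < 1" for k
    using lr l00 r0 r01 by (auto simp: l'_def r'_def split: nat.split)
  ultimately show ?case by blast
qed

section \<open>The stick-breaking prior\<close>

lemma beta1_density_measurable [measurable (raw)]:
  assumes [measurable]: "f \<in> borel_measurable M" "g \<in> borel_measurable M"
  shows "(\<lambda>z. beta1_density (f z) (g z)) \<in> borel_measurable M"
  unfolding beta1_density_def by measurable

lemma nn_integral_beta1_density:
  assumes \<alpha>: "0 < \<alpha>"
  shows "(\<integral>\<^sup>+x. ennreal (beta1_density \<alpha> x) \<partial>lborel) = 1"
proof -
  have "(\<integral>\<^sup>+x. ennreal (beta1_density \<alpha> x) \<partial>lborel) = ennreal \<bar>-1\<bar> * (\<integral>\<^sup>+y. ennreal (beta1_density \<alpha> (1 + (-1) * y)) \<partial>lborel)"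
    by (intro nn_integral_real_affine) auto
  also have "\<dots> = (\<integral>\<^sup>+y. ennreal (beta1_density \<alpha> (1 - y)) \<partial>lborel)" by simp
  also have "\<dots> = (\<integral>\<^sup>+y. ennreal (indicator {0..1} y * (\<alpha> * y powr (\<alpha> - 1))) \<partial>lborel)"
    by (intro nn_integral_cong_AE AE_I[of _ _ "{0, 1}"]) (auto simp: beta1_density_def indicator_def emeasure_lborel_countable)
  also have "\<dots> = ennreal (\<alpha> * (1 powr (\<alpha> - 1 + 1) / (\<alpha> - 1 + 1)))"
    using \<alpha> by (intro nn_integral_has_integral_lebesgue has_integral_mult_right has_integral_powr_from_0) auto
  also have "\<dots> = 1" using \<alpha> by simp
  finally show ?thesis .
qed

abbreviation beta1_measure :: "real \<Rightarrow> real measure" where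
  "beta1_measure \<alpha> \<equiv> density lborel (\<lambda>x. ennreal (beta1_density \<alpha> x))"

abbreviation param_space :: "dpm_param measure" where
  "param_space \<equiv> (\<Pi>\<^sub>M k\<in>UNIV. borel) \<Otimes>\<^sub>M (\<Pi>\<^sub>M k\<in>UNIV. borel \<Otimes>\<^sub>M borel)"

lemma prob_space_densityI:
  assumes "f \<in> borel_measurable lborel" "(\<integral>\<^sup>+x. ennreal (f x) \<partial>lborel) = 1"
  shows "prob_space (density lborel (\<lambda>x. ennreal (f x)))"
  using assms by (intro prob_spaceI) (simp add: emeasure_density)

lemma prob_space_beta1: "0 < \<alpha> \<Longrightarrow> prob_space (beta1_measure \<alpha>)"
  by (intro prob_space_densityI nn_integral_beta1_density) auto

lemma prob_space_base_measure:
  assumes "0 < \<theta>" "0 < r" "0 < s"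
  shows "prob_space (base_measure \<theta> r s)"
  unfolding base_measure_def
  using assms by (intro prob_space_pair prob_space_exponential_density prob_space_densityI nn_integral_inv_gamma_density) auto

lemma sets_base_measure: "sets (base_measure \<theta> r s) = sets (borel \<Otimes>\<^sub>M borel)"
  unfolding base_measure_def by (intro sets_pair_measure_cong) auto

lemma sets_stick_breaking:
  assumes "sets G0 = sets (borel \<Otimes>\<^sub>M borel)"
  shows "sets (stick_breaking \<alpha> G0) = sets param_space"
  unfolding stick_breaking_def using assms by (intro sets_pair_measure_cong sets_PiM_cong) auto

lemma prob_space_stick_breaking:
  assumes "0 < \<alpha>" "prob_space G0"
  shows "prob_space (stick_breaking \<alpha> G0)"
  unfolding stick_breaking_def using assms by (intro prob_space_pair prob_space_PiM prob_space_beta1)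

text \<open>With infinitely many factors of mass different from 1, the product in the definition of
  \<open>PiM\<close> takes the junk value 1 even on the empty cylinder, so no extension exists.\<close>
lemma emeasure_PiM_zero:
  fixes N :: "'a measure"
  assumes "emeasure N (space N) = 0"
  shows "emeasure (\<Pi>\<^sub>M k\<in>(UNIV::nat set). N) X = 0"
proof -
  define I :: "(nat set \<times> (nat \<Rightarrow> 'a set)) set" where "I = {(J, X). (J \<noteq> {} \<or> (UNIV::nat set) = {}) \<and> finite J \<and> J \<subseteq> UNIV \<and> X \<in> (\<Pi> j\<in>J. sets N)}"
  define G where "G = (\<lambda>(J, X). prod_emb UNIV (\<lambda>_. N) J (\<Pi>\<^sub>E j\<in>J. X j) :: (nat \<Rightarrow> 'a) set)"
  define \<mu> where "\<mu> = (\<lambda>(J, X). \<Prod>j\<in>J \<union> {i\<in>(UNIV::nat set). emeasure N (space N) \<noteq> 1}. if j \<in> J then emeasure N (X j) else emeasure N (space N))"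
  define \<Omega> where "\<Omega> = (\<Pi>\<^sub>E i\<in>(UNIV::nat set). space N)"
  have PiM: "(\<Pi>\<^sub>M k\<in>(UNIV::nat set). N) = extend_measure \<Omega> I G \<mu>"
    unfolding PiM_def I_def G_def \<mu>_def \<Omega>_def ..
  let ?i = "({0::nat}, \<lambda>_::nat. {}::'a set)"
  have iI: "?i \<in> I" by (auto simp: I_def)
  have Gi: "G ?i = {}" by (simp add: G_def prod_emb_def)
  have mui: "\<mu> ?i = 1" using assms by (simp add: \<mu>_def)
  have none: "\<not> (\<exists>\<mu>'. (\<forall>i\<in>I. \<mu>' (G i) = \<mu> i) \<and> measure_space \<Omega> (sigma_sets \<Omega> (G ` I)) \<mu>')"
  proof
    assume "\<exists>\<mu>'. (\<forall>i\<in>I. \<mu>' (G i) = \<mu> i) \<and> measure_space \<Omega> (sigma_sets \<Omega> (G ` I)) \<mu>'"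
    then obtain \<mu>' where m: "\<forall>i\<in>I. \<mu>' (G i) = \<mu> i" "measure_space \<Omega> (sigma_sets \<Omega> (G ` I)) \<mu>'" by blast
    have "\<mu>' {} = 1" using bspec[OF m(1) iI] unfolding Gi mui .
    moreover have "\<mu>' {} = 0" using m(2) by (simp add: measure_space_def positive_def)
    ultimately show False by simp
  qed
  have "extend_measure \<Omega> I G \<mu> = sigma \<Omega> (G ` I)"
    unfolding extend_measure_def by (rule if_not_P) (use none in blast)
  then show ?thesis unfolding PiM by (simp add: emeasure_sigma)
qed

text \<open>The kernel bound in \<open>dpm_prior\<close> is defined at all reals, including
  parameters that the dispersion prior almost surely avoids. There \<open>beta1_density\<close> is
  at most 0, \<open>ennreal\<close> clips it to 0, and the infinite product collapses.\<close>

lemma stick_breaking_nonpos: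
  assumes \<alpha>: "\<alpha> \<le> 0" and G0: "prob_space G0" "sets G0 = sets (borel \<Otimes>\<^sub>M borel)"
  shows "stick_breaking \<alpha> G0 = null_measure param_space"
proof (rule measure_eqI)
  show sets: "sets (stick_breaking \<alpha> G0) = sets (null_measure param_space)"
    using sets_stick_breaking[OF G0(2)] by simp
  fix X assume X: "X \<in> sets (stick_breaking \<alpha> G0)"
  let ?B = "\<Pi>\<^sub>M k\<in>(UNIV::nat set). beta1_measure \<alpha>" and ?\<Psi> = "\<Pi>\<^sub>M k\<in>(UNIV::nat set). G0"
  interpret \<Psi>: prob_space ?\<Psi> using G0 by (intro prob_space_PiM)
  have "beta1_density \<alpha> x \<le> 0" for x
    using \<alpha> by (auto simp: beta1_density_def intro!: mult_nonpos_nonneg)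
  then have "emeasure (beta1_measure \<alpha>) (space (beta1_measure \<alpha>)) = 0"
    by (simp add: emeasure_density ennreal_neg)
  then have B0: "emeasure ?B Y = 0" for Y by (rule emeasure_PiM_zero)
  have "emeasure (stick_breaking \<alpha> G0) X = (\<integral>\<^sup>+x. \<integral>\<^sup>+y. indicator X (x, y) \<partial>?\<Psi> \<partial>?B)"
    using X unfolding stick_breaking_def by (intro \<Psi>.emeasure_pair_measure) auto
  also have "\<dots> = (\<integral>\<^sup>+x. 0 \<partial>?B)"
    by (intro nn_integral_cong_AE AE_I[of _ _ "space ?B"]) (auto simp: B0)
  finally show "emeasure (stick_breaking \<alpha> G0) X = emeasure (null_measure param_space) X" by simp
qed

text \<open>Replacing nonpositive parameters by 1 makes all measures probabilities, so measurability
  need only be checked on cylinders. There the measure is a finite product of integrals that depend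
  measurably on the parameter.\<close>

lemma PiM_beta1_measurable:
  "(\<lambda>\<alpha>. \<Pi>\<^sub>M k\<in>(UNIV::nat set). beta1_measure (if 0 < \<alpha> then \<alpha> else 1)) \<in> borel \<rightarrow>\<^sub>M prob_algebra (\<Pi>\<^sub>M k\<in>UNIV. borel)"
proof (rule measurable_prob_algebra_generated)
  show "sets (\<Pi>\<^sub>M k\<in>(UNIV::nat set). (borel :: real measure)) = sigma_sets (\<Pi>\<^sub>E i\<in>UNIV. space borel) (prod_algebra UNIV (\<lambda>_. borel))"
    by (rule sets_PiM)
  show "Int_stable (prod_algebra (UNIV::nat set) (\<lambda>_. borel :: real measure))"
    by (rule Int_stable_prod_algebra)
  show "prod_algebra (UNIV::nat set) (\<lambda>_. borel :: real measure) \<subseteq> Pow (\<Pi>\<^sub>E i\<in>UNIV. space borel)"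
    by (rule prod_algebra_sets_into_space)
  have pr: "prob_space (beta1_measure (if 0 < \<alpha> then \<alpha> else 1))" for \<alpha>
    by (intro prob_space_beta1) auto
  show "prob_space (\<Pi>\<^sub>M k\<in>(UNIV::nat set). beta1_measure (if 0 < \<alpha> then \<alpha> else 1))" for \<alpha>
    by (intro prob_space_PiM pr)
  show "sets (\<Pi>\<^sub>M k\<in>(UNIV::nat set). beta1_measure (if 0 < \<alpha> then \<alpha> else 1)) = sets (\<Pi>\<^sub>M k\<in>(UNIV::nat set). borel)" for \<alpha>
    by (intro sets_PiM_cong) auto
  fix A assume "A \<in> prod_algebra (UNIV::nat set) (\<lambda>_. borel :: real measure)"
  then obtain J E where A: "A = prod_emb UNIV (\<lambda>_. borel) J (\<Pi>\<^sub>E j\<in>J. E j)" and J: "finite J"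
    and E[measurable]: "\<And>i. i \<in> J \<Longrightarrow> E i \<in> sets (borel :: real measure)"
    by (rule prod_algebraE) blast
  have "emeasure (\<Pi>\<^sub>M k\<in>(UNIV::nat set). beta1_measure (if 0 < \<alpha> then \<alpha> else 1)) A
     = (\<Prod>j\<in>J. \<integral>\<^sup>+x. ennreal (beta1_density (if 0 < \<alpha> then \<alpha> else 1) x) * indicator (E j) x \<partial>lborel)" for \<alpha>
  proof -
    have "A = prod_emb UNIV (\<lambda>_. beta1_measure (if 0 < \<alpha> then \<alpha> else 1)) J (\<Pi>\<^sub>E j\<in>J. E j)"
      unfolding A by (simp add: prod_emb_def)
    then show ?thesis
      using emeasure_PiM_emb[of UNIV "\<lambda>_. beta1_measure (if 0 < \<alpha> then \<alpha> else 1)" J E] pr J E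
      by (simp add: emeasure_density)
  qed
  moreover have "(\<lambda>\<alpha>. \<Prod>j\<in>J. \<integral>\<^sup>+x. ennreal (beta1_density (if 0 < \<alpha> then \<alpha> else 1) x) * indicator (E j) x \<partial>lborel) \<in> borel_measurable borel"
  proof (intro borel_measurable_prod_ennreal)
    fix j assume "j \<in> J"
    then have [measurable]: "E j \<in> sets borel" by (rule E)
    show "(\<lambda>\<alpha>. \<integral>\<^sup>+x. ennreal (beta1_density (if 0 < \<alpha> then \<alpha> else 1) x) * indicator (E j) x \<partial>lborel) \<in> borel_measurable borel"
      by measurable
  qed
  ultimately show "(\<lambda>\<alpha>. emeasure (\<Pi>\<^sub>M k\<in>(UNIV::nat set). beta1_measure (if 0 < \<alpha> then \<alpha> else 1)) A) \<in> borel_measurable borel"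
    by simp
qed

text \<open>The probability kernel on positive parameters is glued to the zero measure on the
  others; \<open>subprob_algebra\<close> admits both.\<close>

lemma stick_breaking_measurable:
  assumes G0: "prob_space G0" "sets G0 = sets (borel \<Otimes>\<^sub>M borel)"
  shows "(\<lambda>\<alpha>. stick_breaking \<alpha> G0) \<in> borel \<rightarrow>\<^sub>M subprob_algebra param_space"
proof -
  let ?k = "\<lambda>\<alpha>. stick_breaking (if 0 < \<alpha> then \<alpha> else 1) G0"
  have "?k \<in> borel \<rightarrow>\<^sub>M prob_algebra param_space"
    unfolding stick_breaking_def
  proof (intro measurable_pair_prob PiM_beta1_measurable measurable_const)
    show "(\<Pi>\<^sub>M k\<in>(UNIV::nat set). G0) \<in> space (prob_algebra (\<Pi>\<^sub>M k\<in>UNIV. borel \<Otimes>\<^sub>M borel))"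
      unfolding space_prob_algebra using G0 by (auto intro!: prob_space_PiM sets_PiM_cong)
  qed
  then have "?k \<in> borel \<rightarrow>\<^sub>M subprob_algebra param_space" by (rule measurable_prob_algebraD)
  then have "(\<lambda>\<alpha>. if 0 < \<alpha> then ?k \<alpha> else null_measure param_space) \<in> borel \<rightarrow>\<^sub>M subprob_algebra param_space"
    by (intro measurable_If measurable_const) (auto simp: space_pair_measure space_PiM)
  also have "(\<lambda>\<alpha>. if 0 < \<alpha> then ?k \<alpha> else null_measure param_space) = (\<lambda>\<alpha>. stick_breaking \<alpha> G0)"
    using stick_breaking_nonpos[OF _ G0] by (auto simp: fun_eq_iff)
  finally show ?thesis .
qed

lemma admissible_alpha_priorD:
  assumes "admissible_alpha_prior A"
  shows "prob_space A" "sets A = sets borel" "AE \<alpha> in A. 0 < \<alpha>"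
proof -
  consider \<alpha> where "0 < \<alpha>" "A = return borel \<alpha>"
    | a b where "0 < a" "0 < b" "A = density lborel (\<lambda>x. ennreal (gamma_density a b x))"
    using assms unfolding admissible_alpha_prior_def by blast
  then have "prob_space A \<and> sets A = sets borel \<and> (AE \<alpha> in A. 0 < \<alpha>)"
  proof cases
    case 1
    then show ?thesis by (auto intro!: prob_space_return simp: AE_return)
  next
    case 2
    have "AE x in A. 0 < x"
      unfolding 2(3) by (subst AE_density) (auto simp: gamma_density_def intro!: AE_I2)
    moreover have "prob_space A"
      unfolding 2(3) using 2 by (intro prob_space_densityI) (auto simp: gamma_density_eq_kernel nn_integral_gamma_kernel)
    ultimately show ?thesis using 2(3) by simp
  qed
  then show "prob_space A" "sets A = sets borel" "AE \<alpha> in A. 0 < \<alpha>" by auto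
qed

section \<open>Positive prior mass of open boxes of parameters\<close>

lemma emeasure_density_greaterThanLessThan_pos:
  fixes f :: "real \<Rightarrow> real"
  assumes [measurable]: "f \<in> borel_measurable borel" and ab: "a < b" and pos: "\<And>x. a < x \<Longrightarrow> x < b \<Longrightarrow> 0 < f x"
  shows "0 < emeasure (density lborel (\<lambda>x. ennreal (f x))) {a<..<b}"
proof (rule ccontr)
  assume "\<not> ?thesis"
  then have "(\<integral>\<^sup>+x. ennreal (f x) * indicator {a<..<b} x \<partial>lborel) = 0"
    by (simp add: emeasure_density)
  then have "AE x in lborel. ennreal (f x) * indicator {a<..<b} x = 0"
    by (subst (asm) nn_integral_0_iff_AE) auto
  then have "AE x in lborel. x \<notin> {a<..<b}"
    by eventually_elim (use pos in \<open>force simp: indicator_def split: if_splits\<close>)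
  then have "emeasure lborel {a<..<b} = 0"
    by (subst (asm) AE_iff_measurable[of "{a<..<b}"]) auto
  then show False using ab by simp
qed

lemma open_in_sets_base_measure: "open S \<Longrightarrow> S \<in> sets (base_measure \<theta> r s)"
  unfolding sets_base_measure borel_prod by (rule borel_open)

lemma emeasure_base_measure_open_pos:
  assumes h: "0 < \<theta>" "0 < r" "0 < s" and S: "open S" "(V, u) \<in> S" "0 < V" "0 < u"
  shows "0 < emeasure (base_measure \<theta> r s) S"
proof -
  from open_prod_elim[OF S(1,2)] obtain A B where *: "open A" "open B" "(V, u) \<in> A \<times> B" "A \<times> B \<subseteq> S"
    by blast
  then have AB: "open A" "open B" "V \<in> A" "u \<in> B" "A \<times> B \<subseteq> S" by simp_all
  obtain d where d: "0 < d" "\<And>y. dist y V < d \<Longrightarrow> y \<in> A" using AB unfolding open_dist by blast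
  obtain d' where d': "0 < d'" "\<And>y. dist y u < d' \<Longrightarrow> y \<in> B" using AB unfolding open_dist by blast
  \<comment> \<open>Intervals to the right of \<open>V\<close> and \<open>u\<close> stay in the
    region where both densities are positive.\<close>
  let ?I = "{V<..<V + d}" and ?J = "{u<..<u + d'}"
  let ?M1 = "density lborel (\<lambda>V. ennreal (exponential_density \<theta> V))" and ?M2 = "density lborel (\<lambda>u. ennreal (inv_gamma_density r s u))"
  interpret M2: prob_space ?M2 using h by (intro prob_space_densityI nn_integral_inv_gamma_density) auto
  have sub: "?I \<times> ?J \<subseteq> S"
  proof -
    have "?I \<subseteq> A" "?J \<subseteq> B" using d(2) d'(2) by (auto simp: dist_real_def)
    then show ?thesis using AB(5) by blast
  qed
  have "0 < emeasure ?M1 ?I"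
    using d S h by (intro emeasure_density_greaterThanLessThan_pos) (auto simp: exponential_density_def)
  moreover have "0 < emeasure ?M2 ?J"
    using d' S h by (intro emeasure_density_greaterThanLessThan_pos)
      (auto simp: inv_gamma_density_def intro!: mult_pos_pos divide_pos_pos Gamma_real_pos)
  ultimately have "0 < emeasure ?M1 ?I * emeasure ?M2 ?J"
    by (simp add: ennreal_zero_less_mult_iff)
  also have "\<dots> = emeasure (base_measure \<theta> r s) (?I \<times> ?J)"
    unfolding base_measure_def by (intro M2.emeasure_pair_measure_Times[symmetric]) auto
  also have "\<dots> \<le> emeasure (base_measure \<theta> r s) S"
    using sub open_in_sets_base_measure[OF S(1)] by (rule emeasure_mono)
  finally show ?thesis .
qed

text \<open>An almost sure event on which all stick weights are nonnegative and all components are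
  genuine densities.\<close>

definition regular_param :: "dpm_param \<Rightarrow> bool" where
  "regular_param p \<longleftrightarrow> (\<forall>k. 0 < fst p k \<and> fst p k < 1 \<and> 0 < fst (snd p k) \<and> 0 < snd (snd p k))"

lemma regular_param_measurable [measurable]: "Measurable.pred param_space regular_param"
  unfolding regular_param_def by measurable

lemma AE_base_measure_pos:
  assumes h: "0 < \<theta>" "0 < r" "0 < s"
  shows "AE \<psi> in base_measure \<theta> r s. 0 < fst \<psi> \<and> 0 < snd \<psi>"
proof -
  let ?M1 = "density lborel (\<lambda>V. ennreal (exponential_density \<theta> V))" and ?M2 = "density lborel (\<lambda>u. ennreal (inv_gamma_density r s u))"
  interpret M1: prob_space ?M1 using h by (intro prob_space_exponential_density)
  interpret M2: prob_space ?M2 using h by (intro prob_space_densityI nn_integral_inv_gamma_density) auto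
  interpret pair_sigma_finite ?M1 ?M2 ..
  have "AE V in ?M1. V \<noteq> 0"
    by (subst AE_density) (auto intro!: eventually_mono[OF AE_lborel_singleton[of 0]])
  moreover have "AE V in ?M1. 0 \<le> V"
    by (subst AE_density) (auto simp: exponential_density_def intro!: AE_I2)
  ultimately have 1: "AE V in ?M1. 0 < V" by eventually_elim simp
  have 2: "AE u in ?M2. 0 < u"
    by (subst AE_density) (auto simp: inv_gamma_density_def intro!: AE_I2)
  show ?thesis
    unfolding base_measure_def
  proof (rule AE_pair_measure)
    show "AE V in ?M1. AE u in ?M2. 0 < fst (V, u) \<and> 0 < snd (V, u)"
      using 1 by eventually_elim (use 2 in simp)
  qed measurable
qed

lemma AE_stick_breaking_regular:
  assumes h: "0 < \<theta>" "0 < r" "0 < s" and \<alpha>: "0 < \<alpha>"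
  shows "AE p in stick_breaking \<alpha> (base_measure \<theta> r s). regular_param p"
proof -
  let ?B = "\<Pi>\<^sub>M k\<in>(UNIV::nat set). beta1_measure \<alpha>" and ?\<Psi> = "\<Pi>\<^sub>M k\<in>(UNIV::nat set). base_measure \<theta> r s"
  interpret B: prob_space ?B using \<alpha> by (intro prob_space_PiM prob_space_beta1)
  interpret \<Psi>: prob_space ?\<Psi> using h by (intro prob_space_PiM prob_space_base_measure)
  interpret pair_sigma_finite ?B ?\<Psi> ..
  have "AE \<beta> in ?B. 0 < \<beta> k \<and> \<beta> k < 1" for k
  proof (rule AE_PiM_component[where P="\<lambda>x. 0 < x \<and> x < 1"])
    show "AE x in beta1_measure \<alpha>. 0 < x \<and> x < 1"
      by (subst AE_density) (auto simp: beta1_density_def intro!: AE_I2)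
  qed (use \<alpha> in \<open>auto intro: prob_space_beta1\<close>)
  then have 1: "AE \<beta> in ?B. \<forall>k. 0 < \<beta> k \<and> \<beta> k < 1" unfolding AE_all_countable by simp
  have "AE \<psi> in ?\<Psi>. 0 < fst (\<psi> k) \<and> 0 < snd (\<psi> k)" for k
    using h by (intro AE_PiM_component[where P="\<lambda>x. 0 < fst x \<and> 0 < snd x"] AE_base_measure_pos prob_space_base_measure) auto
  then have 2: "AE \<psi> in ?\<Psi>. \<forall>k. 0 < fst (\<psi> k) \<and> 0 < snd (\<psi> k)" unfolding AE_all_countable by simp
  have "AE p in ?B \<Otimes>\<^sub>M ?\<Psi>. regular_param p"
  proof (rule AE_pair_measure)
    have "Measurable.pred (?B \<Otimes>\<^sub>M ?\<Psi>) regular_param"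
      using regular_param_measurable
      by (subst measurable_cong_sets[OF sets_stick_breaking[of "base_measure \<theta> r s" \<alpha>, unfolded stick_breaking_def, OF sets_base_measure] refl])
    then show "{p \<in> space (?B \<Otimes>\<^sub>M ?\<Psi>). regular_param p} \<in> sets (?B \<Otimes>\<^sub>M ?\<Psi>)" by measurable
    show "AE \<beta> in ?B. AE \<psi> in ?\<Psi>. regular_param (\<beta>, \<psi>)"
      using 1
    proof eventually_elim
      case (elim \<beta>)
      then show ?case using 2 by (auto simp: regular_param_def)
    qed
  qed
  then show ?thesis unfolding stick_breaking_def .
qed

text \<open>Only the first \<open>K\<close> coordinates are constrained, so the event is a product
  of two cylinders and its mass a finite product of positive numbers.\<close>

lemma emeasure_stick_breaking_box_pos:
  fixes l r' :: "nat \<Rightarrow> real" and S :: "nat \<Rightarrow> (real \<times> real) set"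
  assumes h: "0 < \<theta>" "0 < r" "0 < s" and \<alpha>: "0 < \<alpha>"
    and lr: "\<And>k. 0 \<le> l k \<and> l k < r' k \<and> r' k < 1"
    and S: "\<And>k. open (S k)" "\<And>k. \<exists>V u. 0 < V \<and> 0 < u \<and> (V, u) \<in> S k"
  shows "0 < emeasure (stick_breaking \<alpha> (base_measure \<theta> r s)) {p. \<forall>k<K. l k < fst p k \<and> fst p k < r' k \<and> snd p k \<in> S k}"
proof -
  let ?G = "base_measure \<theta> r s"
  let ?B = "\<Pi>\<^sub>M k\<in>(UNIV::nat set). beta1_measure \<alpha>" and ?\<Psi> = "\<Pi>\<^sub>M k\<in>(UNIV::nat set). ?G"
  interpret \<Psi>: prob_space ?\<Psi> using h by (intro prob_space_PiM prob_space_base_measure)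
  let ?X = "prod_emb UNIV (\<lambda>_. beta1_measure \<alpha>) {..<K} (\<Pi>\<^sub>E k\<in>{..<K}. {l k<..<r' k})"
  let ?Y = "prod_emb UNIV (\<lambda>_. ?G) {..<K} (\<Pi>\<^sub>E k\<in>{..<K}. S k)"
  have spG: "space ?G = UNIV" by (simp add: base_measure_def space_pair_measure)
  have eq: "{p. \<forall>k<K. l k < fst p k \<and> fst p k < r' k \<and> snd p k \<in> S k} = ?X \<times> ?Y"
    by (auto simp: prod_emb_iff restrict_PiE_iff spG extensional_UNIV Pi_iff)
  have Smeas: "S k \<in> sets ?G" for k using S(1) by (rule open_in_sets_base_measure)
  have X: "emeasure ?B ?X = (\<Prod>k<K. emeasure (beta1_measure \<alpha>) {l k<..<r' k})"
    using \<alpha> by (intro emeasure_PiM_emb) (auto intro: prob_space_beta1)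
  have Y: "emeasure ?\<Psi> ?Y = (\<Prod>k<K. emeasure ?G (S k))"
    using h Smeas by (intro emeasure_PiM_emb) (auto intro: prob_space_base_measure)
  have "0 < emeasure (beta1_measure \<alpha>) {l k<..<r' k}" for k
    using lr[of k] \<alpha> by (intro emeasure_density_greaterThanLessThan_pos) (auto simp: beta1_density_def)
  moreover have "0 < emeasure ?G (S k)" for k
    using S(2)[of k] emeasure_base_measure_open_pos[OF h S(1)] by blast
  ultimately have "0 < emeasure ?B ?X * emeasure ?\<Psi> ?Y"
    unfolding X Y by (auto simp: ennreal_zero_less_mult_iff zero_less_iff_neq_zero)
  also have "\<dots> = emeasure (?B \<Otimes>\<^sub>M ?\<Psi>) (?X \<times> ?Y)"
    using Smeas by (intro \<Psi>.emeasure_pair_measure_Times[symmetric] sets_PiM_I) auto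
  finally show ?thesis unfolding eq stick_breaking_def .
qed

text \<open>Each property passes from \<open>stick_breaking\<close> to the prior by integrating over
  the dispersion parameter. Positivity needs no bound uniform in that parameter, since an integral
  of a nonnegative function vanishes only if the function is 0 almost everywhere.\<close>

lemma
  assumes h: "0 < \<theta>" "0 < r" "0 < s" and A: "admissible_alpha_prior A"
  shows sets_dpm_prior: "sets (dpm_prior A \<theta> r s) = sets param_space"
    and prob_space_dpm_prior: "prob_space (dpm_prior A \<theta> r s)"
    and AE_dpm_prior_regular: "AE p in dpm_prior A \<theta> r s. regular_param p"
    and emeasure_dpm_prior_pos: "\<And>Z. Z \<in> sets param_space \<Longrightarrow> (\<And>\<alpha>. 0 < \<alpha> \<Longrightarrow> 0 < emeasure (stick_breaking \<alpha> (base_measure \<theta> r s)) Z) \<Longrightarrow> 0 < emeasure (dpm_prior A \<theta> r s) Z"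
proof -
  let ?k = "\<lambda>\<alpha>. stick_breaking \<alpha> (base_measure \<theta> r s)"
  note A' = admissible_alpha_priorD[OF A]
  interpret A: prob_space A by (rule A')
  have k: "?k \<in> A \<rightarrow>\<^sub>M subprob_algebra param_space"
    unfolding measurable_cong_sets[OF A'(2) refl]
    by (rule stick_breaking_measurable[OF prob_space_base_measure[OF h] sets_base_measure])
  have emeas: "emeasure (dpm_prior A \<theta> r s) Z = (\<integral>\<^sup>+\<alpha>. emeasure (?k \<alpha>) Z \<partial>A)" if "Z \<in> sets param_space" for Z
    unfolding dpm_prior_def using that by (rule emeasure_bind[OF A.not_empty k])
  show sets: "sets (dpm_prior A \<theta> r s) = sets param_space"
    unfolding dpm_prior_def by (intro sets_bind[OF sets_kernel[OF k]] A.not_empty)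
  have sp: "space (dpm_prior A \<theta> r s) = space param_space" by (rule sets_eq_imp_space_eq[OF sets])
  show "prob_space (dpm_prior A \<theta> r s)"
  proof
    have "emeasure (dpm_prior A \<theta> r s) (space (dpm_prior A \<theta> r s)) = (\<integral>\<^sup>+\<alpha>. emeasure (?k \<alpha>) (space param_space) \<partial>A)"
      unfolding sp by (intro emeas sets.top)
    also have "\<dots> = (\<integral>\<^sup>+\<alpha>. 1 \<partial>A)"
    proof (intro nn_integral_cong_AE)
      show "AE \<alpha> in A. emeasure (?k \<alpha>) (space param_space) = 1"
        using A'(3)
      proof eventually_elim
        case (elim \<alpha>)
        interpret prob_space "?k \<alpha>" using elim h by (intro prob_space_stick_breaking prob_space_base_measure)
        show ?case using emeasure_space_1 sets_eq_imp_space_eq[OF sets_stick_breaking[OF sets_base_measure, of \<alpha>]] by simp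
      qed
    qed
    finally show "emeasure (dpm_prior A \<theta> r s) (space (dpm_prior A \<theta> r s)) = 1" by (simp add: A.emeasure_space_1)
  qed
  show "AE p in dpm_prior A \<theta> r s. regular_param p"
    unfolding dpm_prior_def AE_bind[OF k regular_param_measurable]
    using A'(3) by eventually_elim (rule AE_stick_breaking_regular[OF h])
  fix Z assume Z: "Z \<in> sets param_space" and pos: "\<And>\<alpha>. 0 < \<alpha> \<Longrightarrow> 0 < emeasure (?k \<alpha>) Z"
  show "0 < emeasure (dpm_prior A \<theta> r s) Z"
  proof (rule ccontr)
    assume "\<not> ?thesis"
    then have "(\<integral>\<^sup>+\<alpha>. emeasure (?k \<alpha>) Z \<partial>A) = 0" using emeas[OF Z] by simp
    then have "AE \<alpha> in A. emeasure (?k \<alpha>) Z = 0"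
      by (subst (asm) nn_integral_0_iff_AE) (use measurable_emeasure_kernel[OF k Z] in auto)
    with A'(3) have "AE \<alpha> in A. False" by eventually_elim (use pos in force)
    then show False using A.AE_False by simp
  qed
qed

section \<open>Consistency of the Dirichlet process mixture\<close>

definition dpm_sum :: "dpm_param \<Rightarrow> real \<Rightarrow> ennreal" where
  "dpm_sum p x = (\<Sum>k. ennreal (stick_weight (fst p) k * gamma_kernel (fst (snd p k)) (snd (snd p k)) x))"

text \<open>Where \<open>dpm_sum\<close> is infinite, \<open>dpm_density\<close> takes the junk value 0, so lower bounds on the density
  hold only for almost every \<open>x\<close>.\<close>
lemma dpm_density_eq: "dpm_density p x = enn2real (dpm_sum p x)"
  by (simp add: dpm_density_def dpm_sum_def)

lemma stick_weight_measurable [measurable]: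
  "(\<lambda>p. stick_weight (fst p) k) \<in> borel_measurable param_space"
  unfolding stick_weight_def by measurable

lemma dpm_sum_measurable [measurable]:
  "(\<lambda>z. dpm_sum (fst z) (snd z)) \<in> borel_measurable (param_space \<Otimes>\<^sub>M borel)"
proof -
  have [measurable]: "(\<lambda>z. stick_weight (fst (fst z)) k) \<in> borel_measurable (param_space \<Otimes>\<^sub>M (borel :: real measure))" for k
    by (rule measurable_compose[OF measurable_fst stick_weight_measurable])
  show ?thesis unfolding dpm_sum_def by measurable
qed

lemma stick_weight_nonneg: "regular_param p \<Longrightarrow> 0 \<le> stick_weight (fst p) k"
  unfolding regular_param_def stick_weight_def
  by (intro mult_nonneg_nonneg prod_nonneg) (auto intro: less_imp_le)

lemma suminf_stick_weight_le:
  assumes "regular_param p"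
  shows "(\<Sum>k. ennreal (stick_weight (fst p) k)) \<le> 1"
proof (rule suminf_le_const)
  fix n
  \<comment> \<open>The product is the length of stick left after \<open>n\<close> breaks.\<close>
  have "(\<Sum>k<n. stick_weight (fst p) k) = 1 - (\<Prod>k<n. 1 - fst p k)"
    by (induction n) (auto simp: stick_weight_def algebra_simps)
  moreover have "0 \<le> (\<Prod>k<n. 1 - fst p k)"
    using assms unfolding regular_param_def by (intro prod_nonneg) (auto intro: less_imp_le)
  ultimately have "(\<Sum>k<n. stick_weight (fst p) k) \<le> 1" by simp
  then show "(\<Sum>k<n. ennreal (stick_weight (fst p) k)) \<le> 1"
    using stick_weight_nonneg[OF assms] by (simp add: sum_ennreal)
qed auto

lemma nn_integral_dpm_sum_le:
  assumes p: "regular_param p"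
  shows "(\<integral>\<^sup>+x. dpm_sum p x \<partial>lborel) \<le> 1"
proof -
  have "(\<integral>\<^sup>+x. dpm_sum p x \<partial>lborel)
     = (\<Sum>k. \<integral>\<^sup>+x. ennreal (stick_weight (fst p) k * gamma_kernel (fst (snd p k)) (snd (snd p k)) x) \<partial>lborel)"
    unfolding dpm_sum_def by (intro nn_integral_suminf) measurable
  also have "\<dots> = (\<Sum>k. ennreal (stick_weight (fst p) k))"
  proof (intro suminf_cong)
    fix k
    have pos: "0 < fst (snd p k)" "0 < snd (snd p k)" using p by (auto simp: regular_param_def)
    have "(\<integral>\<^sup>+x. ennreal (stick_weight (fst p) k * gamma_kernel (fst (snd p k)) (snd (snd p k)) x) \<partial>lborel)
      = (\<integral>\<^sup>+x. ennreal (stick_weight (fst p) k) * ennreal (gamma_kernel (fst (snd p k)) (snd (snd p k)) x) \<partial>lborel)"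
      using stick_weight_nonneg[OF p] pos by (intro nn_integral_cong ennreal_mult) (auto simp: gamma_kernel_nonneg)
    also have "\<dots> = ennreal (stick_weight (fst p) k)"
      using pos by (subst nn_integral_cmult) (auto simp: nn_integral_gamma_kernel)
    finally show "(\<integral>\<^sup>+x. ennreal (stick_weight (fst p) k * gamma_kernel (fst (snd p k)) (snd (snd p k)) x) \<partial>lborel) = ennreal (stick_weight (fst p) k)" .
  qed
  also have "\<dots> \<le> 1" by (rule suminf_stick_weight_le[OF p])
  finally show ?thesis .
qed

lemma dpm_density_ge:
  assumes p: "regular_param p" and fin: "dpm_sum p x < \<infinity>"
  shows "(\<Sum>k<K. stick_weight (fst p) k * gamma_kernel (fst (snd p k)) (snd (snd p k)) x) \<le> dpm_density p x"
proof -
  let ?t = "\<lambda>k. stick_weight (fst p) k * gamma_kernel (fst (snd p k)) (snd (snd p k)) x"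
  have t0: "0 \<le> ?t k" for k
    using p stick_weight_nonneg[OF p] by (intro mult_nonneg_nonneg gamma_kernel_nonneg) (auto simp: regular_param_def)
  have "ennreal (\<Sum>k<K. ?t k) = (\<Sum>k<K. ennreal (?t k))" using t0 by (simp add: sum_ennreal)
  also have "\<dots> \<le> dpm_sum p x" unfolding dpm_sum_def by (intro sum_le_suminf) auto
  also have "\<dots> = ennreal (dpm_density p x)" using fin by (simp add: dpm_density_eq)
  finally show ?thesis
    by (subst (asm) ennreal_le_iff) (auto simp: dpm_density_eq)
qed

text \<open>For regular \<open>p\<close> the series has integral at most 1 in \<open>x\<close>,
  hence is finite at almost every \<open>x\<close>. Fubini then exchanges the quantifiers into the
  order that \<open>kl_supported\<close> uses.\<close>

lemma AE_dpm_sum_finite: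
  assumes P: "prob_space P" "sets P = sets param_space" and reg: "AE p in P. regular_param p"
  shows "AE x in lborel. AE p in P. dpm_sum p x < \<infinity>"
proof -
  interpret prob_space P by fact
  interpret pair_sigma_finite P "lborel :: real measure" ..
  have sets: "sets (P \<Otimes>\<^sub>M (lborel :: real measure)) = sets (param_space \<Otimes>\<^sub>M borel)"
    using P(2) by (intro sets_pair_measure_cong) auto
  have meas: "(\<lambda>z. dpm_sum (fst z) (snd z)) \<in> borel_measurable (P \<Otimes>\<^sub>M lborel)"
    using dpm_sum_measurable unfolding measurable_cong_sets[OF sets refl] .
  have "AE p in P. AE x in lborel. dpm_sum p x < \<infinity>"
    using reg AE_space
  proof eventually_elim
    case (elim p)
    have "(\<lambda>x. dpm_sum p x) \<in> borel_measurable lborel"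
      using measurable_compose[OF _ meas, of "\<lambda>x. (p, x)" lborel] elim(2) by simp
    moreover have "(\<integral>\<^sup>+x. dpm_sum p x \<partial>lborel) \<noteq> \<infinity>"
      using nn_integral_dpm_sum_le[OF elim(1)] by (auto simp: top_unique)
    ultimately have "AE x in lborel. dpm_sum p x \<noteq> \<infinity>" by (rule nn_integral_PInf_AE)
    then show ?case by (simp add: less_top)
  qed
  then show ?thesis
    by (subst AE_commute[symmetric]) (use meas in measurable)
qed

lemma ext0_measurable:
  assumes "continuous_on {0..} fc"
  shows "ext0 fc \<in> borel_measurable borel"
  using borel_measurable_continuous_on_indicator[OF _ assms] unfolding ext0_def by simp

lemma bayes_model_dpm:
  assumes h: "0 < \<theta>" "0 < r" "0 < s" and A: "admissible_alpha_prior A"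
    and q: "q \<in> borel_measurable borel" "\<And>x. 0 \<le> q x" "(\<integral>\<^sup>+x. ennreal (q x) \<partial>lborel) = 1"
  shows "bayes_model (dpm_prior A \<theta> r s) dpm_density q"
proof (rule bayes_model.intro)
  note sets = sets_dpm_prior[OF h A]
  show "prob_space (dpm_prior A \<theta> r s)" by (rule prob_space_dpm_prior[OF h A])
  have S: "sets (dpm_prior A \<theta> r s \<Otimes>\<^sub>M (borel :: real measure)) = sets (param_space \<Otimes>\<^sub>M borel)"
    using sets by (intro sets_pair_measure_cong) auto
  have "(\<lambda>(p, x). dpm_density p x) \<in> borel_measurable (param_space \<Otimes>\<^sub>M (borel :: real measure))"
    unfolding dpm_density_eq split_beta by measurable
  then show "(\<lambda>(p, x). dpm_density p x) \<in> borel_measurable (dpm_prior A \<theta> r s \<Otimes>\<^sub>M borel)"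
    unfolding measurable_cong_sets[OF S refl] .
  show "AE p in dpm_prior A \<theta> r s. (\<integral>\<^sup>+x. ennreal (dpm_density p x) \<partial>lborel) \<le> 1"
    using AE_dpm_prior_regular[OF h A]
  proof eventually_elim
    case (elim p)
    have "(\<integral>\<^sup>+x. ennreal (dpm_density p x) \<partial>lborel) \<le> (\<integral>\<^sup>+x. dpm_sum p x \<partial>lborel)"
      unfolding dpm_density_eq by (intro nn_integral_mono) (simp add: ennreal_enn2real_if)
    then show ?case using nn_integral_dpm_sum_le[OF elim] by (rule order_trans)
  qed
  show "0 \<le> dpm_density p x" for p x by (simp add: dpm_density_eq)
qed (fact q)+

text \<open>\<open>env x\<close> is at most twice the larger of \<open>x\<close> and
  \<open>1 / x\<close>, whence the factor 4; raising the exponents by \<open>\<zeta>\<close> only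
  enlarges the dominating power.\<close>

lemma env_square_le:
  assumes x: "0 < x" and z: "0 < \<zeta>"
  shows "(env x)\<^sup>2 \<le> 4 * max (x powr (- \<zeta> - 2)) (x powr (\<zeta> + 2))"
proof (cases "1 \<le> x")
  case True
  have "1 / x \<le> x" using True mult_mono[OF True True] by (simp add: divide_le_eq)
  then have "env x \<le> 2 * x" using x by (simp add: env_def)
  then have "(env x)\<^sup>2 \<le> (2 * x)\<^sup>2" using env_ge(1)[OF x] by (intro power_mono) auto
  also have "\<dots> = 4 * x powr 2" using x by (simp add: power_mult_distrib)
  also have "x powr 2 \<le> x powr (\<zeta> + 2)" using True z by (intro powr_mono) auto
  finally show ?thesis by (simp add: le_max_iff_disj)
next
  case False
  then have x1: "x \<le> 1" by simp
  have "x \<le> 1 / x" using x x1 by (simp add: le_divide_eq mult_le_one)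
  then have "env x \<le> 2 / x" by (simp add: env_def)
  then have "(env x)\<^sup>2 \<le> (2 / x)\<^sup>2" using env_ge(1)[OF x] by (intro power_mono) auto
  also have "\<dots> = 4 * x powr (- 2)" using x by (simp add: power_divide powr_minus_divide)
  also have "x powr (- 2) \<le> x powr (- \<zeta> - 2)" using x x1 z by (intro powr_mono') auto
  finally show ?thesis by (simp add: le_max_iff_disj)
qed

text \<open>A finite mixture close to \<open>q\<close> is realized by a box of parameters: the first
  breaks lie where the stick weights dominate \<open>w\<close>, the first atoms lie near the given
  components, and all later atoms only add to the density.\<close>

lemma kl_supported_dpm:
  assumes h: "0 < \<theta>" "0 < r" "0 < s" and A: "admissible_alpha_prior A"
    and bm: "bayes_model (dpm_prior A \<theta> r s) dpm_density q"
    and bdd: "\<And>x. q x \<le> C" and pos: "\<And>x. 0 < x \<Longrightarrow> 0 < q x" and zero: "\<And>x. x < 0 \<Longrightarrow> q x = 0"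
    and cont: "\<And>x. 0 < x \<Longrightarrow> isCont q x"
    and env2: "integrable (density lborel (\<lambda>x. ennreal (q x))) (\<lambda>x. (env x)\<^sup>2)"
  shows "bayes_model.kl_supported (dpm_prior A \<theta> r s) dpm_density q"
proof -
  interpret bayes_model "dpm_prior A \<theta> r s" dpm_density q by (rule bm)
  have bmD: "borel_measurable D = borel_measurable borel" by (rule borel_measurable_D)
  have env2D: "integrable D (\<lambda>x. (env x)\<^sup>2)" using env2 unfolding D_def .
  have envD: "integrable D env"
    by (rule D.square_integrable_imp_integrable[OF _ env2D]) (simp add: bmD)
  have AEne: "AE x in lborel. x \<noteq> (0::real)" by (rule AE_lborel_singleton)
  have AED: "AE x in D. 0 < x"
    unfolding D_def
  proof (subst AE_density)
    show "AE x in lborel. 0 < ennreal (q x) \<longrightarrow> 0 < x"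
      using AEne
    proof eventually_elim
      case (elim x)
      then show ?case using zero[of x] by (cases "x < 0") auto
    qed
  qed simp
  show ?thesis
    unfolding kl_supported_def
  proof (intro allI impI)
    fix \<eta> :: real assume eta: "0 < \<eta>"
    define E where "E = (\<integral>x. env x \<partial>D)"
    have E0: "0 \<le> E" unfolding E_def
      by (intro integral_nonneg_AE eventually_mono[OF AED]) (simp add: less_imp_le[OF env_pos])
    \<comment> \<open>Moving the components costs \<open>\<eta>1 * env\<close>, whose mean is
      thereby below \<open>\<eta> / 2\<close>; \<open>E + 1\<close> keeps the denominator positive
      when \<open>E = 0\<close>.\<close>
    define \<eta>1 where "\<eta>1 = \<eta> / (4 * (E + 1))"
    have eta1: "0 < \<eta>1" "\<eta>1 * E < \<eta> / 2"
    proof -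
      show "0 < \<eta>1" using eta E0 by (simp add: \<eta>1_def)
      have "\<eta>1 * E \<le> \<eta>1 * (E + 1)" using \<open>0 < \<eta>1\<close> by simp
      also have "\<dots> = \<eta> / 4" using E0 by (simp add: \<eta>1_def field_simps)
      finally show "\<eta>1 * E < \<eta> / 2" using eta by simp
    qed
    have eta2: "0 < \<eta> / 2" using eta by simp
    have "\<exists>(K::nat) w V u Y c. (\<forall>k. 0 \<le> w k \<and> 0 < V k \<and> 0 < u k) \<and> (\<Sum>k<K. w k) < 1 \<and>
        Y \<in> borel_measurable borel \<and> (\<forall>x. 0 \<le> Y x) \<and> (\<forall>x>0. Y x \<le> c * env x) \<and> (\<integral>x. Y x \<partial>D) < \<eta> / 2 \<and>
        (\<forall>x>0. q x * exp (- Y x) \<le> (\<Sum>k<K. w k * gamma_kernel (V k) (u k) x))"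
      by (rule finite_gamma_mixture_kl[OF q_meas q_nonneg bdd pos cont q_integrable(1) eq_refl[OF q_integrable(2)]
            D.prob_space_axioms sets_D AED envD eta2]) simp_all
    then obtain K :: nat and w V u Y c where mix: "(\<forall>k. 0 \<le> w k \<and> 0 < V k \<and> 0 < u k) \<and> (\<Sum>k<K. w k) < 1 \<and>
        Y \<in> borel_measurable borel \<and> (\<forall>x. 0 \<le> Y x) \<and> (\<forall>x>0. Y x \<le> c * env x) \<and> (\<integral>x. Y x \<partial>D) < \<eta> / 2 \<and>
        (\<forall>x>0. q x * exp (- Y x) \<le> (\<Sum>k<K. w k * gamma_kernel (V k) (u k) x))"
      by (elim exE) (rule that)
    have w: "0 \<le> w k \<and> 0 < V k \<and> 0 < u k" for k using mix by simp
    have w1: "(\<Sum>k<K. w k) < 1" and Y[measurable]: "Y \<in> borel_measurable borel" and YI: "(\<integral>x. Y x \<partial>D) < \<eta> / 2"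
      using mix by simp_all
    have Y0: "0 \<le> Y x" for x using mix by simp
    have Yc: "Y x \<le> c * env x" if "0 < x" for x using mix that by simp
    have low: "q x * exp (- Y x) \<le> (\<Sum>k<K. w k * gamma_kernel (V k) (u k) x)" if "0 < x" for x
      using mix that by simp
    \<comment> \<open>The whole stick, \<open>Q = 1\<close>, is available because the weights of the
      mixture sum to strictly less than 1.\<close>
    obtain l r' where lr: "\<And>k. 0 \<le> l k \<and> l k < r' k \<and> r' k < 1"
      and sw: "\<And>\<beta>. (\<forall>k<K. l k < \<beta> k \<and> \<beta> k < r' k) \<Longrightarrow> (\<forall>k<K. w k \<le> 1 * stick_weight \<beta> k)"
      using stick_weight_lower_bound[of w K 1] w w1 by auto
    have "\<exists>S. open S \<and> (V k, u k) \<in> S \<and> (\<forall>z\<in>S. \<forall>x>0. gamma_kernel (V k) (u k) x * exp (- \<eta>1 * env x) \<le> gamma_kernel (fst z) (snd z) x)" for k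
      using gamma_kernel_perturbation[of "V k" "u k" \<eta>1] w[of k] eta1 unfolding eventually_nhds by blast
    then obtain S where S: "\<And>k. open (S k)" "\<And>k. (V k, u k) \<in> S k"
      and Sle: "\<And>k z x. z \<in> S k \<Longrightarrow> 0 < x \<Longrightarrow> gamma_kernel (V k) (u k) x * exp (- \<eta>1 * env x) \<le> gamma_kernel (fst z) (snd z) x"
      by metis
    define B :: "dpm_param set" where "B = {p. \<forall>k<K. l k < fst p k \<and> fst p k < r' k \<and> snd p k \<in> S k}"
    \<comment> \<open>The cost of the approximating mixture plus that of moving its components. The
      value 0 off the positive half-line keeps \<open>Y2\<close> nonnegative; it is harmless as
      \<open>q\<close> vanishes on the negative numbers and 0 is a null set.\<close>
    define Y2 where "Y2 x = (if 0 < x then Y x + \<eta>1 * env x else 0)" for x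
    have [measurable]: "S k \<in> sets (borel \<Otimes>\<^sub>M borel)" for k
      unfolding borel_prod using S(1) by (rule borel_open)
    have Bmeas: "B \<in> sets param_space"
    proof -
      have "B = {p \<in> space param_space. \<forall>k<K. l k < fst p k \<and> fst p k < r' k \<and> snd p k \<in> S k}"
        unfolding B_def by (simp add: space_pair_measure space_PiM)
      also have "\<dots> \<in> sets param_space" by measurable
      finally show ?thesis .
    qed
    have Bpos: "0 < emeasure (dpm_prior A \<theta> r s) B"
      using Bmeas unfolding B_def
      by (intro emeasure_dpm_prior_pos[OF h A] emeasure_stick_breaking_box_pos[OF h _ lr S(1)]) (use w S(2) in blast)+
    have Y2m[measurable]: "Y2 \<in> borel_measurable borel" unfolding Y2_def by measurable
    have Y20: "0 \<le> Y2 x" for x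
      using Y0[of x] eta1 env_pos[of x] by (auto simp: Y2_def)
    have Y2sq: "integrable D (\<lambda>x. (Y2 x)\<^sup>2)"
    proof (rule Bochner_Integration.integrable_bound)
      show "integrable D (\<lambda>x. (c + \<eta>1)\<^sup>2 * (env x)\<^sup>2)" using env2D by simp
      show "AE x in D. norm ((Y2 x)\<^sup>2) \<le> norm ((c + \<eta>1)\<^sup>2 * (env x)\<^sup>2)"
        using AED
      proof eventually_elim
        case (elim x)
        have "Y2 x \<le> (c + \<eta>1) * env x" using Yc[OF elim] elim by (simp add: Y2_def algebra_simps)
        then have "(Y2 x)\<^sup>2 \<le> ((c + \<eta>1) * env x)\<^sup>2" using Y20 by (intro power_mono) auto
        then show ?case by (simp add: power_mult_distrib)
      qed
    qed (simp add: bmD)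
    have intY: "integrable D Y"
    proof (rule Bochner_Integration.integrable_bound)
      show "integrable D (\<lambda>x. c * env x)" using envD by simp
      show "AE x in D. norm (Y x) \<le> norm (c * env x)"
        using AED by eventually_elim (use Yc Y0 in \<open>force simp: abs_of_nonneg intro: order_trans[OF _ abs_ge_self]\<close>)
    qed (simp add: bmD)
    have "(\<integral>x. Y2 x \<partial>D) = (\<integral>x. Y x + \<eta>1 * env x \<partial>D)"
      by (intro integral_cong_AE eventually_mono[OF AED]) (auto simp: Y2_def bmD)
    also have "\<dots> = (\<integral>x. Y x \<partial>D) + \<eta>1 * E" using intY envD by (simp add: E_def)
    also have "\<dots> < \<eta>" using YI eta1 by linarith
    finally have Y2I: "(\<integral>x. Y2 x \<partial>D) < \<eta>" .
    have "AE x in lborel. AE p in dpm_prior A \<theta> r s. p \<in> B \<longrightarrow> q x * exp (- Y2 x) \<le> dpm_density p x"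
      using AE_dpm_sum_finite[OF prob_P sets_dpm_prior[OF h A] AE_dpm_prior_regular[OF h A]] AEne
    proof eventually_elim
      case (elim x)
      show ?case
      proof (cases "0 < x")
        case False
        then have "q x = 0" using elim zero by auto
        then show ?thesis by (simp add: dpm_density_eq)
      next
        case x: True
        show ?thesis
          using elim(1) AE_dpm_prior_regular[OF h A]
        proof eventually_elim
          case (elim p)
          show ?case
          proof
            assume p: "p \<in> B"
            have "q x * exp (- Y2 x) = q x * exp (- Y x) * exp (- \<eta>1 * env x)"
              using x by (simp add: Y2_def exp_add[symmetric])
            also have "\<dots> \<le> (\<Sum>k<K. w k * gamma_kernel (V k) (u k) x) * exp (- \<eta>1 * env x)"
              by (intro mult_right_mono low x) auto
            also have "\<dots> = (\<Sum>k<K. w k * (gamma_kernel (V k) (u k) x * exp (- \<eta>1 * env x)))"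
              by (simp add: sum_distrib_right mult.assoc)
            also have "\<dots> \<le> (\<Sum>k<K. stick_weight (fst p) k * gamma_kernel (fst (snd p k)) (snd (snd p k)) x)"
            proof (intro sum_mono mult_mono)
              fix k assume "k \<in> {..<K}"
              then have k: "k < K" by simp
              show "w k \<le> stick_weight (fst p) k" using sw[of "fst p"] p k unfolding B_def by auto
              show "gamma_kernel (V k) (u k) x * exp (- \<eta>1 * env x) \<le> gamma_kernel (fst (snd p k)) (snd (snd p k)) x"
                using p k x unfolding B_def by (intro Sle) auto
              show "0 \<le> stick_weight (fst p) k" by (rule stick_weight_nonneg[OF elim(2)])
              show "0 \<le> gamma_kernel (V k) (u k) x * exp (- \<eta>1 * env x)"
                using w[of k] by (simp add: gamma_kernel_nonneg)
            qed
            also have "\<dots> \<le> dpm_density p x" by (rule dpm_density_ge[OF elim(2) elim(1)])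
            finally show "q x * exp (- Y2 x) \<le> dpm_density p x" .
          qed
        qed
      qed
    qed
    moreover have "B \<in> sets (dpm_prior A \<theta> r s)" using Bmeas sets_dpm_prior[OF h A] by simp
    ultimately show "\<exists>Y B. Y \<in> borel_measurable borel \<and> (\<forall>x. 0 \<le> Y x) \<and>
       integrable D (\<lambda>x. (Y x)\<^sup>2) \<and> (\<integral>x. Y x \<partial>D) < \<eta> \<and> B \<in> sets (dpm_prior A \<theta> r s) \<and> 0 < emeasure (dpm_prior A \<theta> r s) B \<and>
       (AE x in lborel. AE p in dpm_prior A \<theta> r s. p \<in> B \<longrightarrow> q x * exp (- Y x) \<le> dpm_density p x)"
      using Y2m Y20 Y2sq Y2I Bpos by (intro exI[of _ Y2] exI[of _ B] conjI allI) auto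
  qed
qed

theorem theorem1:
  fixes fc :: "real \<Rightarrow> real" and A :: "real measure" and \<theta> r s C\<^sub>f :: real
  assumes hyper: "0 < \<theta>" "0 < r" "0 < s"
    and alpha_prior: "admissible_alpha_prior A"
    and nonneg: "\<forall>x\<ge>0. 0 \<le> fc x"
    and dens: "(\<integral>\<^sup>+ x. ennreal (ext0 fc x) \<partial>lborel) = 1"
    and cont: "continuous_on {0..} fc"
    and a_pos: "\<forall>x>0. 0 < fc x"
    and a_bdd: "\<forall>x\<ge>0. fc x \<le> C\<^sub>f"
    and b: "set_integrable lborel {0<..} (\<lambda>x. fc x * ln (fc x))"
    and c: "\<exists>\<delta>>0. (\<integral>\<^sup>+ x\<in>{0<..}.
              (if 0 < phi_delta fc \<delta> x then ennreal (fc x * ln (fc x / phi_delta fc \<delta> x)) else \<infinity>)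
              \<partial>lborel) < \<infinity>"
    and d: "\<exists>\<zeta>>0. (\<integral>\<^sup>+ x\<in>{0<..}.
              ennreal (max (x powr (- \<zeta> - 2)) (x powr (\<zeta> + 2)) * fc x) \<partial>lborel) < \<infinity>"
  shows "weakly_consistent (dpm_prior A \<theta> r s) fc"
proof -
  define q where "q = ext0 fc"
  have q_eq: "q x = (if 0 \<le> x then fc x else 0)" for x by (simp add: q_def ext0_def indicator_def)
  have q0: "0 \<le> q x" for x using nonneg by (simp add: q_eq)
  have qm[measurable]: "q \<in> borel_measurable borel" unfolding q_def by (rule ext0_measurable[OF cont])
  have qC: "q x \<le> max C\<^sub>f 0" for x using a_bdd by (auto simp: q_eq le_max_iff_disj)
  have qcont: "isCont q x" if x: "0 < x" for x
  proof -
    have "continuous_on {0<..} q"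
      by (rule continuous_on_cong[THEN iffD1, OF refl _ continuous_on_subset[OF cont]]) (auto simp: q_eq)
    then show ?thesis using x by (simp add: continuous_on_eq_continuous_at)
  qed
  obtain \<zeta> where z: "0 < \<zeta>" and dz: "(\<integral>\<^sup>+ x\<in>{0<..}. ennreal (max (x powr (- \<zeta> - 2)) (x powr (\<zeta> + 2)) * fc x) \<partial>lborel) < \<infinity>"
    using d by blast
  \<comment> \<open>The moment condition \<open>d\<close> enters here: the log ratios are bounded by
    multiples of \<open>env\<close>, whose square must be integrable for the one-sided law.\<close>
  have env2: "integrable (density lborel (\<lambda>x. ennreal (q x))) (\<lambda>x. (env x)\<^sup>2)"
  proof (rule integrableI_nonneg)
    have "(\<integral>\<^sup>+x. ennreal ((env x)\<^sup>2) \<partial>density lborel (\<lambda>x. ennreal (q x))) = (\<integral>\<^sup>+x. ennreal (q x) * ennreal ((env x)\<^sup>2) \<partial>lborel)"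
      by (intro nn_integral_density) auto
    also have "\<dots> \<le> (\<integral>\<^sup>+x. ennreal 4 * (ennreal (max (x powr (- \<zeta> - 2)) (x powr (\<zeta> + 2)) * q x) * indicator {0<..} x) \<partial>lborel)"
    proof (intro nn_integral_mono_AE eventually_mono[OF AE_lborel_singleton[of 0]])
      fix x :: real assume "x \<noteq> 0"
      show "ennreal (q x) * ennreal ((env x)\<^sup>2) \<le> ennreal 4 * (ennreal (max (x powr (- \<zeta> - 2)) (x powr (\<zeta> + 2)) * q x) * indicator {0<..} x)"
      proof (cases "0 < x")
        case True
        have "q x * (env x)\<^sup>2 \<le> q x * (4 * max (x powr (- \<zeta> - 2)) (x powr (\<zeta> + 2)))"
          by (intro mult_left_mono env_square_le True z q0)
        then have "ennreal (q x * (env x)\<^sup>2) \<le> ennreal (4 * (max (x powr (- \<zeta> - 2)) (x powr (\<zeta> + 2)) * q x))"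
          by (intro ennreal_leI) (simp only: mult_ac)
        then show ?thesis using True q0[of x] by (simp only: ennreal_mult' ennreal_mult'' zero_le_power2) simp
      qed (use \<open>x \<noteq> 0\<close> in \<open>simp add: q_eq\<close>)
    qed
    also have "\<dots> = ennreal 4 * (\<integral>\<^sup>+x. ennreal (max (x powr (- \<zeta> - 2)) (x powr (\<zeta> + 2)) * q x) * indicator {0<..} x \<partial>lborel)"
      by (intro nn_integral_cmult) measurable
    also have "(\<integral>\<^sup>+x. ennreal (max (x powr (- \<zeta> - 2)) (x powr (\<zeta> + 2)) * q x) * indicator {0<..} x \<partial>lborel)
       = (\<integral>\<^sup>+ x\<in>{0<..}. ennreal (max (x powr (- \<zeta> - 2)) (x powr (\<zeta> + 2)) * fc x) \<partial>lborel)"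
      by (intro nn_integral_cong) (auto simp: q_eq indicator_def)
    also have "ennreal 4 * \<dots> < \<infinity>" using dz by (simp add: ennreal_mult_less_top)
    finally show "(\<integral>\<^sup>+x. ennreal ((env x)\<^sup>2) \<partial>density lborel (\<lambda>x. ennreal (q x))) < \<infinity>" .
  qed auto
  have bm: "bayes_model (dpm_prior A \<theta> r s) dpm_density q"
    by (rule bayes_model_dpm[OF hyper alpha_prior qm q0]) (simp add: q_def dens)
  interpret bayes_model "dpm_prior A \<theta> r s" dpm_density q by (rule bm)
  have kl: kl_supported
    by (rule kl_supported_dpm[OF hyper alpha_prior bm qC _ _ qcont env2]) (use a_pos in \<open>auto simp: q_eq\<close>)
  have data: "(\<Pi>\<^sub>M i\<in>(UNIV::nat set). data_law fc) = \<Omega>"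
    by (simp only: \<Omega>_def D_def data_law_def q_def[symmetric])
  have post: "posterior (dpm_prior A \<theta> r s) X m U =
      (\<integral>\<^sup>+p. indicator {p. dpm_density p \<in> U} p * lik X m p \<partial>dpm_prior A \<theta> r s) / (\<integral>\<^sup>+p. lik X m p \<partial>dpm_prior A \<theta> r s)" for X m U
    unfolding posterior_def lik_def ..
  show ?thesis
    unfolding weakly_consistent_def data post by (rule weak_consistency[OF kl q_def])
qed

end
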